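(* Let $G=(V,E)$ be an unweighted graph on $n$ vertices, let $s,t\in V$ be two distinct vertices, and let $r\in\{1,2,\ldots,\log n\}$ be a parameter. It is possible to find the value of the minimum $(s,t)$-cut, i.e. $\min\{\mathrm{cut}_G(S): s\in S,\ t\notin S\}$, using $\tilde{O}(n^{5/3+1/r})$ cut queries in $2r+1$ rounds.
   Context: Cut-query model: the graph is accessed only via queries returning $\mathrm{cut}_G(S)$, the number of edges with exactly one endpoint in $S$, for a given $S\subseteq V$. An algorithm has round complexity $r$ if its queries are issued in $r$ rounds, queries of round $t$ depending only on answers from earlier rounds. Algorithms may be randomized. $\tilde{O}(\cdot)$ hides polylogarithmic factors in $n$. *)

theory Defs
  imports "HOL-Probability.Probability_Mass_Function"
begin

definition simple_graph :: "'v set \<Rightarrow> 'v set set \<Rightarrow> bool" where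
  "simple_graph V E \<longleftrightarrow> finite V \<and> (\<forall>e\<in>E. e \<subseteq> V \<and> card e = 2)"

definition cut :: "'v set set \<Rightarrow> 'v set \<Rightarrow> nat" where
  "cut E S = card {e \<in> E. card (e \<inter> S) = 1}"

definition min_st_cut :: "'v set \<Rightarrow> 'v set set \<Rightarrow> 'v \<Rightarrow> 'v \<Rightarrow> nat" where
  "min_st_cut V E s t = Min {cut E S | S. S \<subseteq> V \<and> s \<in> S \<and> t \<notin> S}"

text \<open>
  A deterministic cut-query algorithm sees the graph only through the history of answers:
  one list of answers per completed round, in the order in which the queries of that round
  were listed. The queries of a round depend only on the history of the earlier rounds.
\<close>

record 'v cut_algorithm =
  queries :: "nat list list \<Rightarrow> 'v set list"
  result :: "nat list list \<Rightarrow> nat"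

primrec history :: "'v cut_algorithm \<Rightarrow> 'v set set \<Rightarrow> nat \<Rightarrow> nat list list" where
  "history a E 0 = []"
| "history a E (Suc i) = history a E i @ [map (cut E) (queries a (history a E i))]"

definition round_queries :: "'v cut_algorithm \<Rightarrow> 'v set set \<Rightarrow> nat \<Rightarrow> 'v set list" where
  "round_queries a E i = queries a (history a E i)"

definition num_queries :: "'v cut_algorithm \<Rightarrow> 'v set set \<Rightarrow> nat \<Rightarrow> nat" where
  "num_queries a E R = (\<Sum>i<R. length (round_queries a E i))"

text \<open>
  A randomized algorithm is a distribution over deterministic ones (all coins are tossed in
  advance). The bound \<open>q\<close> on the total number of queries holds for every outcome of the coins,
  and the error probability is at most \<open>\<delta>\<close> on every graph. A round may be empty, so \<open>R\<close> is an
  upper bound on the number of rounds.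
\<close>

definition finds_min_st_cut ::
    "'v cut_algorithm pmf \<Rightarrow> 'v set \<Rightarrow> 'v \<Rightarrow> 'v \<Rightarrow> nat \<Rightarrow> real \<Rightarrow> real \<Rightarrow> bool" where
  "finds_min_st_cut A V s t R q \<delta> \<longleftrightarrow>
    (\<forall>E. simple_graph V E \<longrightarrow>
      (\<forall>a\<in>set_pmf A. (\<forall>i<R. \<forall>S\<in>set (round_queries a E i). S \<subseteq> V) \<and>
        real (num_queries a E R) \<le> q) \<and>
      measure_pmf.prob A {a. result a (history a E R) = min_st_cut V E s t} \<ge> 1 - \<delta>)"

end

theory Submission
  imports Defs "HOL-Probability.Product_PMF"
begin

text \<open>
  Nested samples of the vertex pairs, at rates \<open>n\<^sup>-\<^sup>i\<^sup>/\<^sup>r\<close>, are explored from the sparsest to the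
  densest. Sets that are \<open>T\<close>-edge-connected in one sample (with \<open>T\<close> about \<open>n\<^sup>2\<^sup>/\<^sup>3\<close>) are regarded as
  contracted in the next one, and by a union bound over all vertex partitions at most about
  \<open>T n\<^sup>1\<^sup>+\<^sup>1\<^sup>/\<^sup>r\<close> edges are then left to be read at each level. Edges of a
  second, independent family of samples, weighted by the inverse rates, approximate every cut up to a factor \<open>1 \<plusminus> n\<^sup>-\<^sup>1\<^sup>/\<^sup>3\<close>, by Karger's bound on the number of
  small cuts. Hence all \<open>s\<close>-\<open>t\<close> cuts of almost minimum weight exceed the minimum cut by only
  \<open>O(n\<^sup>2\<^sup>/\<^sup>3)\<close> edges. Outside a maximum flow that uses \<open>O(n\<^sup>3\<^sup>/\<^sup>2)\<close> edges each such cut has only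
  \<open>O(n\<^sup>2\<^sup>/\<^sup>3)\<close> edges, so that together they contain \<open>O(n\<^sup>5\<^sup>/\<^sup>3)\<close> edges, which are read in the
  end. A set of edges is read in two rounds: the degrees first, then each neighbourhood by
  additive group testing.
\<close>

subsection \<open>Strongly connected sets\<close>

text \<open>Let n = card V. The exponent 2/3 balances two costs. A relative error \<epsilon> forces
  \<open>T\<close> to be about 1/\<epsilon>^2, so a level leaves about n/\<epsilon>^2 edges, times
  n^(1/r). Since a minimum cut has at most n edges, near-minimum cuts exceed it by about \<epsilon>
  n, and the last stage reads about \<epsilon> n^2 edges. Both are n^(5/3) at \<epsilon> = n^(-1/3).

  The second family of samples is there because the first decides at which level a pair is
  contracted: once the first is fixed, the level sets are fixed, and the second is still fresh
  randomness. Both samples of a level are confined to the same uncontracted pairs and are read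
  together, so independence costs no rounds.

  With two rounds per stage, r stages fit into 2 r + 1 rounds: r - 1 sampling levels and the final
  reading. For r = 1 no level remains, but n^(8/3) queries pay for reading the whole graph.

  With the samples fixed, the algorithm is written as a plan in terms of the hidden edge set
  \<open>E\<close>; the obligation is that each step of the plan is the same for all graphs with the
  same earlier answers.\<close>

definition pairs :: "'v set \<Rightarrow> 'v set set" where
  "pairs V = {e. e \<subseteq> V \<and> card e = 2}"

definition bd :: "'v set set \<Rightarrow> 'v set \<Rightarrow> 'v set set" where
  "bd E S = {e \<in> E. card (e \<inter> S) = 1}"

lemma cut_eq_card_bd: "cut E S = card (bd E S)"
  by (simp add: cut_def bd_def)

lemma finite_pairs: "finite V \<Longrightarrow> finite (pairs V)"
  by (rule finite_subset[of _ "Pow V"]) (auto simp: pairs_def)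

lemma card_pairs_le: "finite V \<Longrightarrow> card (pairs V) \<le> card V ^ 2"
proof -
  assume V: "finite V"
  have "pairs V \<subseteq> (\<lambda>(x,y). {x,y}) ` (V \<times> V)"
    by (auto simp: pairs_def card_2_iff)
  then have "card (pairs V) \<le> card (V \<times> V)"
    using V by (meson card_image_le card_mono finite_SigmaI finite_imageI le_trans)
  then show ?thesis by (simp add: card_cartesian_product power2_eq_square)
qed

lemma simple_graph_iff: "simple_graph V E \<longleftrightarrow> finite V \<and> E \<subseteq> pairs V"
  by (auto simp: simple_graph_def pairs_def)

lemma cross_iff: "card e = 2 \<Longrightarrow> card (e \<inter> S) = 1 \<longleftrightarrow> e \<inter> S \<noteq> {} \<and> e - S \<noteq> {}"
proof -
  assume "card e = 2"
  then obtain a b where "e = {a,b}" "a \<noteq> b" by (auto simp: card_2_iff)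
  then show ?thesis by (cases "a \<in> S"; cases "b \<in> S") auto
qed

lemma bd_iff: "card e = 2 \<Longrightarrow> e \<in> bd E S \<longleftrightarrow> e \<in> E \<and> e \<inter> S \<noteq> {} \<and> e - S \<noteq> {}"
  using cross_iff[of e S] by (auto simp: bd_def)

lemma bd_subset: "bd E S \<subseteq> E"
  by (auto simp: bd_def)

lemma bd_mono: "E \<subseteq> F \<Longrightarrow> bd E S \<subseteq> bd F S"
  by (auto simp: bd_def)

text \<open>Both ends of the counted edges lie in \<open>C\<close>: this is t-edge-connectivity of
  the induced subgraph, the strong connectivity of Benczur and Karger. The empty set and singletons
  satisfy it vacuously.\<close>

definition tconn :: "nat \<Rightarrow> 'v set set \<Rightarrow> 'v set \<Rightarrow> bool" where
  "tconn t E C \<longleftrightarrow>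
    (\<forall>S. S \<inter> C \<noteq> {} \<longrightarrow> C - S \<noteq> {} \<longrightarrow> t \<le> card (bd {e \<in> E. e \<subseteq> C} S))"

text \<open>The witness is confined to \<open>V\<close> so that recursive decompositions can apply
  the notion to each part of a split vertex set.\<close>

definition inside :: "'v set \<Rightarrow> nat \<Rightarrow> 'v set set \<Rightarrow> 'v set \<Rightarrow> bool" where
  "inside V t E e \<longleftrightarrow> (\<exists>D\<subseteq>V. e \<subseteq> D \<and> tconn t E D)"

lemma tconn_mono: "finite F \<Longrightarrow> E \<subseteq> F \<Longrightarrow> tconn t E C \<Longrightarrow> tconn t F C"
proof -
  assume F: "finite F" "E \<subseteq> F" and t: "tconn t E C"
  have "card (bd {e \<in> E. e \<subseteq> C} S) \<le> card (bd {e \<in> F. e \<subseteq> C} S)" for S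
    using F by (intro card_mono finite_subset[OF bd_subset] bd_mono) auto
  then show ?thesis using t unfolding tconn_def by (meson le_trans)
qed

lemma inside_mono: "finite F \<Longrightarrow> E \<subseteq> F \<Longrightarrow> inside V t E e \<Longrightarrow> inside V t F e"
  unfolding inside_def using tconn_mono by blast

lemma inside_subset: "e \<subseteq> e' \<Longrightarrow> inside V t E e' \<Longrightarrow> inside V t E e"
  unfolding inside_def by blast

lemma inside_refl: "x \<in> V \<Longrightarrow> inside V t E {x}"
  unfolding inside_def tconn_def by (intro exI[of _ "{x}"]) auto

lemma tconn_bound:
  assumes "finite E" "tconn t E D" "D \<subseteq> C" "x \<in> D" "y \<in> D" "x \<in> S" "y \<notin> S"
  shows "t \<le> card (bd {e \<in> E. e \<subseteq> C} S)"
proof -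
  have "t \<le> card (bd {e \<in> E. e \<subseteq> D} S)"
    using assms(2,4-) unfolding tconn_def by blast
  also have "\<dots> \<le> card (bd {e \<in> E. e \<subseteq> C} S)"
    using assms(1,3) by (intro card_mono finite_subset[OF bd_subset] bd_mono) auto
  finally show ?thesis .
qed

lemma tconn_split:
  assumes "finite E" "tconn t E D" "D \<subseteq> C" "x \<in> D" "y \<in> D" "(x \<in> S) \<noteq> (y \<in> S)"
  shows "t \<le> card (bd {e \<in> E. e \<subseteq> C} S)"
  using assms tconn_bound[of E t D C x y S] tconn_bound[of E t D C y x S] by blast

text \<open>Connected sets sharing the vertex y have a connected union: a set that splits the union
  separates y from some vertex, and that vertex lies in one of the two sets together with y.\<close>

lemma inside_trans:
  assumes "finite E" "inside V t E {x,y}" "inside V t E {y,z}"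
  shows "inside V t E {x,z}"
proof -
  obtain D1 D2 where D: "D1 \<subseteq> V" "x \<in> D1" "y \<in> D1" "tconn t E D1"
    "D2 \<subseteq> V" "y \<in> D2" "z \<in> D2" "tconn t E D2"
    using assms unfolding inside_def by auto
  have "tconn t E (D1 \<union> D2)"
    unfolding tconn_def
  proof (intro allI impI)
    fix S assume "S \<inter> (D1 \<union> D2) \<noteq> {}" "D1 \<union> D2 - S \<noteq> {}"
    then obtain a b where ab: "a \<in> S" "a \<in> D1 \<union> D2" "b \<notin> S" "b \<in> D1 \<union> D2" by blast
    then consider "a \<in> D1" "(a \<in> S) \<noteq> (y \<in> S)" | "a \<in> D2" "(a \<in> S) \<noteq> (y \<in> S)"
      | "b \<in> D1" "(b \<in> S) \<noteq> (y \<in> S)" | "b \<in> D2" "(b \<in> S) \<noteq> (y \<in> S)" by blast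
    then show "t \<le> card (bd {e \<in> E. e \<subseteq> D1 \<union> D2} S)"
      by cases (use D assms(1) in \<open>blast intro: tconn_split\<close>)+
  qed
  then show ?thesis using D unfolding inside_def by (intro exI[of _ "D1 \<union> D2"]) auto
qed

text \<open>Strong components partition \<open>V\<close>. Encoding the partition as a labelling by
  vertices allows a union bound over only n^n candidates. The label of a vertex is a
  \<open>SOME\<close>-representative; equivalent vertices get the same one because the predicates
  under \<open>SOME\<close> coincide.\<close>

lemma inside_labels:
  assumes "finite E" "finite V" "E \<subseteq> pairs V"
  obtains f where "f \<in> V \<rightarrow>\<^sub>E V" "\<And>e. e \<in> pairs V \<Longrightarrow> inside V t E e \<longleftrightarrow> card (f ` e) \<le> 1"
proof -
  define f where "f = (\<lambda>x\<in>V. SOME y. y \<in> V \<and> inside V t E {x,y})"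
  have ex: "\<exists>y. y \<in> V \<and> inside V t E {x,y}" if "x \<in> V" for x
    using that inside_refl[OF that] by (intro exI[of _ x]) auto
  have fV: "f x \<in> V" and fi: "inside V t E {x, f x}" if "x \<in> V" for x
    using someI_ex[OF ex[OF that]] that by (auto simp: f_def)
  have eq: "inside V t E {x,y} \<longleftrightarrow> f x = f y" if "x \<in> V" "y \<in> V" for x y
  proof
    assume h: "inside V t E {x,y}"
    have "inside V t E {x,z} \<longleftrightarrow> inside V t E {y,z}" for z
      using inside_trans[OF assms(1) h, of z] inside_trans[OF assms(1), of V t y x z] h
      by (auto simp: insert_commute)
    then show "f x = f y" using that by (simp add: f_def)
  next
    assume "f x = f y"
    then show "inside V t E {x,y}"
      using fi[OF that(1)] fi[OF that(2)] inside_trans[OF assms(1), of V t x "f x" y]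
      by (simp add: insert_commute)
  qed
  show ?thesis
  proof
    show "f \<in> V \<rightarrow>\<^sub>E V" using fV by (auto simp: f_def)
  next
    fix e assume "e \<in> pairs V"
    then obtain x y where e: "e = {x,y}" "x \<in> V" "y \<in> V" by (auto simp: pairs_def card_2_iff)
    show "inside V t E e \<longleftrightarrow> card (f ` e) \<le> 1"
      using eq[OF e(2,3)] e by (cases "f x = f y") auto
  qed
qed

text \<open>Splitting along cuts with fewer than t edges can happen at most card V - 1 times, and
  every weak edge is cut at some split.\<close>

lemma card_weak_edges_le:
  assumes "finite V" "finite E"
  shows "card {e \<in> E. card e = 2 \<and> e \<subseteq> V \<and> \<not> inside V t E e} \<le> t * (card V - 1)"
  using assms(1)
proof (induction "card V" arbitrary: V rule: less_induct)
  case less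
  let ?W = "\<lambda>V. {e \<in> E. card e = 2 \<and> e \<subseteq> V \<and> \<not> inside V t E e}"
  show ?case
  proof (cases "tconn t E V")
    case True
    then have "?W V = {}" unfolding inside_def by auto
    then show ?thesis by (simp only: card.empty)
  next
    case False
    then obtain S where S: "S \<inter> V \<noteq> {}" "V - S \<noteq> {}" "card (bd {e \<in> E. e \<subseteq> V} S) < t"
      unfolding tconn_def by (meson not_le)
    let ?A = "V \<inter> S" and ?B = "V - S"
    have cV: "card V = card ?A + card ?B"
      using less.prems by (metis card_Diff_subset_Int card_Int_Diff finite_Int inf_commute)
    have pos: "card ?A > 0" "card ?B > 0"
      using S less.prems by (auto simp: card_gt_0_iff inf_commute)
    have IH: "card (?W ?A) \<le> t * (card ?A - 1)" "card (?W ?B) \<le> t * (card ?B - 1)"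
      using less.hyps[of ?A] less.hyps[of ?B] less.prems cV pos by auto
    have sub: "?W V \<subseteq> ?W ?A \<union> ?W ?B \<union> bd {e \<in> E. e \<subseteq> V} S"
    proof
      fix e assume e: "e \<in> ?W V"
      \<comment> \<open>A witness inside a part is also a witness inside \<open>V\<close>.\<close>
      have "\<not> inside ?A t E e" "\<not> inside ?B t E e"
        using e unfolding inside_def by blast+
      then show "e \<in> ?W ?A \<union> ?W ?B \<union> bd {e \<in> E. e \<subseteq> V} S"
        using e cross_iff[of e S] by (auto simp: bd_def)
    qed
    have fin: "finite (?W ?A \<union> ?W ?B \<union> bd {e \<in> E. e \<subseteq> V} S)"
      using assms(2) by (auto simp: bd_def)
    have "card (?W V) \<le> card (?W ?A) + card (?W ?B) + card (bd {e \<in> E. e \<subseteq> V} S)"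
      by (rule order_trans[OF card_mono[OF fin sub]])
         (meson add_le_mono card_Un_le le_refl order_trans)
    also have "\<dots> \<le> t * (card ?A - 1) + t * (card ?B - 1) + t"
      using IH S(3) by linarith
    also have "\<dots> = t * (card V - 1)"
      using pos cV by (cases "card ?A"; cases "card ?B") (auto simp: algebra_simps)
    finally show ?thesis .
  qed
qed

text \<open>
  For a set of low connectivity in \<open>E\<close> to stay so in a sample \<open>E'\<close>, only the cuts of one recursive
  decomposition of \<open>V\<close> have to remain small, instead of all exponentially many cuts.
\<close>

lemma split_family:
  assumes "finite V" "finite E"
  shows "\<exists>\<F>. finite \<F> \<and> card \<F> \<le> card V - 1 \<and> (\<forall>X\<in>\<F>. X \<subseteq> E \<and> card X < k) \<and>
    (\<forall>E' t. E' \<subseteq> E \<longrightarrow> (\<forall>X\<in>\<F>. card (X \<inter> E') < t) \<longrightarrow>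
       (\<forall>D\<subseteq>V. D \<noteq> {} \<longrightarrow> tconn t E' D \<longrightarrow> inside V k E D))"
  using assms(1)
proof (induction "card V" arbitrary: V rule: less_induct)
  case less
  show ?case
  proof (cases "tconn k E V")
    case True
    then show ?thesis unfolding inside_def by (intro exI[of _ "{}"]) auto
  next
    case False
    then obtain S where S: "S \<inter> V \<noteq> {}" "V - S \<noteq> {}" "card (bd {e \<in> E. e \<subseteq> V} S) < k"
      unfolding tconn_def by (meson not_le)
    let ?A = "V \<inter> S" and ?B = "V - S" and ?X = "bd {e \<in> E. e \<subseteq> V} S"
    have cV: "card V = card ?A + card ?B"
      using less.prems by (metis card_Diff_subset_Int card_Int_Diff finite_Int inf_commute)
    have pos: "card ?A > 0" "card ?B > 0"
      using S less.prems by (auto simp: card_gt_0_iff inf_commute)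
    obtain \<F>1 where F1: "finite \<F>1" "card \<F>1 \<le> card ?A - 1" "\<forall>X\<in>\<F>1. X \<subseteq> E \<and> card X < k"
      "\<And>E' t D. E' \<subseteq> E \<Longrightarrow> (\<forall>X\<in>\<F>1. card (X \<inter> E') < t) \<Longrightarrow>
         D\<subseteq>?A \<Longrightarrow> D \<noteq> {} \<Longrightarrow> tconn t E' D \<Longrightarrow> inside ?A k E D"
      using less.hyps[of ?A] less.prems cV pos by auto
    obtain \<F>2 where F2: "finite \<F>2" "card \<F>2 \<le> card ?B - 1" "\<forall>X\<in>\<F>2. X \<subseteq> E \<and> card X < k"
      "\<And>E' t D. E' \<subseteq> E \<Longrightarrow> (\<forall>X\<in>\<F>2. card (X \<inter> E') < t) \<Longrightarrow>
         D\<subseteq>?B \<Longrightarrow> D \<noteq> {} \<Longrightarrow> tconn t E' D \<Longrightarrow> inside ?B k E D"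
      using less.hyps[of ?B] less.prems cV pos by auto
    show ?thesis
    proof (intro exI[of _ "insert ?X (\<F>1 \<union> \<F>2)"] conjI allI impI)
      show "finite (insert ?X (\<F>1 \<union> \<F>2))" using F1 F2 by auto
      have "card (insert ?X (\<F>1 \<union> \<F>2)) \<le> Suc (card \<F>1 + card \<F>2)"
        using F1(1) F2(1) card_Un_le[of \<F>1 \<F>2] by (simp add: card_insert_if)
      then show "card (insert ?X (\<F>1 \<union> \<F>2)) \<le> card V - 1"
        using F1(2) F2(2) pos cV by linarith
      show "\<forall>X\<in>insert ?X (\<F>1 \<union> \<F>2). X \<subseteq> E \<and> card X < k"
        using F1(3) F2(3) S(3) by (auto simp: bd_def)
    next
      fix E' t D
      assume h: "E' \<subseteq> E" "\<forall>X\<in>insert ?X (\<F>1 \<union> \<F>2). card (X \<inter> E') < t" "D \<subseteq> V" "D \<noteq> {}" "tconn t E' D"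
      have "finite E'" using h(1) assms(2) by (rule finite_subset)
      have "bd {e \<in> E'. e \<subseteq> V} S = ?X \<inter> E'" using h(1) by (auto simp: bd_def)
      then have "card (bd {e \<in> E'. e \<subseteq> V} S) < t" using h(2) by simp
      \<comment> \<open>The sampled cut has fewer than t edges, so it cannot separate two vertices
        of a set that is t-connected in the sample.\<close>
      then have "D \<subseteq> ?A \<or> D \<subseteq> ?B"
      proof -
        have "\<not> (\<exists>x\<in>D. \<exists>y\<in>D. x \<in> S \<and> y \<notin> S)"
          using tconn_bound[OF \<open>finite E'\<close> h(5,3), of _ _ S] \<open>card (bd {e \<in> E'. e \<subseteq> V} S) < t\<close>
          by (metis not_le)
        then show ?thesis using h(3) by blast
      qed
      then show "inside V k E D"
      proof
        assume "D \<subseteq> ?A"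
        then have "inside ?A k E D" using F1(4)[of E' t D] h by blast
        then show ?thesis unfolding inside_def by blast
      next
        assume "D \<subseteq> ?B"
        then have "inside ?B k E D" using F2(4)[of E' t D] h by blast
        then show ?thesis unfolding inside_def by blast
      qed
    qed
  qed
qed

text \<open>An edge of \<open>K\<close> crossing S lies in a k-connected set D that S splits, and
  all edges within D belong to \<open>K\<close> themselves. So the strong edges form a graph,
  possibly disconnected, whose nonempty cuts are all heavy, as the cut counting requires.\<close>

lemma inside_cut_ge:
  fixes E :: "'v set set" and k :: nat
  assumes "finite E" "E \<subseteq> pairs V"
  defines "K \<equiv> {e \<in> E. inside V k E e}"
  shows "bd K S = {} \<or> k \<le> card (bd K S)"
proof (cases "bd K S = {}")
  case False
  then obtain e where e: "e \<in> E" "inside V k E e" "card (e \<inter> S) = 1" by (auto simp: K_def bd_def)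
  then obtain D where D: "D \<subseteq> V" "e \<subseteq> D" "tconn k E D" unfolding inside_def by blast
  have "e \<inter> S \<noteq> {}" "e - S \<noteq> {}"
    using e assms(2) cross_iff[of e S] by (auto simp: pairs_def)
  then have "S \<inter> D \<noteq> {}" "D - S \<noteq> {}" using D(2) by blast+
  then have "k \<le> card (bd {e \<in> E. e \<subseteq> D} S)" using D(3) unfolding tconn_def by blast
  also have "\<dots> \<le> card (bd K S)"
    using D assms(1) unfolding K_def
    by (intro card_mono finite_subset[OF bd_subset] bd_mono) (auto simp: inside_def)
  finally show ?thesis by simp
qed simp

text \<open>
  A cut that splits an old component is large anyway, so only the edges between the old components
  decide which components merge.
\<close>

lemma inside_determined:
  fixes F F' G G' :: "'v set set"
  assumes fin: "finite G" "finite G'" and sub: "F \<subseteq> G" "F' \<subseteq> G'" and pr: "G \<subseteq> pairs V"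
    and old: "\<And>x y. x \<in> V \<Longrightarrow> y \<in> V \<Longrightarrow> inside V t F {x,y} \<longleftrightarrow> inside V t F' {x,y}"
    and new: "\<And>e. e \<in> pairs V \<Longrightarrow> \<not> inside V t F e \<Longrightarrow> e \<in> G \<longleftrightarrow> e \<in> G'"
    and ins: "inside V t G {x,y}"
  shows "inside V t G' {x,y}"
proof -
  have finF: "finite F" "finite F'" using fin sub by (auto intro: finite_subset)
  obtain C where C: "C \<subseteq> V" "x \<in> C" "y \<in> C" "tconn t G C" using ins unfolding inside_def by auto
  \<comment> \<open>Saturating C under the old components guarantees that any set that is
    t-connected in \<open>F'\<close> and meets D lies inside D, so that its edges count for
    D.\<close>
  define D where "D = {z \<in> V. \<exists>x\<in>C. inside V t F {x,z}}"
  have CD: "C \<subseteq> D"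
  proof
    fix z assume "z \<in> C"
    moreover have "z \<in> V" "inside V t F {z,z}" using \<open>z \<in> C\<close> C(1) inside_refl[of z V t F] by auto
    ultimately show "z \<in> D" unfolding D_def by blast
  qed
  have closed: "b \<in> D" if a: "a \<in> D" and b: "b \<in> V" "inside V t F {a,b}" for a b
  proof -
    obtain x where "x \<in> C" "inside V t F {x,a}" using a by (auto simp: D_def)
    then have "inside V t F {x,b}" using b(2) inside_trans[OF finF(1)] by blast
    then show ?thesis using \<open>x \<in> C\<close> b(1) by (auto simp: D_def)
  qed
  have "tconn t G' D"
    unfolding tconn_def
  proof (intro allI impI)
    fix S assume S: "S \<inter> D \<noteq> {}" "D - S \<noteq> {}"
    show "t \<le> card (bd {e \<in> G'. e \<subseteq> D} S)"
    proof (cases "\<exists>a b. a \<in> D \<and> b \<in> D \<and> a \<in> S \<and> b \<notin> S \<and> inside V t F {a,b}")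
      case True
      then obtain a b where ab: "a \<in> D" "b \<in> D" "a \<in> S" "b \<notin> S" "inside V t F {a,b}" by blast
      then have "inside V t F' {a,b}" using old by (auto simp: D_def)
      then obtain D' where D': "D' \<subseteq> V" "a \<in> D'" "b \<in> D'" "tconn t F' D'" unfolding inside_def by auto
      have "D' \<subseteq> D"
      proof
        fix z assume z: "z \<in> D'"
        then have "inside V t F' {a,z}" using D' unfolding inside_def by blast
        then have "inside V t F {a,z}" using old ab z D' by blast
        then show "z \<in> D" using closed ab z D' by blast
      qed
      moreover have "tconn t G' D'" using D'(4) tconn_mono fin(2) sub(2) by blast
      ultimately show ?thesis using tconn_bound[OF fin(2)] D' ab by blast
    next
      case False
      \<comment> \<open>S splits no old component within D, so it still separates two vertices of C,
        and all edges of \<open>G\<close> crossing it run between old components, where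
        \<open>G\<close> and \<open>G'\<close> agree.\<close>
      obtain a b where "a \<in> D" "a \<in> S" "b \<in> D" "b \<notin> S" using S by blast
      then obtain a' b' where ab': "a' \<in> C" "inside V t F {a',a}" "b' \<in> C" "inside V t F {b',b}"
        by (auto simp: D_def)
      have ab: "a' \<in> S" "b' \<notin> S"
        using False ab' CD \<open>a \<in> D\<close> \<open>a \<in> S\<close> \<open>b \<in> D\<close> \<open>b \<notin> S\<close> by (metis insert_commute subset_iff)+
      have "t \<le> card (bd {e \<in> G. e \<subseteq> D} S)"
        using tconn_bound[OF fin(1) C(4) CD] ab ab' by blast
      also have "bd {e \<in> G. e \<subseteq> D} S \<subseteq> bd {e \<in> G'. e \<subseteq> D} S"
      proof
        fix e assume e: "e \<in> bd {e \<in> G. e \<subseteq> D} S"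
        then have e': "e \<in> G" "e \<subseteq> D" "card (e \<inter> S) = 1" by (auto simp: bd_def)
        then have ep: "e \<in> pairs V" using pr by blast
        then obtain p q where pq: "p \<in> e" "p \<in> S" "q \<in> e" "q \<notin> S"
          using e'(3) cross_iff[of e S] by (auto simp: pairs_def)
        have "\<not> inside V t F e"
        proof
          assume "inside V t F e"
          then have "inside V t F {p,q}" by (rule inside_subset[rotated]) (use pq in auto)
          then show False using False pq e' by blast
        qed
        then show "e \<in> bd {e \<in> G'. e \<subseteq> D} S" using new[OF ep] e' by (auto simp: bd_def)
      qed
      then have "card (bd {e \<in> G. e \<subseteq> D} S) \<le> card (bd {e \<in> G'. e \<subseteq> D} S)"
        using fin by (intro card_mono) (auto simp: bd_def)
      finally show ?thesis .
    qed
  qed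
  moreover have "D \<subseteq> V" by (auto simp: D_def)
  ultimately show ?thesis using CD C unfolding inside_def by blast
qed

subsection \<open>Counting cut projections\<close>

lemma binomial_le_power_nat: "n choose a \<le> n ^ a"
  by (cases "a \<le> n") (auto simp: binomial_le_pow binomial_eq_0)

text \<open>Karger's contraction argument as an induction without randomness: \<open>f\<close> sends
  a vertex to its contracted super-vertex. A small cut contains at most a fraction 2 \<alpha> / (M +
  1) of the crossing edges and survives the contraction of any other one; averaging over the
  contracted edge reduces the count to that for M. Cuts are counted as edge sets because, in a
  disconnected graph, many S have the same boundary.\<close>

lemma karger_count_contracted:
  fixes K :: "'v set set" and f :: "'v \<Rightarrow> 'v"
  assumes V: "finite V" and K: "K \<subseteq> pairs V"
    and heavy: "\<And>S. bd K S = {} \<or> \<kappa> \<le> card (bd K S)"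
    and \<kappa>: "\<kappa> > 0"
    and M: "2 * \<alpha> \<le> M"
    and ni: "card {x \<in> f ` V. bd K (f -` {x}) \<noteq> {}} \<le> M"
  shows "card {X. \<exists>T. X = bd K (f -` T) \<and> card X \<le> \<alpha> * \<kappa>} \<le> 2 ^ (2 * \<alpha>) * (M choose (2 * \<alpha>))"
  using M ni
proof (induction M arbitrary: f rule: dec_induct)
  case base
  let ?I = "{x \<in> f ` V. bd K (f -` {x}) \<noteq> {}}"
  have "{X. \<exists>T. X = bd K (f -` T) \<and> card X \<le> \<alpha> * \<kappa>} \<subseteq> (\<lambda>T. bd K (f -` T)) ` Pow ?I"
  proof
    fix X assume "X \<in> {X. \<exists>T. X = bd K (f -` T) \<and> card X \<le> \<alpha> * \<kappa>}"
    then obtain T where T: "X = bd K (f -` T)" by auto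
    \<comment> \<open>Labels without crossing edges do not affect the boundary, so only subsets of
      \<open>?I\<close> matter.\<close>
    have "e \<in> bd K (f -` T) \<longleftrightarrow> e \<in> bd K (f -` (T \<inter> ?I))" for e
    proof (cases "e \<in> K")
      case True
      then obtain u v where e: "e = {u,v}" "u \<noteq> v" "u \<in> V" "v \<in> V"
        using K by (auto simp: pairs_def card_2_iff)
      have c2: "card e = 2" using e by auto
      show ?thesis
      proof (cases "f u = f v")
        case True
        then show ?thesis using e c2 by (auto simp: bd_iff)
      next
        case False
        then have "e \<in> bd K (f -` {f u})" "e \<in> bd K (f -` {f v})"
          using e \<open>e \<in> K\<close> c2 by (auto simp: bd_iff)
        then have "f u \<in> ?I" "f v \<in> ?I" using e by auto
        then show ?thesis using e c2 by (auto simp: bd_iff)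
      qed
    qed (auto simp: bd_def)
    then have "X = bd K (f -` (T \<inter> ?I))" using T by blast
    moreover have "T \<inter> ?I \<in> Pow ?I" by blast
    ultimately show "X \<in> (\<lambda>T. bd K (f -` T)) ` Pow ?I" by (rule image_eqI)
  qed
  then have "card {X. \<exists>T. X = bd K (f -` T) \<and> card X \<le> \<alpha> * \<kappa>} \<le> card (Pow ?I)"
    using V by (intro surj_card_le) auto
  also have "\<dots> = 2 ^ card ?I" using V by (simp add: card_Pow)
  also have "\<dots> \<le> 2 ^ (2 * \<alpha>)" using base by (intro power_increasing) auto
  finally show ?case by simp
next
  case (step M)
  let ?I = "\<lambda>f. {x \<in> f ` V. bd K (f -` {x}) \<noteq> {}}"
  let ?N = "\<lambda>f. {X. \<exists>T. X = bd K (f -` T) \<and> card X \<le> \<alpha> * \<kappa>}"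
  let ?B = "2 ^ (2 * \<alpha>) * (M choose (2 * \<alpha>))"
  have finK: "finite K" using V K finite_pairs finite_subset by blast
  have finN: "finite (?N f)" for f :: "'v \<Rightarrow> 'v"
    by (rule finite_subset[of _ "Pow K"]) (use finK bd_subset in auto)
  show ?case
  proof (cases "card (?I f) \<le> M")
    case True
    have "(M choose (2*\<alpha>)) \<le> (Suc M choose (2*\<alpha>))" by (cases "2*\<alpha>") auto
    then show ?thesis using step.IH[OF True] by (meson le_trans mult_le_mono2)
  next
    case False
    then have cI: "card (?I f) = Suc M" using step.prems by linarith
    define cr where "cr = {e \<in> K. card (f ` e) = 2}"
    have fincr: "finite cr" using finK by (simp add: cr_def)
    have mem: "e \<in> bd K (f -` {x}) \<longleftrightarrow> e \<in> cr \<and> x \<in> f ` e" for e x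
    proof (cases "e \<in> K")
      case True
      then obtain u v where e: "e = {u,v}" "u \<noteq> v" using K by (auto simp: pairs_def card_2_iff)
      then have c2: "card e = 2" by auto
      show ?thesis using e True by (cases "f u = f v") (auto simp: bd_iff cr_def)
    qed (auto simp: bd_def cr_def)
    \<comment> \<open>Every label in \<open>?I f\<close> is a nonempty cut by itself, hence has at
      least \<kappa> edges; a crossing edge is counted for at most two labels.\<close>
    have "Suc M * \<kappa> \<le> (\<Sum>x\<in>?I f. card (bd K (f -` {x})))"
      using heavy sum_bounded_below[of "?I f" \<kappa> "\<lambda>x. card (bd K (f -` {x}))"] cI by fastforce
    also have "\<dots> = (\<Sum>x\<in>?I f. \<Sum>e\<in>cr. if x \<in> f ` e then 1 else 0)"
    proof (intro sum.cong refl)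
      fix x
      have "bd K (f -` {x}) = {e \<in> cr. x \<in> f ` e}" using mem by blast
      then show "card (bd K (f -` {x})) = (\<Sum>e\<in>cr. if x \<in> f ` e then 1 else 0)"
        using fincr by (simp add: sum.If_cases Int_def)
    qed
    also have "\<dots> = (\<Sum>e\<in>cr. \<Sum>x\<in>?I f. if x \<in> f ` e then 1 else 0)" by (rule sum.swap)
    also have "\<dots> = (\<Sum>e\<in>cr. card (?I f \<inter> f ` e))"
      using V by (intro sum.cong refl) (simp add: sum.If_cases Int_def)
    also have "\<dots> \<le> (\<Sum>e\<in>cr. 2)"
    proof (intro sum_mono)
      fix e assume "e \<in> cr"
      then have "card (f ` e) = 2" by (simp add: cr_def)
      then show "card (?I f \<inter> f ` e) \<le> 2"
        using card_mono[of "f ` e" "?I f \<inter> f ` e"] card.infinite[of "f ` e"] by fastforce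
    qed
    finally have m: "Suc M * \<kappa> \<le> 2 * card cr" by simp
    have contr: "card {X \<in> ?N f. e \<notin> X} \<le> ?B" if e: "e \<in> cr" for e
    proof -
      have "card e = 2" "e \<subseteq> V" "card (f ` e) = 2" using e K by (auto simp: cr_def pairs_def)
      then obtain a b where ab: "e = {a,b}" by (auto simp: card_2_iff[of e])
      have "f a \<noteq> f b" using \<open>card (f ` e) = 2\<close> ab by (cases "f a = f b") auto
      with ab \<open>e \<subseteq> V\<close> \<open>card e = 2\<close>
      have ab: "e = {a,b}" "a \<in> V" "b \<in> V" "f a \<noteq> f b" "card e = 2" by auto
      \<comment> \<open>Contracting e relabels \<open>f a\<close> as \<open>f b\<close>: the label
        \<open>f a\<close> disappears, and the cuts of \<open>f\<close> that avoid e remain cuts of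
        \<open>g\<close>.\<close>
      define g where "g = (\<lambda>v. if f v = f a then f b else f v)"
      have "?I g \<subseteq> ?I f - {f a}"
      proof
        fix x assume x: "x \<in> ?I g"
        then have xa: "x \<noteq> f a" using ab by (auto simp: g_def)
        have "x \<in> f ` V" using x ab by (auto simp: g_def)
        moreover have "bd K (f -` {x}) \<noteq> {}"
        proof (cases "x = f b")
          case True
          then show ?thesis using mem[of e x] e ab by auto
        next
          case False
          then have "g -` {x} = f -` {x}" using xa by (auto simp: g_def)
          then show ?thesis using x by auto
        qed
        ultimately show "x \<in> ?I f - {f a}" using xa by auto
      qed
      then have "card (?I g) \<le> card (?I f - {f a})" using V by (intro card_mono) auto
      also have "\<dots> = M"
      proof -
        have "e \<in> bd K (f -` {f a})" using mem[of e "f a"] e ab by auto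
        then have "f a \<in> ?I f" using ab by auto
        then show ?thesis using cI V by simp
      qed
      finally have "card (?N g) \<le> ?B" by (rule step.IH)
      moreover have "{X \<in> ?N f. e \<notin> X} \<subseteq> ?N g"
      proof
        fix X assume X: "X \<in> {X \<in> ?N f. e \<notin> X}"
        then obtain T where T: "X = bd K (f -` T)" "card X \<le> \<alpha> * \<kappa>" by auto
        have "f a \<in> T \<longleftrightarrow> f b \<in> T"
          using X T(1) ab e by (auto simp: bd_iff cr_def)
        then have "g -` T = f -` T" by (auto simp: g_def split: if_splits)
        then show "X \<in> ?N g" using T by (intro CollectI exI[of _ T]) simp
      qed
      ultimately show ?thesis using card_mono[OF finN[of g]] order_trans by blast
    qed
    \<comment> \<open>Double counting of the pairs of a small cut X and a crossing edge outside
      X.\<close>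
    have "card (?N f) * (card cr - \<alpha> * \<kappa>) = (\<Sum>X\<in>?N f. card cr - \<alpha> * \<kappa>)" by simp
    also have "\<dots> \<le> (\<Sum>X\<in>?N f. card (cr - X))"
    proof (intro sum_mono)
      fix X assume "X \<in> ?N f"
      then have "finite X" "card X \<le> \<alpha> * \<kappa>" using finK bd_subset[of K] by (auto intro: finite_subset)
      then show "card cr - \<alpha> * \<kappa> \<le> card (cr - X)" using diff_card_le_card_Diff[of X cr] by linarith
    qed
    also have "\<dots> = (\<Sum>X\<in>?N f. \<Sum>e\<in>cr. if e \<notin> X then 1 else 0)"
      using fincr by (intro sum.cong refl) (simp add: sum.If_cases Int_def set_diff_eq)
    also have "\<dots> = (\<Sum>e\<in>cr. \<Sum>X\<in>?N f. if e \<notin> X then 1 else 0)" by (rule sum.swap)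
    also have "\<dots> = (\<Sum>e\<in>cr. card {X \<in> ?N f. e \<notin> X})"
      using finN[of f] by (intro sum.cong refl) (simp add: sum.If_cases Int_def)
    also have "\<dots> \<le> card cr * ?B" using sum_bounded_above[of cr "\<lambda>e. card {X \<in> ?N f. e \<notin> X}" ?B] contr by simp
    finally have avg: "card (?N f) * (card cr - \<alpha> * \<kappa>) \<le> card cr * ?B" .
    have lt: "2 * \<alpha> < Suc M" using step.hyps by simp
    have "real (card (?N f)) * (real (Suc M) - 2 * \<alpha>) \<le> real (Suc M) * real ?B"
    proof -
      let ?m = "real (card cr)" and ?n = "real (card (?N f))"
      have mm: "real (Suc M) * real \<kappa> \<le> 2 * ?m" using of_nat_mono[OF m, where ?'a = real] by (simp add: algebra_simps)
      have "real \<alpha> * real \<kappa> * 2 < real (Suc M) * real \<kappa>"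
      proof -
        have "real (2 * \<alpha>) * real \<kappa> < real (Suc M) * real \<kappa>"
          using lt \<kappa> by (intro mult_strict_right_mono) (simp_all only: of_nat_less_iff of_nat_0_less_iff)
        then show ?thesis by simp
      qed
      then have "real (\<alpha> * \<kappa>) < ?m" using mm by simp
      then have le: "\<alpha> * \<kappa> \<le> card cr" and mpos: "?m > 0" by linarith+
      have "?n * (?m - real \<alpha> * real \<kappa>) = real (card (?N f) * (card cr - \<alpha> * \<kappa>))"
        using le by (simp only: of_nat_mult of_nat_diff)
      also have "\<dots> \<le> ?m * real ?B"
        using avg by (simp only: of_nat_le_iff flip: of_nat_mult)
      finally have "?n * (?m - real \<alpha> * real \<kappa>) \<le> ?m * real ?B" .
      then have "?n * ((?m - real \<alpha> * real \<kappa>) / ?m) \<le> real ?B"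
        using mpos by (simp add: field_simps)
      have ratio: "(real (Suc M) - 2 * \<alpha>) / real (Suc M) \<le> (?m - real \<alpha> * real \<kappa>) / ?m"
      proof -
        have "real \<alpha> * (real (Suc M) * real \<kappa>) \<le> real \<alpha> * (2 * ?m)" using mm by (intro mult_left_mono) auto
        then show ?thesis using mpos by (simp add: divide_simps algebra_simps)
      qed
      have "?n * ((real (Suc M) - 2 * \<alpha>) / real (Suc M)) \<le> ?n * ((?m - real \<alpha> * real \<kappa>) / ?m)"
        by (rule mult_left_mono[OF ratio]) simp
      also note \<open>?n * ((?m - real \<alpha> * real \<kappa>) / ?m) \<le> real ?B\<close>
      finally have "?n * ((real (Suc M) - 2 * \<alpha>) / real (Suc M)) * real (Suc M) \<le> real ?B * real (Suc M)"
        by (rule mult_right_mono) simp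
      moreover have "?n * ((real (Suc M) - 2 * \<alpha>) / real (Suc M)) * real (Suc M) = ?n * (real (Suc M) - 2 * \<alpha>)"
        by (simp del: of_nat_Suc)
      ultimately show ?thesis by (simp only: mult.commute)
    qed
    then have "real (card (?N f)) * real (Suc M - 2 * \<alpha>) \<le> real (Suc M) * real ?B"
      using lt by (simp add: of_nat_diff)
    then have "real (card (?N f) * (Suc M - 2 * \<alpha>)) \<le> real (Suc M * ?B)"
      unfolding of_nat_mult[of "card (?N f)" "Suc M - 2 * \<alpha>"] of_nat_mult[of "Suc M" ?B] .
    then have "card (?N f) * (Suc M - 2 * \<alpha>) \<le> Suc M * ?B"
      by (rule of_nat_le_iff[THEN iffD1])
    also have "Suc M * ?B = 2 ^ (2 * \<alpha>) * (Suc M * (M choose (2 * \<alpha>)))"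
      by (rule mult.left_commute)
    \<comment> \<open>The averaging factor (M + 1) / (M + 1 - 2 \<alpha>) is the quotient of
      consecutive binomial coefficients, so the factors telescope over the induction.\<close>
    also have "Suc M * (M choose (2 * \<alpha>)) = (Suc M - 2 * \<alpha>) * (Suc M choose (2 * \<alpha>))"
      using binomial_absorb_comp[of "Suc M" "2 * \<alpha>"] by (simp only: diff_Suc_1)
    finally have "card (?N f) * (Suc M - 2 * \<alpha>) \<le>
        2 ^ (2 * \<alpha>) * (Suc M choose (2 * \<alpha>)) * (Suc M - 2 * \<alpha>)"
      by (simp only: mult_ac)
    then show ?thesis using lt by (simp del: binomial_Suc_Suc)
  qed
qed

lemma karger_count:
  fixes K :: "'v set set"
  assumes V: "finite V" "V \<noteq> {}" and K: "K \<subseteq> pairs V"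
    and heavy: "\<And>S. bd K S = {} \<or> \<kappa> \<le> card (bd K S)"
    and \<kappa>: "\<kappa> > 0"
  shows "card {X. \<exists>S. X = bd K S \<and> card X \<le> \<alpha> * \<kappa>} \<le> (2 * card V) ^ (2 * \<alpha>)"
proof -
  \<comment> \<open>If \<open>2 * \<alpha>\<close> exceeds card V, the induction stops at its base
    case, where the binomial coefficient is 1.\<close>
  define M where "M = max (card V) (2 * \<alpha>)"
  have "card {x \<in> (\<lambda>x. x) ` V. bd K ((\<lambda>x. x) -` {x}) \<noteq> {}} \<le> M"
    unfolding M_def using V by (intro max.coboundedI1 card_mono) auto
  from karger_count_contracted[OF V(1) K heavy \<kappa> _ this, of \<alpha>]
  have "card {X. \<exists>S. X = bd K S \<and> card X \<le> \<alpha> * \<kappa>} \<le> 2 ^ (2 * \<alpha>) * (M choose (2 * \<alpha>))"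
    by (simp add: M_def)
  also have "(M choose (2 * \<alpha>)) \<le> card V ^ (2 * \<alpha>)"
  proof (cases "2 * \<alpha> \<le> card V")
    case True
    then show ?thesis using binomial_le_power_nat by (simp add: M_def max_def)
  next
    case False
    then show ?thesis using V by (simp add: M_def max_def card_gt_0_iff Suc_leI)
  qed
  finally show ?thesis by (simp add: power_mult_distrib)
qed

subsection \<open>Sparse maximum flows and near-minimum cuts\<close>

definition arc :: "'v set set \<Rightarrow> 'v \<Rightarrow> 'v \<Rightarrow> int" where
  "arc E u v = of_bool ({u,v} \<in> E)"

text \<open>Net flow: antisymmetry and the upper bound in both directions give values -1, 0 or 1 on
  edges, so a residual capacity is 0, 1 or 2. The value, the net outflow of s, is kept outside the
  definition.\<close>

definition unit_flow :: "'v set \<Rightarrow> 'v set set \<Rightarrow> 'v \<Rightarrow> 'v \<Rightarrow> ('v \<Rightarrow> 'v \<Rightarrow> int) \<Rightarrow> bool" where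
  "unit_flow V E s t f \<longleftrightarrow> (\<forall>u v. f u v = - f v u) \<and> (\<forall>u v. f u v \<le> arc E u v) \<and>
    (\<forall>u\<in>V - {s,t}. (\<Sum>v\<in>V. f u v) = 0)"

abbreviation flow_arcs :: "'v set \<Rightarrow> ('v \<Rightarrow> 'v \<Rightarrow> int) \<Rightarrow> ('v \<times> 'v) set" where
  "flow_arcs V f \<equiv> {p \<in> V \<times> V. f (fst p) (snd p) > 0}"

lemma card_bd_eq_sum_arc:
  assumes V: "finite V" and E: "E \<subseteq> pairs V" and S: "S \<subseteq> V"
  shows "int (card (bd E S)) = (\<Sum>u\<in>S. \<Sum>v\<in>V - S. arc E u v)"
proof -
  have fS: "finite S" using V S finite_subset by blast
  have "(\<Sum>u\<in>S. \<Sum>v\<in>V - S. arc E u v) = (\<Sum>(u,v)\<in>S \<times> (V - S). arc E u v)"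
    by (simp add: sum.cartesian_product)
  also have "\<dots> = int (card {p \<in> S \<times> (V - S). {fst p, snd p} \<in> E})"
    using V fS by (simp add: arc_def case_prod_beta of_bool_def sum.If_cases Int_def)
  also have "card {p \<in> S \<times> (V - S). {fst p, snd p} \<in> E} = card (bd E S)"
  proof (rule bij_betw_same_card[of "\<lambda>p. {fst p, snd p}"], unfold bij_betw_def, intro conjI)
    show "inj_on (\<lambda>p. {fst p, snd p}) {p \<in> S \<times> (V - S). {fst p, snd p} \<in> E}"
      by (auto simp: inj_on_def doubleton_eq_iff)
    show "(\<lambda>p. {fst p, snd p}) ` {p \<in> S \<times> (V - S). {fst p, snd p} \<in> E} = bd E S"
    proof (intro equalityI subsetI)
      fix e assume "e \<in> (\<lambda>p. {fst p, snd p}) ` {p \<in> S \<times> (V - S). {fst p, snd p} \<in> E}"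
      then obtain u v where e: "e = {u,v}" "u \<in> S" "v \<notin> S" "e \<in> E" by auto
      then have "u \<noteq> v" by auto
      then have "card e = 2" using e by simp
      then show "e \<in> bd E S" using e by (auto simp: bd_iff)
    next
      fix e assume e: "e \<in> bd E S"
      then have e2: "card e = 2" "e \<subseteq> V" "e \<in> E" using E by (auto simp: bd_def pairs_def)
      then obtain u v where uv: "u \<in> e" "u \<in> S" "v \<in> e" "v \<notin> S" using e by (auto simp: bd_iff)
      then have "e = {u,v}" using e2(1) by (auto simp: card_2_iff)
      then show "e \<in> (\<lambda>p. {fst p, snd p}) ` {p \<in> S \<times> (V - S). {fst p, snd p} \<in> E}"
        using uv e2 by (intro image_eqI[of _ _ "(u,v)"]) auto
    qed
  qed
  finally show ?thesis by simp
qed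

lemma sum_antisym_zero:
  fixes f :: "'v \<Rightarrow> 'v \<Rightarrow> int"
  assumes "\<And>u v. f u v = - f v u"
  shows "(\<Sum>u\<in>S. \<Sum>v\<in>S. f u v) = 0"
proof -
  have "(\<Sum>u\<in>S. \<Sum>v\<in>S. f u v) = (\<Sum>u\<in>S. \<Sum>v\<in>S. f v u)" by (rule sum.swap)
  also have "\<dots> = - (\<Sum>u\<in>S. \<Sum>v\<in>S. f u v)"
    unfolding sum_negf[symmetric] using assms by (intro sum.cong refl)
  finally show ?thesis by simp
qed

text \<open>Summing conservation over S leaves the outflow of s, and arcs within S cancel by
  antisymmetry.\<close>

lemma flow_across_cut:
  assumes V: "finite V" and f: "unit_flow V E s t f" and S: "S \<subseteq> V" "s \<in> S" "t \<notin> S"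
  shows "(\<Sum>u\<in>S. \<Sum>v\<in>V - S. f u v) = (\<Sum>v\<in>V. f s v)"
proof -
  have fS: "finite S" using V S finite_subset by blast
  have "(\<Sum>u\<in>S. \<Sum>v\<in>V. f u v) = (\<Sum>v\<in>V. f s v) + (\<Sum>u\<in>S - {s}. \<Sum>v\<in>V. f u v)"
    using fS S by (simp add: sum.remove)
  also have "(\<Sum>u\<in>S - {s}. \<Sum>v\<in>V. f u v) = 0"
  proof (rule sum.neutral, rule ballI)
    fix u assume "u \<in> S - {s}"
    then have "u \<in> V - {s,t}" using S by blast
    then show "(\<Sum>v\<in>V. f u v) = 0" using f unfolding unit_flow_def by blast
  qed
  finally have "(\<Sum>u\<in>S. \<Sum>v\<in>V. f u v) = (\<Sum>v\<in>V. f s v)" by simp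
  moreover have "(\<Sum>u\<in>S. \<Sum>v\<in>V. f u v) = (\<Sum>u\<in>S. (\<Sum>v\<in>V - S. f u v) + (\<Sum>v\<in>S. f u v))"
    using V S by (intro sum.cong refl) (simp add: sum.subset_diff)
  moreover have "\<dots> = (\<Sum>u\<in>S. \<Sum>v\<in>V - S. f u v) + (\<Sum>u\<in>S. \<Sum>v\<in>S. f u v)"
    by (simp add: sum.distrib)
  moreover have "(\<Sum>u\<in>S. \<Sum>v\<in>S. f u v) = 0"
    using f unfolding unit_flow_def by (intro sum_antisym_zero) blast
  ultimately show ?thesis by simp
qed

section \<open>Breadth-first layers of the residual graph\<close>

primrec reach :: "'v set \<Rightarrow> ('v \<Rightarrow> 'v \<Rightarrow> bool) \<Rightarrow> 'v \<Rightarrow> nat \<Rightarrow> 'v set" where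
  "reach V R s 0 = {s}"
| "reach V R s (Suc j) = reach V R s j \<union> {v \<in> V. \<exists>u\<in>reach V R s j. R u v}"

lemma reach_mono: "i \<le> j \<Longrightarrow> reach V R s i \<subseteq> reach V R s j"
  by (induction rule: dec_induct) auto

lemma reach_subset: "s \<in> V \<Longrightarrow> reach V R s j \<subseteq> V"
  by (induction j) auto

text \<open>On a path to a vertex first reached at step j, the i-th vertex is first reached at step
  i; the vertices are therefore distinct.\<close>

lemma reach_path:
  assumes "s \<in> V" "v \<in> reach V R s j" "\<And>i. i < j \<Longrightarrow> v \<notin> reach V R s i"
  shows "\<exists>x. x 0 = s \<and> x j = v \<and> (\<forall>i<j. R (x i) (x (Suc i))) \<and>
    (\<forall>i\<le>j. x i \<in> reach V R s i \<and> (\<forall>l<i. x i \<notin> reach V R s l))"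
  using assms(2,3)
proof (induction j arbitrary: v)
  case 0
  then show ?case by (intro exI[of _ "\<lambda>_. s"]) auto
next
  case (Suc j)
  then obtain u where u: "u \<in> reach V R s j" "R u v" "v \<in> V" by fastforce
  have nu: "u \<notin> reach V R s i" if "i < j" for i
  proof
    assume "u \<in> reach V R s i"
    then have "v \<in> reach V R s (Suc i)" using u by auto
    then show False using Suc.prems(2)[of "Suc i"] that by simp
  qed
  obtain x where x: "x 0 = s" "x j = u" "\<forall>i<j. R (x i) (x (Suc i))"
    "\<forall>i\<le>j. x i \<in> reach V R s i \<and> (\<forall>l<i. x i \<notin> reach V R s l)"
    using Suc.IH[OF u(1) nu] by blast
  show ?case
    using x u Suc.prems
    by (intro exI[of _ "x(Suc j := v)"]) (auto simp: less_Suc_eq le_Suc_eq simp del: reach.simps(2))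
qed

text \<open>Makes the sum of 1 / sqrt (F - k) over all augmentations telescope to at most 2 sqrt
  F.\<close>

lemma sqrt_step:
  fixes a :: nat
  assumes "a > 0"
  shows "1 / sqrt (real a) \<le> 2 * (sqrt (real a) - sqrt (real a - 1))"
proof -
  have a: "real a \<ge> 1" using assms by simp
  have "1 = (sqrt (real a) - sqrt (real a - 1)) * (sqrt (real a) + sqrt (real a - 1))"
    using a by (simp add: algebra_simps flip: power2_eq_square)
  also have "\<dots> \<le> (sqrt (real a) - sqrt (real a - 1)) * (2 * sqrt (real a))"
    using a by (intro mult_left_mono) auto
  finally show ?thesis using a by (simp add: field_simps)
qed

text \<open>
  Each distance layer of the residual graph is a cut of residual capacity at least \<open>F - k\<close> between
  two consecutive layers, whose sizes therefore sum to at least \<open>sqrt (F - k)\<close>. As the layers are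
  disjoint, this bounds the length \<open>d\<close> of a shortest augmenting path.
\<close>

lemma augment_flow:
  assumes V: "finite V" and E: "E \<subseteq> pairs V" and st: "s \<in> V" "t \<in> V" "s \<noteq> t"
    and F: "\<And>S. S \<subseteq> V \<Longrightarrow> s \<in> S \<Longrightarrow> t \<notin> S \<Longrightarrow> F \<le> card (bd E S)"
    and f: "unit_flow V E s t f" "(\<Sum>v\<in>V. f s v) = int k" and k: "k < F"
  shows "\<exists>g d. unit_flow V E s t g \<and> (\<Sum>v\<in>V. g s v) = int (Suc k) \<and>
    card (flow_arcs V g) \<le> card (flow_arcs V f) + d \<and>
    real d \<le> 2 * card V / sqrt (real (F - k))"
proof -
  define R where "R = (\<lambda>u v. f u v < arc E u v)"
  let ?L = "reach V R s"
  have Lsub: "?L j \<subseteq> V" for j using reach_subset st(1) .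
  have s_in: "s \<in> ?L j" for j using reach_mono[of 0 j V R s] by auto
  define A where "A = (\<lambda>S. {p \<in> S \<times> (V - S). R (fst p) (snd p)})"
  \<comment> \<open>A residual arc has capacity at most 2, hence at least (F - k) / 2 of them leave
    S.\<close>
  have capa: "int (F - k) \<le> 2 * int (card (A S))" if S: "S \<subseteq> V" "s \<in> S" "t \<notin> S" for S
  proof -
    have fS: "finite S" using V S finite_subset by blast
    have "int F - int k \<le> (\<Sum>u\<in>S. \<Sum>v\<in>V - S. arc E u v) - (\<Sum>u\<in>S. \<Sum>v\<in>V - S. f u v)"
      using F[OF S] card_bd_eq_sum_arc[OF V E S(1)] flow_across_cut[OF V f(1) S] f(2) by simp
    also have "\<dots> = (\<Sum>u\<in>S. \<Sum>v\<in>V - S. arc E u v - f u v)" by (simp add: sum_subtractf)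
    also have "\<dots> \<le> (\<Sum>u\<in>S. \<Sum>v\<in>V - S. 2 * of_bool (R u v))"
    proof (intro sum_mono)
      fix u v
      have "f v u \<le> arc E v u" "f u v = - f v u" "f u v \<le> arc E u v"
        using f(1) unfolding unit_flow_def by blast+
      then show "arc E u v - f u v \<le> 2 * of_bool (R u v)"
        by (auto simp: R_def arc_def insert_commute of_bool_def split: if_splits)
    qed
    also have "\<dots> = (\<Sum>p\<in>S \<times> (V - S). 2 * of_bool (R (fst p) (snd p)))"
      by (simp add: sum.cartesian_product case_prod_beta)
    also have "\<dots> = 2 * int (card (A S))"
      using V fS by (simp add: A_def of_bool_def sum.If_cases Int_def flip: sum_distrib_left)
    finally show ?thesis using k by simp
  qed
  have grow: "t \<in> ?L j \<or> card (?L j) > j" for j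
  proof (induction j)
    case 0 then show ?case by simp
  next
    case (Suc j)
    show ?case
    proof (cases "t \<in> ?L j")
      case True then show ?thesis by simp
    next
      case False
      then have "card (A (?L j)) > 0" using capa[OF Lsub s_in False] k by simp
      then obtain u v where "u \<in> ?L j" "v \<in> V" "v \<notin> ?L j" "R u v"
        unfolding A_def by (auto simp: card_gt_0_iff)
      then have "?L j \<subset> ?L (Suc j)" by auto
      then have "card (?L j) < card (?L (Suc j))"
        using V Lsub by (meson finite_subset psubset_card_mono)
      then show ?thesis using Suc False by simp
    qed
  qed
  have "t \<in> ?L (card V)"
    using grow[of "card V"] card_mono[OF V Lsub[of "card V"]] by linarith
  define d where "d = (LEAST j. t \<in> ?L j)"
  have td: "t \<in> ?L d" and tnd: "\<And>i. i < d \<Longrightarrow> t \<notin> ?L i"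
    unfolding d_def using \<open>t \<in> ?L (card V)\<close> by (auto intro: LeastI dest: not_less_Least)
  obtain x where x: "x 0 = s" "x d = t" "\<And>i. i < d \<Longrightarrow> R (x i) (x (Suc i))"
    "\<And>i. i \<le> d \<Longrightarrow> x i \<in> ?L i" "\<And>i l. i \<le> d \<Longrightarrow> l < i \<Longrightarrow> x i \<notin> ?L l"
    using reach_path[OF st(1) td tnd] by blast
  have xV: "x i \<in> V" if "i \<le> d" for i using x(4)[OF that] Lsub by blast
  have xinj: "i = j" if "x i = x j" "i \<le> d" "j \<le> d" for i j
    using that x(4)[of i] x(4)[of j] x(5)[of i j] x(5)[of j i] by (cases i j rule: linorder_cases) auto
  define onp where "onp = (\<lambda>u v. \<exists>i<d. x i = u \<and> x (Suc i) = v)"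
  \<comment> \<open>\<open>h\<close> counts how often the path uses an arc, at most once by
    distinctness; subtracting the reverse arc in \<open>g\<close> preserves antisymmetry.\<close>
  define h where "h = (\<lambda>u v. \<Sum>i<d. of_bool (x i = u \<and> x (Suc i) = v) :: int)"
  define g where "g = (\<lambda>u v. f u v + (h u v - h v u))"
  have h0: "h u v \<ge> 0" for u v by (auto simp: h_def intro!: sum_nonneg)
  have hle: "h u v \<le> of_bool (onp u v)" for u v
  proof (cases "onp u v")
    case True
    then obtain i where i: "i < d" "x i = u" "x (Suc i) = v" unfolding onp_def by blast
    have "h u v \<le> (\<Sum>j<d. of_bool (j = i))"
      unfolding h_def using i xinj by (intro sum_mono) (auto simp: of_bool_def)
    also have "\<dots> = 1" using i by (simp add: of_bool_def)
    finally show ?thesis using True by simp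
  next
    case False
    then have "h u v = 0" unfolding h_def onp_def by (intro sum.neutral) auto
    then show ?thesis by simp
  qed
  have net: "(\<Sum>v\<in>V. h u v - h v u) = of_bool (s = u) - of_bool (t = u)" for u
  proof -
    have "(\<Sum>v\<in>V. h u v) = (\<Sum>i<d. \<Sum>v\<in>V. of_bool (x i = u \<and> x (Suc i) = v))"
      unfolding h_def by (rule sum.swap)
    also have "\<dots> = (\<Sum>i<d. of_bool (x i = u))"
    proof (intro sum.cong refl)
      fix i assume i: "i \<in> {..<d}"
      have "(\<Sum>v\<in>V. of_bool (x i = u \<and> x (Suc i) = v)) = (\<Sum>v\<in>V. if x (Suc i) = v then of_bool (x i = u) else (0::int))"
        by (intro sum.cong) auto
      then show "(\<Sum>v\<in>V. of_bool (x i = u \<and> x (Suc i) = v)) = (of_bool (x i = u) :: int)"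
        using xV[of "Suc i"] V i by simp
    qed
    finally have 1: "(\<Sum>v\<in>V. h u v) = (\<Sum>i<d. of_bool (x i = u))" .
    have "(\<Sum>v\<in>V. h v u) = (\<Sum>i<d. \<Sum>v\<in>V. of_bool (x i = v \<and> x (Suc i) = u))"
      unfolding h_def by (rule sum.swap)
    also have "\<dots> = (\<Sum>i<d. of_bool (x (Suc i) = u))"
    proof (intro sum.cong refl)
      fix i assume i: "i \<in> {..<d}"
      have "(\<Sum>v\<in>V. of_bool (x i = v \<and> x (Suc i) = u)) = (\<Sum>v\<in>V. if x i = v then of_bool (x (Suc i) = u) else (0::int))"
        by (intro sum.cong) auto
      then show "(\<Sum>v\<in>V. of_bool (x i = v \<and> x (Suc i) = u)) = (of_bool (x (Suc i) = u) :: int)"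
        using xV[of i] V i by simp
    qed
    finally have 2: "(\<Sum>v\<in>V. h v u) = (\<Sum>i<d. of_bool (x (Suc i) = u))" .
    have "(\<Sum>v\<in>V. h u v - h v u) = (\<Sum>i<d. of_bool (x i = u) - of_bool (x (Suc i) = u))"
      by (simp add: sum_subtractf 1 2)
    also have "\<dots> = of_bool (x 0 = u) - of_bool (x d = u)" by (rule sum_lessThan_telescope')
    finally show ?thesis using x by simp
  qed
  have sumg: "(\<Sum>v\<in>V. g u v) = (\<Sum>v\<in>V. f u v) + (of_bool (s = u) - of_bool (t = u))" for u
    using net[of u] by (simp add: g_def sum.distrib)
  have "unit_flow V E s t g"
    unfolding unit_flow_def
  proof (intro conjI allI ballI)
    fix u v
    have "f u v = - f v u" using f(1) unfolding unit_flow_def by blast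
    then show "g u v = - g v u" by (simp add: g_def)
    have fa: "f u v \<le> arc E u v" using f(1) unfolding unit_flow_def by blast
    show "g u v \<le> arc E u v"
    proof (cases "onp u v")
      case True
      then have "R u v" using x(3) unfolding onp_def by blast
      then show ?thesis using hle[of u v] h0[of v u] True by (simp add: g_def R_def)
    next
      case False
      then show ?thesis using hle[of u v] h0[of v u] fa by (simp add: g_def)
    qed
  next
    fix u assume u: "u \<in> V - {s,t}"
    then have "(\<Sum>v\<in>V. f u v) = 0" using f(1) unfolding unit_flow_def by blast
    then show "(\<Sum>v\<in>V. g u v) = 0" using sumg[of u] u by auto
  qed
  moreover have "(\<Sum>v\<in>V. g s v) = int (Suc k)" using sumg[of s] f(2) st(3) by simp
  moreover have "card (flow_arcs V g) \<le> card (flow_arcs V f) + d"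
  proof -
    have "(flow_arcs V g) \<subseteq> (flow_arcs V f) \<union> (\<lambda>i. (x i, x (Suc i))) ` {..<d}"
    proof
      fix p assume p: "p \<in> (flow_arcs V g)"
      obtain u v where uv: "p = (u,v)" by (cases p)
      show "p \<in> (flow_arcs V f) \<union> (\<lambda>i. (x i, x (Suc i))) ` {..<d}"
      proof (cases "onp u v")
        case True
        then show ?thesis using uv unfolding onp_def by auto
      next
        case False
        then show ?thesis using p uv hle[of u v] h0[of v u] by (simp add: g_def)
      qed
    qed
    then have "card (flow_arcs V g) \<le>
        card ((flow_arcs V f) \<union> (\<lambda>i. (x i, x (Suc i))) ` {..<d})"
      using V by (intro card_mono) auto
    also have "\<dots> \<le> card (flow_arcs V f) + card ((\<lambda>i. (x i, x (Suc i))) ` {..<d})"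
      by (rule card_Un_le)
    finally show ?thesis using card_image_le[of "{..<d}" "\<lambda>i. (x i, x (Suc i))"] by simp
  qed
  moreover have "real d \<le> 2 * card V / sqrt (real (F - k))"
  proof -
    define l where "l = (\<lambda>j. ?L j - (\<Union>i<j. ?L i))"
    have fl: "finite (l j)" for j using V Lsub unfolding l_def by (meson finite_Diff finite_subset)
    have disj: "l i \<inter> l j = {}" if "i \<noteq> j" for i j
      using that unfolding l_def by (cases i j rule: linorder_cases) auto
    have suml: "(\<Sum>j\<in>J. card (l j)) \<le> card V" if "finite J" for J
    proof -
      have "(\<Sum>j\<in>J. card (l j)) = card (\<Union>j\<in>J. l j)"
        using that fl disj by (intro card_UN_disjoint[symmetric]) auto
      also have "\<dots> \<le> card V" using V Lsub unfolding l_def by (intro card_mono) blast+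
      finally show ?thesis .
    qed
    have step: "sqrt (real (F - k)) \<le> real (card (l j)) + real (card (l (Suc j)))" if j: "j < d" for j
    proof -
      have "A (?L j) \<subseteq> l j \<times> l (Suc j)"
      proof
        fix p assume "p \<in> A (?L j)"
        then obtain u v where p: "p = (u,v)" "u \<in> ?L j" "v \<in> V" "v \<notin> ?L j" "R u v"
          by (cases p) (auto simp: A_def)
        have "u \<notin> ?L i" if "i < j" for i
        proof
          assume "u \<in> ?L i"
          then have "v \<in> ?L (Suc i)" using p by auto
          then show False using reach_mono[of "Suc i" j V R s] that p(4) by auto
        qed
        moreover have "v \<in> ?L (Suc j)" using p by auto
        moreover have "v \<notin> ?L i" if "i < Suc j" for i using reach_mono[of i j V R s] that p(4) by auto
        ultimately show "p \<in> l j \<times> l (Suc j)" using p unfolding l_def by blast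
      qed
      then have "card (A (?L j)) \<le> card (l j) * card (l (Suc j))"
        using card_mono[of "l j \<times> l (Suc j)" "A (?L j)"] fl by (simp add: card_cartesian_product)
      then have "F - k \<le> 2 * (card (l j) * card (l (Suc j)))"
        using capa[OF Lsub s_in tnd[OF j]] by linarith
      \<comment> \<open>The factor 2 lost to residual capacities is absorbed here, as 2 a b is at
        most (a + b)^2.\<close>
      also have "\<dots> \<le> (card (l j) + card (l (Suc j)))^2"
        by (simp add: power2_eq_square algebra_simps)
      finally have "real (F - k) \<le> (real (card (l j)) + real (card (l (Suc j))))^2"
        by (metis of_nat_add of_nat_le_iff of_nat_power)
      then show ?thesis by (intro real_le_lsqrt) auto
    qed
    have "real d * sqrt (real (F - k)) = (\<Sum>j<d. sqrt (real (F - k)))" by simp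
    also have "\<dots> \<le> (\<Sum>j<d. real (card (l j)) + real (card (l (Suc j))))"
      by (intro sum_mono step) auto
    also have "\<dots> = real (\<Sum>j<d. card (l j)) + real (\<Sum>j\<in>Suc ` {..<d}. card (l j))"
      by (simp add: sum.distrib sum.reindex)
    also have "\<dots> \<le> real (card V) + real (card V)"
      using suml[of "{..<d}"] suml[of "Suc ` {..<d}"] by (intro add_mono) (simp_all only: of_nat_le_iff finite_lessThan finite_imageI)
    finally show ?thesis using k by (simp add: field_simps)
  qed
  ultimately show ?thesis by blast
qed

text \<open>The augmentation from value k adds at most 2 n / sqrt (F - k) arcs, and
  \<open>sqrt_step\<close> bounds the total. For F at most n this is of order n^(3/2), below the
  budget for the edges of near-minimum cuts.\<close>

lemma sparse_flow:
  assumes V: "finite V" and E: "E \<subseteq> pairs V" and st: "s \<in> V" "t \<in> V" "s \<noteq> t"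
    and F: "\<And>S. S \<subseteq> V \<Longrightarrow> s \<in> S \<Longrightarrow> t \<notin> S \<Longrightarrow> F \<le> card (bd E S)"
  shows "\<exists>f. unit_flow V E s t f \<and> (\<Sum>v\<in>V. f s v) = int F \<and>
    real (card (flow_arcs V f)) \<le> 4 * card V * sqrt F"
proof -
  have "\<exists>f. unit_flow V E s t f \<and> (\<Sum>v\<in>V. f s v) = int k \<and>
    real (card (flow_arcs V f)) \<le> 4 * card V * (sqrt F - sqrt (F - k))"
    if "k \<le> F" for k
    using that
  proof (induction k)
    case 0
    show ?case by (intro exI[of _ "\<lambda>_ _. 0"]) (auto simp: unit_flow_def arc_def)
  next
    case (Suc k)
    then obtain f where f: "unit_flow V E s t f" "(\<Sum>v\<in>V. f s v) = int k"
      "real (card (flow_arcs V f)) \<le> 4 * card V * (sqrt F - sqrt (F - k))"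
      by auto
    obtain g d where g: "unit_flow V E s t g" "(\<Sum>v\<in>V. g s v) = int (Suc k)"
      "card (flow_arcs V g) \<le> card (flow_arcs V f) + d"
      "real d \<le> 2 * card V / sqrt (real (F - k))"
      using augment_flow[OF V E st F f(1,2)] Suc.prems by auto
    have "real d \<le> 2 * card V * (1 / sqrt (real (F - k)))" using g(4) by simp
    also have "\<dots> \<le> 2 * card V * (2 * (sqrt (real (F - k)) - sqrt (real (F - k) - 1)))"
      using Suc.prems by (intro mult_left_mono sqrt_step) auto
    also have "real (F - k) - 1 = real (F - Suc k)" using Suc.prems by simp
    finally have "real (card (flow_arcs V g)) \<le> 4 * card V * (sqrt F - sqrt (F - Suc k))"
      using g(3) f(3) by (simp add: algebra_simps)
    then show ?case using g by blast
  qed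
  from this[of F] show ?thesis by simp
qed

text \<open>Possibly exponentially many cuts are covered at once. The flow uses at least F edges of
  each, so at most \<Delta> edges of a cut lie outside the support; such an edge cannot lie in a
  (\<Delta> + 1)-connected set of the remaining graph, and the weak edges number at most (\<Delta> +
  1) (n - 1) in total.\<close>

lemma card_near_min_cut_edges_le:
  assumes V: "finite V" and E: "E \<subseteq> pairs V" and st: "s \<in> V" "t \<in> V" "s \<noteq> t"
    and F: "\<And>S. S \<subseteq> V \<Longrightarrow> s \<in> S \<Longrightarrow> t \<notin> S \<Longrightarrow> F \<le> card (bd E S)"
  shows "real (card (\<Union>S\<in>{S. S \<subseteq> V \<and> s \<in> S \<and> t \<notin> S \<and> card (bd E S) \<le> F + \<Delta>}. bd E S))
    \<le> (\<Delta> + 1) * card V + 4 * card V * sqrt F"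
proof -
  obtain f where f: "unit_flow V E s t f" "(\<Sum>v\<in>V. f s v) = int F"
    "real (card (flow_arcs V f)) \<le> 4 * card V * sqrt F"
    using sparse_flow[OF V E st F] by blast
  define P where "P = (flow_arcs V f)"
  define supp where "supp = (\<lambda>p. {fst p, snd p}) ` P"
  define E0 where "E0 = E - supp"
  let ?W = "{e \<in> E0. card e = 2 \<and> e \<subseteq> V \<and> \<not> inside V (Suc \<Delta>) E0 e}"
  have fE: "finite E" using V E finite_pairs finite_subset by blast
  have fP: "finite P" using V by (simp add: P_def)
  have "bd E S \<subseteq> supp \<union> ?W" if S: "S \<subseteq> V" "s \<in> S" "t \<notin> S" "card (bd E S) \<le> F + \<Delta>" for S
  proof -
    have fS: "finite S" using V S finite_subset by blast
    have "int F = (\<Sum>u\<in>S. \<Sum>v\<in>V - S. f u v)" using flow_across_cut[OF V f(1) S(1-3)] f(2) by simp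
    also have "\<dots> \<le> (\<Sum>u\<in>S. \<Sum>v\<in>V - S. arc (E \<inter> supp) u v)"
    proof (intro sum_mono)
      fix u v assume uv: "u \<in> S" "v \<in> V - S"
      have "f u v \<le> arc E u v" using f(1) unfolding unit_flow_def by blast
      moreover have "{u,v} \<in> supp" if "f u v > 0"
        unfolding supp_def P_def using that uv S(1) by (intro image_eqI[of _ _ "(u,v)"]) auto
      ultimately show "f u v \<le> arc (E \<inter> supp) u v"
        by (cases "f u v > 0") (auto simp: arc_def of_bool_def split: if_splits)
    qed
    also have "\<dots> = int (card (bd (E \<inter> supp) S))"
    proof -
      have "E \<inter> supp \<subseteq> pairs V" using E by blast
      from card_bd_eq_sum_arc[OF V this S(1)] show ?thesis by (rule sym)
    qed
    finally have "F \<le> card (bd (E \<inter> supp) S)" by simp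
    moreover have "card (bd E S) = card (bd (E \<inter> supp) S) + card (bd E0 S)"
      unfolding E0_def using fE
      by (subst card_Un_disjoint[symmetric]) (auto simp: bd_def intro: arg_cong[of _ _ card])
    ultimately have small: "card (bd E0 S) \<le> \<Delta>" using S(4) by linarith
    show ?thesis
    proof
      fix e assume e: "e \<in> bd E S"
      then have e2: "card e = 2" "e \<subseteq> V" "e \<in> E" using E by (auto simp: bd_def pairs_def)
      show "e \<in> supp \<union> ?W"
      proof (cases "e \<in> supp")
        case False
        then have e0: "e \<in> E0" using e2 by (simp add: E0_def)
        have "\<not> inside V (Suc \<Delta>) E0 e"
        proof
          assume "inside V (Suc \<Delta>) E0 e"
          then obtain D where D: "D \<subseteq> V" "e \<subseteq> D" "tconn (Suc \<Delta>) E0 D" unfolding inside_def by blast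
          obtain u v where "u \<in> e" "u \<in> S" "v \<in> e" "v \<notin> S" using e e2 by (auto simp: bd_iff)
          then have "Suc \<Delta> \<le> card (bd {e \<in> E0. e \<subseteq> D} S)"
            using tconn_bound[OF _ D(3), of D u v S] fE D(2) by (auto simp: E0_def)
          also have "\<dots> \<le> card (bd E0 S)"
            using fE by (intro card_mono bd_mono) (auto simp: E0_def bd_def)
          finally show False using small by simp
        qed
        then show ?thesis using e0 e2 by blast
      qed simp
    qed
  qed
  then have "(\<Union>S\<in>{S. S \<subseteq> V \<and> s \<in> S \<and> t \<notin> S \<and> card (bd E S) \<le> F + \<Delta>}. bd E S) \<subseteq> supp \<union> ?W"
    by blast
  then have "card (\<Union>S\<in>{S. S \<subseteq> V \<and> s \<in> S \<and> t \<notin> S \<and> card (bd E S) \<le> F + \<Delta>}. bd E S) \<le> card (supp \<union> ?W)"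
    using fE fP by (intro card_mono) (auto simp: supp_def E0_def)
  also have "\<dots> \<le> card supp + card ?W" by (rule card_Un_le)
  also have "card supp \<le> card P" unfolding supp_def using fP by (rule card_image_le)
  also have "card ?W \<le> Suc \<Delta> * (card V - 1)"
    using fE by (intro card_weak_edges_le[OF V]) (simp add: E0_def)
  also have "Suc \<Delta> * (card V - 1) \<le> Suc \<Delta> * card V" by (intro mult_left_mono) auto
  finally have "card (\<Union>S\<in>{S. S \<subseteq> V \<and> s \<in> S \<and> t \<notin> S \<and> card (bd E S) \<le> F + \<Delta>}. bd E S)
    \<le> card P + Suc \<Delta> * card V" by simp
  then have "real (card (\<Union>S\<in>{S. S \<subseteq> V \<and> s \<in> S \<and> t \<notin> S \<and> card (bd E S) \<le> F + \<Delta>}. bd E S))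
    \<le> real (card P) + real (Suc \<Delta> * card V)"
    by (simp only: of_nat_le_iff flip: of_nat_add)
  then show ?thesis using f(3) unfolding P_def by simp
qed

subsection \<open>Learning a sparse set of edges in two rounds\<close>

text \<open>Toggling in T an element on which A and B differ changes exactly one of the two counts,
  which injects balanced sets into unbalanced ones.\<close>

lemma balanced_sets_at_most_half:
  assumes N: "finite N" and AB: "A \<subseteq> N" "B \<subseteq> N" "A \<noteq> B"
  shows "2 * card {T \<in> Pow N. card (A \<inter> T) = card (B \<inter> T)} \<le> 2 ^ card N"
proof -
  let ?Q = "{T \<in> Pow N. card (A \<inter> T) = card (B \<inter> T)}"
  obtain x where x: "x \<in> N" "(x \<in> A) \<noteq> (x \<in> B)" using AB by blast
  define \<phi> where "\<phi> = (\<lambda>T. if x \<in> T then T - {x} else insert x T)"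
  have inj: "inj_on \<phi> (Pow N)"
    by (rule inj_on_inverseI[of _ \<phi>]) (auto simp: \<phi>_def)
  have fin: "finite A" "finite B" using AB N finite_subset by blast+
  have card_in: "card (C \<inter> \<phi> T) = (if x \<in> T then card (C \<inter> T) - 1 else card (C \<inter> T) + 1)"
    if "x \<in> C" "finite C" for C T
  proof (cases "x \<in> T")
    case True
    then have "C \<inter> \<phi> T = (C \<inter> T) - {x}" by (auto simp: \<phi>_def)
    then show ?thesis using True that by simp
  next
    case False
    then have "C \<inter> \<phi> T = insert x (C \<inter> T)" using that by (auto simp: \<phi>_def)
    then show ?thesis using False that by simp
  qed
  have card_out: "card (C \<inter> \<phi> T) = card (C \<inter> T)" if "x \<notin> C" for C T
  proof -
    have "C \<inter> \<phi> T = C \<inter> T" using that by (auto simp: \<phi>_def)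
    then show ?thesis by simp
  qed
  have pos: "card (C \<inter> T) > 0" if "x \<in> C" "x \<in> T" "finite C" for C T
    using that by (auto simp: card_gt_0_iff)
  have "\<phi> ` ?Q \<subseteq> Pow N - ?Q"
  proof
    fix U assume "U \<in> \<phi> ` ?Q"
    then obtain T where T: "U = \<phi> T" "T \<subseteq> N" "card (A \<inter> T) = card (B \<inter> T)" by auto
    have "U \<subseteq> N" using T x by (auto simp: \<phi>_def)
    moreover have "card (A \<inter> U) \<noteq> card (B \<inter> U)"
    proof (cases "x \<in> A")
      case True
      then have "x \<notin> B" using x by blast
      then show ?thesis using T card_in[OF True fin(1), of T] card_out[of B T] pos[OF True _ fin(1), of T]
        by (auto split: if_splits)
    next
      case False
      then have "x \<in> B" using x by blast
      then show ?thesis using T card_in[OF _ fin(2), of T] card_out[of A T] pos[OF _ _ fin(2), of T] False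
        by (auto split: if_splits)
    qed
    ultimately show "U \<in> Pow N - ?Q" by blast
  qed
  moreover have "inj_on \<phi> ?Q" using inj by (rule inj_on_subset) blast
  ultimately have "card ?Q \<le> card (Pow N - ?Q)"
    using N by (intro card_inj_on_le[of \<phi>]) auto
  also have "\<dots> = 2 ^ card N - card ?Q"
    using N by (subst card_Diff_subset) (auto simp: card_Pow)
  finally show ?thesis
    using card_mono[of "Pow N" ?Q] N by (simp add: card_Pow)
qed

text \<open>By averaging, some T leaves at most half of the pairs unseparated; fewer than 2^q pairs
  are used up after q choices.\<close>

lemma separating_list:
  assumes N: "finite N" and P: "P \<subseteq> Pow N \<times> Pow N" "\<And>A B. (A,B) \<in> P \<Longrightarrow> A \<noteq> B"
    and q: "card P < 2 ^ q"
  shows "\<exists>Ts. length Ts = q \<and> set Ts \<subseteq> Pow N \<and>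
    (\<forall>(A,B)\<in>P. \<exists>T\<in>set Ts. card (A \<inter> T) \<noteq> card (B \<inter> T))"
  using P q
proof (induction q arbitrary: P)
  case 0
  have "finite P" using 0(1) N by (meson finite_Pow_iff finite_SigmaI finite_subset)
  then have "P = {}" using 0(3) by auto
  then show ?case by auto
next
  case (Suc q)
  have fP: "finite P" using Suc.prems(1) N by (meson finite_Pow_iff finite_SigmaI finite_subset)
  define R where "R = (\<lambda>T. {p \<in> P. card (fst p \<inter> T) = card (snd p \<inter> T)})"
  have "\<exists>T\<in>Pow N. 2 * card (R T) \<le> card P"
  proof (rule ccontr)
    assume "\<not> ?thesis"
    then have "2 ^ card N * card P < (\<Sum>T\<in>Pow N. 2 * card (R T))"
      using sum_strict_mono[of "Pow N" "\<lambda>_. card P" "\<lambda>T. 2 * card (R T)"] N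
      by (auto simp: card_Pow not_le)
    also have "\<dots> = (\<Sum>T\<in>Pow N. \<Sum>p\<in>P. if card (fst p \<inter> T) = card (snd p \<inter> T) then 2 else 0)"
      using fP by (intro sum.cong refl) (simp add: R_def sum.If_cases Int_def)
    also have "\<dots> = (\<Sum>p\<in>P. \<Sum>T\<in>Pow N. if card (fst p \<inter> T) = card (snd p \<inter> T) then 2 else 0)"
      by (rule sum.swap)
    also have "\<dots> = (\<Sum>p\<in>P. 2 * card {T \<in> Pow N. card (fst p \<inter> T) = card (snd p \<inter> T)})"
      using N by (intro sum.cong refl) (simp add: sum.If_cases Int_def)
    also have "\<dots> \<le> (\<Sum>p\<in>P. 2 ^ card N)"
    proof (intro sum_mono)
      fix p assume p: "p \<in> P"
      obtain A B where "p = (A,B)" by (cases p)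
      then show "2 * card {T \<in> Pow N. card (fst p \<inter> T) = card (snd p \<inter> T)} \<le> 2 ^ card N"
        using p Suc.prems(1,2) balanced_sets_at_most_half[OF N, of A B] by auto
    qed
    finally show False by (simp add: mult.commute)
  qed
  then obtain T where T: "T \<subseteq> N" "2 * card (R T) \<le> card P" by blast
  have "card (R T) < 2 ^ q" using T(2) Suc.prems(3) by simp
  moreover have "R T \<subseteq> Pow N \<times> Pow N" using Suc.prems(1) by (auto simp: R_def)
  moreover have "A \<noteq> B" if "(A,B) \<in> R T" for A B using that Suc.prems(2) by (auto simp: R_def)
  ultimately obtain Ts where Ts: "length Ts = q" "set Ts \<subseteq> Pow N"
    "\<forall>(A,B)\<in>R T. \<exists>T\<in>set Ts. card (A \<inter> T) \<noteq> card (B \<inter> T)"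
    using Suc.IH[of "R T"] by blast
  have "\<forall>(A,B)\<in>P. \<exists>T\<in>set (T # Ts). card (A \<inter> T) \<noteq> card (B \<inter> T)"
  proof (rule ballI, rule case_prodI2)
    fix p A B assume p: "p \<in> P" "p = (A,B)"
    show "\<exists>T\<in>set (T # Ts). card (A \<inter> T) \<noteq> card (B \<inter> T)"
    proof (cases "card (A \<inter> T) = card (B \<inter> T)")
      case True
      then have "(A,B) \<in> R T" using p by (simp add: R_def)
      then show ?thesis using Ts(3) by fastforce
    qed simp
  qed
  then show ?case using Ts T by (intro exI[of _ "T # Ts"]) simp
qed

lemma card_small_subsets_le:
  assumes N: "finite N"
  shows "card {A. A \<subseteq> N \<and> card A \<le> d} \<le> (card N + 1) ^ d"
proof (induction d)
  case 0
  have "{A. A \<subseteq> N \<and> card A \<le> 0} = {{}}" using N by (auto dest: finite_subset)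
  then show ?case by simp
next
  case (Suc d)
  let ?S = "\<lambda>d. {A. A \<subseteq> N \<and> card A \<le> d}"
  have fS: "finite (?S d)" for d by (rule finite_subset[of _ "Pow N"]) (use N in auto)
  have "?S (Suc d) \<subseteq> ?S d \<union> (\<lambda>(x,A). insert x A) ` (N \<times> ?S d)"
  proof
    fix A assume A: "A \<in> ?S (Suc d)"
    have fA: "finite A" using A N finite_subset by blast
    show "A \<in> ?S d \<union> (\<lambda>(x,A). insert x A) ` (N \<times> ?S d)"
    proof (cases "A = {}")
      case False
      then obtain x where x: "x \<in> A" by blast
      have "A = (\<lambda>(x,A). insert x A) (x, A - {x})" using x by auto
      moreover have "(x, A - {x}) \<in> N \<times> ?S d" using A x fA by auto
      ultimately show ?thesis by blast
    qed simp
  qed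
  then have "card (?S (Suc d)) \<le> card (?S d \<union> (\<lambda>(x,A). insert x A) ` (N \<times> ?S d))"
    using fS N by (intro card_mono) auto
  also have "\<dots> \<le> card (?S d) + card ((\<lambda>(x,A). insert x A) ` (N \<times> ?S d))" by (rule card_Un_le)
  also have "card ((\<lambda>(x,A). insert x A) ` (N \<times> ?S d)) \<le> card (N \<times> ?S d)"
    using N fS by (intro card_image_le) auto
  finally have "card (?S (Suc d)) \<le> (card N + 1) * card (?S d)"
    by (simp add: card_cartesian_product)
  also have "\<dots> \<le> (card N + 1) * (card N + 1) ^ d" using Suc.IH by (rule mult_left_mono) simp
  finally show ?case by simp
qed

definition separates :: "'v set \<Rightarrow> nat \<Rightarrow> 'v set list \<Rightarrow> bool" where
  "separates N d Ts \<longleftrightarrow> set Ts \<subseteq> Pow N \<and> (\<forall>A B. A \<subseteq> N \<longrightarrow> B \<subseteq> N \<longrightarrow> card A \<le> d \<longrightarrow> card B \<le> d \<longrightarrow>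
    (\<forall>T\<in>set Ts. card (A \<inter> T) = card (B \<inter> T)) \<longrightarrow> A = B)"

lemma separating_family_exists:
  assumes N: "finite N" and b: "card N + 1 \<le> 2 ^ b"
  shows "\<exists>Ts. length Ts = 2 * d * b + 1 \<and> separates N d Ts"
proof -
  let ?S = "{A. A \<subseteq> N \<and> card A \<le> d}"
  define P where "P = {p \<in> ?S \<times> ?S. fst p \<noteq> snd p}"
  have fS: "finite ?S" by (rule finite_subset[of _ "Pow N"]) (use N in auto)
  have "card P \<le> card (?S \<times> ?S)" unfolding P_def using fS by (intro card_mono) auto
  also have "\<dots> = card ?S * card ?S" by (rule card_cartesian_product)
  also have "\<dots> \<le> (card N + 1) ^ d * (card N + 1) ^ d"
    by (intro mult_le_mono card_small_subsets_le N)
  also have "\<dots> \<le> (2 ^ b) ^ d * (2 ^ b) ^ d" using b by (intro mult_le_mono power_mono) auto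
  also have "\<dots> = 2 ^ (2 * d * b)" by (simp add: mult_ac flip: power_mult power_add)
  \<comment> \<open>One test beyond 2 d b makes the inequality strict, also for d = 0.\<close>
  also have "(2::nat) ^ (2 * d * b) < 2 ^ (2 * d * b + 1)" by simp
  finally have "card P < 2 ^ (2 * d * b + 1)" .
  moreover have "P \<subseteq> Pow N \<times> Pow N" by (auto simp: P_def)
  moreover have "A \<noteq> B" if "(A,B) \<in> P" for A B using that by (auto simp: P_def)
  ultimately obtain Ts where Ts: "length Ts = 2 * d * b + 1" "set Ts \<subseteq> Pow N"
    "\<forall>(A,B)\<in>P. \<exists>T\<in>set Ts. card (A \<inter> T) \<noteq> card (B \<inter> T)"
    using separating_list[OF N, of P "2 * d * b + 1"] by blast
  have "separates N d Ts"
    unfolding separates_def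
  proof (intro conjI allI impI)
    show "set Ts \<subseteq> Pow N" by (rule Ts)
    fix A B assume h: "A \<subseteq> N" "B \<subseteq> N" "card A \<le> d" "card B \<le> d" "\<forall>T\<in>set Ts. card (A \<inter> T) = card (B \<inter> T)"
    show "A = B"
    proof (rule ccontr)
      assume "A \<noteq> B"
      then have "(A,B) \<in> P" using h by (simp add: P_def)
      then show False using Ts(3) h(5) by fastforce
    qed
  qed
  then show ?thesis using Ts(1) by blast
qed

section \<open>Neighbourhoods and degrees from cut values\<close>

definition nbh :: "'v set set \<Rightarrow> 'v \<Rightarrow> 'v set" where
  "nbh E v = {u. {u,v} \<in> E}"

lemma nbh_subset: "E \<subseteq> pairs V \<Longrightarrow> nbh E v \<subseteq> V - {v}"
  by (auto simp: nbh_def pairs_def)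

lemma nbh_Int: "nbh (E \<inter> F) v = nbh E v \<inter> nbh F v"
  by (auto simp: nbh_def)

lemma edges_eq_if_nbh_eq:
  assumes "E \<subseteq> pairs V" "F \<subseteq> pairs V" "\<And>v. v \<in> V \<Longrightarrow> nbh E v = nbh F v"
  shows "E = F"
proof -
  have "e \<in> E \<longleftrightarrow> e \<in> F" if ep: "e \<in> pairs V" for e
  proof -
    obtain u v where e: "e = {u,v}" "v \<in> V" using ep by (auto simp: pairs_def card_2_iff)
    then show ?thesis using assms(3)[of v] by (auto simp: nbh_def)
  qed
  then show ?thesis using assms(1,2) by blast
qed

lemma sum_card_nbh:
  assumes V: "finite V" and E: "E \<subseteq> pairs V"
  shows "(\<Sum>v\<in>V. card (nbh E v)) = 2 * card E"
proof -
  have fE: "finite E" using V E finite_pairs finite_subset by blast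
  have "card (nbh E v) = card {e \<in> E. v \<in> e}" for v
  proof (rule bij_betw_same_card[of "\<lambda>u. {u,v}"], unfold bij_betw_def, intro conjI)
    show "inj_on (\<lambda>u. {u,v}) (nbh E v)" by (auto simp: inj_on_def doubleton_eq_iff)
    show "(\<lambda>u. {u,v}) ` nbh E v = {e \<in> E. v \<in> e}"
    proof (intro equalityI subsetI)
      fix e assume e: "e \<in> {e \<in> E. v \<in> e}"
      then obtain x y where "e = {x,y}" using E by (auto simp: pairs_def card_2_iff)
      then have "e = {x,v} \<or> e = {y,v}" using e by auto
      then show "e \<in> (\<lambda>u. {u,v}) ` nbh E v" using e by (auto simp: nbh_def)
    qed (auto simp: nbh_def)
  qed
  then have "(\<Sum>v\<in>V. card (nbh E v)) = (\<Sum>v\<in>V. \<Sum>e\<in>E. if v \<in> e then 1 else 0)"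
    using fE by (simp add: sum.If_cases Int_def)
  also have "\<dots> = (\<Sum>e\<in>E. \<Sum>v\<in>V. if v \<in> e then 1 else 0)" by (rule sum.swap)
  also have "\<dots> = (\<Sum>e\<in>E. 2)"
  proof (intro sum.cong refl)
    fix e assume "e \<in> E"
    then have "e \<subseteq> V" "card e = 2" using E by (auto simp: pairs_def)
    then have "V \<inter> {v. v \<in> e} = e" by blast
    then show "(\<Sum>v\<in>V. if v \<in> e then 1 else 0) = (2::nat)"
      using V \<open>card e = 2\<close> by (simp add: sum.If_cases)
  qed
  finally show ?thesis by simp
qed

text \<open>Edges between v and Y count in both cuts on the left but not in the cut on the right;
  every other edge counts equally often in the cuts of both sides.\<close>

lemma cut_star:
  assumes fE: "finite E" and E: "E \<subseteq> pairs V" and v: "v \<notin> Y"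
  shows "cut E {v} + cut E Y = cut E (insert v Y) + 2 * card (nbh E v \<inter> Y)"
proof -
  define D where "D = {e \<in> E. v \<in> e \<and> e \<inter> Y \<noteq> {}}"
  define P where "P = {e \<in> E. v \<in> e \<and> e \<inter> Y = {}}"
  define Q where "Q = {e \<in> E. v \<notin> e \<and> e \<inter> Y \<noteq> {} \<and> e - Y \<noteq> {}}"
  have c2: "card e = 2" if "e \<in> E" for e using that E by (auto simp: pairs_def)
  have out: "\<exists>y. y \<in> e \<and> y \<noteq> v" if "e \<in> E" "v \<in> e" for e
    using c2[OF that(1)] by (auto simp: card_2_iff)
  have two: "e - insert v Y = {}" if "e \<in> E" "v \<in> e" "e \<inter> Y \<noteq> {}" for e
    using c2[OF that(1)] that(2,3) v by (auto simp: card_2_iff)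
  have mem: "e \<in> bd E S \<longleftrightarrow> e \<in> E \<and> e \<inter> S \<noteq> {} \<and> e - S \<noteq> {}" for e S
    using bd_iff[OF c2, of e E S] bd_subset[of E S] by blast
  have s1: "bd E {v} = D \<union> P"
    unfolding set_eq_iff mem D_def P_def using out by blast
  have s2: "bd E Y = D \<union> Q"
    unfolding set_eq_iff mem D_def Q_def using v by blast
  have s3: "bd E (insert v Y) = P \<union> Q"
  proof (rule set_eqI)
    fix e
    show "e \<in> bd E (insert v Y) \<longleftrightarrow> e \<in> P \<union> Q"
      using out[of e] two[of e] unfolding mem P_def Q_def by (cases "v \<in> e") blast+
  qed
  have fin: "finite D" "finite P" "finite Q" using fE by (auto simp: D_def P_def Q_def)
  have "cut E {v} = card D + card P" "cut E Y = card D + card Q" "cut E (insert v Y) = card P + card Q"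
    unfolding cut_eq_card_bd s1 s2 s3 using fin
    by (auto intro!: card_Un_disjoint simp: D_def P_def Q_def)
  moreover have "card (nbh E v \<inter> Y) = card D"
  proof (rule bij_betw_same_card[of "\<lambda>u. {u,v}"], unfold bij_betw_def, intro conjI)
    show "inj_on (\<lambda>u. {u,v}) (nbh E v \<inter> Y)" by (auto simp: inj_on_def doubleton_eq_iff)
    show "(\<lambda>u. {u,v}) ` (nbh E v \<inter> Y) = D"
    proof (intro equalityI subsetI)
      fix e assume e: "e \<in> D"
      then obtain y where y: "y \<in> e" "y \<in> Y" "y \<noteq> v" using v by (auto simp: D_def)
      have "e = {y,v}" using c2[of e] e y by (auto simp: D_def card_2_iff)
      then show "e \<in> (\<lambda>u. {u,v}) ` (nbh E v \<inter> Y)" using e y by (auto simp: nbh_def D_def)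
    qed (auto simp: nbh_def D_def)
  qed
  ultimately show ?thesis by simp
qed

text \<open>By \<open>cut_star\<close> these three answers give the number of neighbours of v in T.
  Intersecting T with \<open>nbh X v\<close> restricts the count to the target pairs although the
  queries see all edges.\<close>

definition star_queries :: "'v set set \<Rightarrow> 'v \<Rightarrow> 'v set \<Rightarrow> 'v set list" where
  "star_queries X v T = [{v}, T \<inter> nbh X v, insert v (T \<inter> nbh X v)]"

lemma star_queries_determine:
  assumes "finite V" "E \<subseteq> pairs V" "E' \<subseteq> pairs V" "X \<subseteq> pairs V"
    and "\<And>S. S \<in> set (star_queries X v T) \<Longrightarrow> cut E S = cut E' S"
  shows "card (nbh (E \<inter> X) v \<inter> T) = card (nbh (E' \<inter> X) v \<inter> T)"
proof -
  have fin: "finite E" "finite E'" using assms finite_pairs finite_subset by blast+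
  have v: "v \<notin> T \<inter> nbh X v" using nbh_subset[OF assms(4)] by blast
  have "card (nbh E v \<inter> (T \<inter> nbh X v)) = card (nbh E' v \<inter> (T \<inter> nbh X v))"
    using cut_star[OF fin(1) assms(2) v] cut_star[OF fin(2) assms(3) v] assms(5)
    by (simp add: star_queries_def)
  then show ?thesis by (simp add: nbh_Int Int_ac)
qed

text \<open>Turns a plan \<open>q\<close>, \<open>res\<close> written in terms of the hidden edge
  set into an algorithm. The algorithm picks any graph of the class that is consistent with the
  answers so far and follows the plan for it; the hypotheses say that the choice does not
  matter.\<close>

lemma history_determines_algorithm:
  fixes q :: "nat \<Rightarrow> 'v set set \<Rightarrow> 'v set list" and res :: "'v set set \<Rightarrow> nat"
  defines "agree \<equiv> \<lambda>i E E'. \<forall>j<i. q j E = q j E' \<and> map (cut E) (q j E) = map (cut E') (q j E')"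
  assumes q: "\<And>i E E'. i < R \<Longrightarrow> E \<in> \<C> \<Longrightarrow> E' \<in> \<C> \<Longrightarrow> agree i E E' \<Longrightarrow> q i E = q i E'"
    and res: "\<And>E E'. E \<in> \<C> \<Longrightarrow> E' \<in> \<C> \<Longrightarrow> agree R E E' \<Longrightarrow> res E = res E'"
  shows "\<exists>a. \<forall>E\<in>\<C>. (\<forall>i<R. round_queries a E i = q i E) \<and> result a (history a E R) = res E"
proof -
  define hist where "hist = (\<lambda>E i. map (\<lambda>j. map (cut E) (q j E)) [0..<i])"
  \<comment> \<open>The round number is recovered as the length of the history.\<close>
  define pick where "pick = (\<lambda>h. SOME E. E \<in> \<C> \<and> hist E (length h) = h)"
  define a where "a = \<lparr>queries = (\<lambda>h. q (length h) (pick h)), result = (\<lambda>h. res (pick h))\<rparr>"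
  have agree: "agree i E E'" if E: "E \<in> \<C>" "E' \<in> \<C>" "hist E i = hist E' i" "i \<le> R" for i E E'
    using E(3,4)
  proof (induction i)
    case 0
    then show ?case by (simp add: agree_def)
  next
    case (Suc i)
    then have "agree i E E'" by (simp add: hist_def)
    moreover have "q i E = q i E'" using q[OF _ E(1,2) \<open>agree i E E'\<close>] Suc.prems by simp
    moreover have "map (cut E) (q i E) = map (cut E') (q i E')" using Suc.prems by (simp add: hist_def)
    ultimately show ?case by (auto simp: agree_def less_Suc_eq)
  qed
  have pick: "pick (hist E i) \<in> \<C> \<and> agree i (pick (hist E i)) E" if "E \<in> \<C>" "i \<le> R" for E i
  proof -
    have "pick (hist E i) \<in> \<C> \<and> hist (pick (hist E i)) i = hist E i"
      unfolding pick_def using that(1)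
      by (intro someI2_ex[where Q = "\<lambda>E'. E' \<in> \<C> \<and> hist E' i = hist E i"]) (auto simp: hist_def)
    then show ?thesis using agree that by blast
  qed
  have h: "history a E i = hist E i" if "E \<in> \<C>" "i \<le> R" for E i
    using that(2)
  proof (induction i)
    case 0
    then show ?case by (simp add: hist_def)
  next
    case (Suc i)
    have "queries a (hist E i) = q i E"
      using pick[OF that(1), of i] q[of i "pick (hist E i)" E] that(1) Suc.prems
      by (simp add: a_def hist_def)
    then show ?case using Suc by (simp add: hist_def)
  qed
  have "round_queries a E i = q i E" if "E \<in> \<C>" "i < R" for E i
    using pick[OF that(1), of i] q[of i "pick (hist E i)" E] that h[of E i]
    by (simp add: round_queries_def a_def hist_def)
  moreover have "result a (history a E R) = res E" if "E \<in> \<C>" for E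
    using pick[OF that, of R] res[of "pick (hist E R)" E] that h[of E R] by (simp add: a_def)
  ultimately show ?thesis by blast
qed

lemma sum_lessThan_double: "(\<Sum>i<2 * K. f i) = (\<Sum>k<K. f (2 * k) + f (2 * k + 1))"
  for f :: "nat \<Rightarrow> nat"
  by (induction K) auto

text \<open>
  A stage \<open>k\<close> takes two rounds: the first reveals the degrees in the target set \<open>X k E\<close> of pairs,
  the second reads each neighbourhood with a separating family adapted to its size. A stage whose
  target contains more than \<open>M\<close> edges ends the run, which keeps the query bound unconditional.
\<close>

lemma staged_learning:
  fixes X :: "nat \<Rightarrow> 'v set set \<Rightarrow> 'v set set" and res :: "'v set set \<Rightarrow> nat"
  assumes V: "finite V" and b: "card V + 1 \<le> 2 ^ b" and R: "2 * K \<le> R"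
    and X: "\<And>k E. X k E \<subseteq> pairs V"
    and Xdet: "\<And>k E E'. k < K \<Longrightarrow> E \<subseteq> pairs V \<Longrightarrow> E' \<subseteq> pairs V \<Longrightarrow>
      (\<And>j. j < k \<Longrightarrow> X j E = X j E' \<and> E \<inter> X j E = E' \<inter> X j E) \<Longrightarrow> X k E = X k E'"
    and resdet: "\<And>E E'. E \<subseteq> pairs V \<Longrightarrow> E' \<subseteq> pairs V \<Longrightarrow>
      (\<And>j. j < K \<Longrightarrow> X j E = X j E' \<and> E \<inter> X j E = E' \<inter> X j E) \<Longrightarrow> res E = res E'"
  shows "\<exists>a. \<forall>E. simple_graph V E \<longrightarrow>
    (\<forall>i<R. \<forall>S\<in>set (round_queries a E i). S \<subseteq> V) \<and>
    num_queries a E R \<le> K * (6 * card V + 12 * b * M) \<and>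
    ((\<forall>k<K. card (E \<inter> X k E) \<le> M) \<longrightarrow> result a (history a E R) = res E)"
proof -
  obtain vs where vs: "set vs = V" "distinct vs" using V finite_distinct_list by blast
  have lvs: "length vs = card V" using vs distinct_card by force
  obtain Sep where Sep: "\<And>d. length (Sep d) = 2 * d * b + 1" "\<And>d. separates V d (Sep d)"
    using separating_family_exists[OF V b] by metis
  define deg where "deg = (\<lambda>F (v::'v). card (nbh F v))"
  \<comment> \<open>With T = V the star queries give the degrees within the target; the second round
    then spends on v a family sized to its degree.\<close>
  define degq where "degq = (\<lambda>Y :: 'v set set. concat (map (\<lambda>v. star_queries Y v V) vs))"
  define rowq where "rowq = (\<lambda>(Y :: 'v set set) d. concat (map (\<lambda>v. concat (map (star_queries Y v) (Sep (d v)))) vs))"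
  \<comment> \<open>\<open>ok k\<close> says that the first k stages stayed within the limit
    \<open>M\<close>. For the current stage the degrees decide this before its second round, by the
    handshake identity.\<close>
  define ok where "ok = (\<lambda>k E. \<forall>j<k. card (E \<inter> X j E) \<le> M)"
  define q where "q = (\<lambda>i E. let k = i div 2; Y = X k E in
     if i < 2 * K \<and> ok k E
     then if even i then degq Y else if card (E \<inter> Y) \<le> M then rowq Y (deg (E \<inter> Y)) else []
     else [])"
  define agree where
    "agree = (\<lambda>i E E'. \<forall>j<i. q j E = q j E' \<and> map (cut E) (q j E) = map (cut E') (q j E'))"
  have agree_less: "agree j E E'" if "agree i E E'" "j \<le> i" for i j E E'
    using that unfolding agree_def by (meson less_le_trans)
  have agree_map: "map (cut E) (q j E) = map (cut E') (q j E)" if "agree i E E'" "j < i" for i j E E'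
    using that unfolding agree_def by metis
  have q0: "q (2 * k) E = (if ok k E then degq (X k E) else [])" if "k < K" for k E
    using that by (simp add: q_def)
  have q1: "q (2 * k + 1) E = (if ok (Suc k) E then rowq (X k E) (deg (E \<inter> X k E)) else [])"
    if "k < K" for k E
    using that by (auto simp: q_def ok_def less_Suc_eq Let_def)
  have deg_eq: "deg (E \<inter> Y) = deg (E' \<inter> Y)"
    if E: "E \<subseteq> pairs V" "E' \<subseteq> pairs V" "Y \<subseteq> pairs V"
      and same: "map (cut E) (degq Y) = map (cut E') (degq Y)" for E E' Y
  proof
    fix v
    have sub: "nbh (E \<inter> Y) v \<subseteq> V - {v}" "nbh (E' \<inter> Y) v \<subseteq> V - {v}"
      using nbh_subset[of "E \<inter> Y" V v] nbh_subset[of "E' \<inter> Y" V v] E by auto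
    show "deg (E \<inter> Y) v = deg (E' \<inter> Y) v"
    proof (cases "v \<in> V")
      case True
      have "card (nbh (E \<inter> Y) v \<inter> V) = card (nbh (E' \<inter> Y) v \<inter> V)"
        using same True vs by (intro star_queries_determine[OF V E]) (auto simp: degq_def)
      moreover have "nbh (E \<inter> Y) v \<inter> V = nbh (E \<inter> Y) v" "nbh (E' \<inter> Y) v \<inter> V = nbh (E' \<inter> Y) v"
        using sub by auto
      ultimately show ?thesis by (simp add: deg_def)
    next
      case False
      have "nbh F v = {}" if "F \<subseteq> pairs V" for F using that False by (auto simp: nbh_def pairs_def)
      then show ?thesis using E by (simp add: deg_def le_infI1)
    qed
  qed
  have card_eq: "card (E \<inter> Y) = card (E' \<inter> Y)"
    if E: "E \<subseteq> pairs V" "E' \<subseteq> pairs V" and "deg (E \<inter> Y) = deg (E' \<inter> Y)" for E E' Y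
  proof -
    have "(\<Sum>v\<in>V. deg (E \<inter> Y) v) = 2 * card (E \<inter> Y)" "(\<Sum>v\<in>V. deg (E' \<inter> Y) v) = 2 * card (E' \<inter> Y)"
      unfolding deg_def by (intro sum_card_nbh V; use E in blast)+
    then show ?thesis using that(3) by simp
  qed
  have row_eq: "E \<inter> Y = E' \<inter> Y"
    if E: "E \<subseteq> pairs V" "E' \<subseteq> pairs V" "Y \<subseteq> pairs V"
      and dd: "deg (E \<inter> Y) = deg (E' \<inter> Y)"
      and same: "map (cut E) (rowq Y (deg (E \<inter> Y))) = map (cut E') (rowq Y (deg (E \<inter> Y)))" for E E' Y
  proof (rule edges_eq_if_nbh_eq)
    show EY: "E \<inter> Y \<subseteq> pairs V" "E' \<inter> Y \<subseteq> pairs V" using E by auto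
    fix v assume v: "v \<in> V"
    have T: "card (nbh (E \<inter> Y) v \<inter> T) = card (nbh (E' \<inter> Y) v \<inter> T)"
      if "T \<in> set (Sep (deg (E \<inter> Y) v))" for T
      using same v vs that by (intro star_queries_determine[OF V E]) (auto simp: rowq_def)
    have "card (nbh (E \<inter> Y) v) \<le> deg (E \<inter> Y) v" "card (nbh (E' \<inter> Y) v) \<le> deg (E \<inter> Y) v"
      using fun_cong[OF dd, of v] by (simp_all add: deg_def)
    moreover have "nbh (E \<inter> Y) v \<subseteq> V" "nbh (E' \<inter> Y) v \<subseteq> V"
      using nbh_subset[OF EY(1)] nbh_subset[OF EY(2)] by auto
    ultimately show "nbh (E \<inter> Y) v = nbh (E' \<inter> Y) v"
      using T Sep(2)[of "deg (E \<inter> Y) v", unfolded separates_def, THEN conjunct2, rule_format,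
          of "nbh (E \<inter> Y) v" "nbh (E' \<inter> Y) v"] by simp
  qed
  \<comment> \<open>Equal degree answers fix the sizes, hence the abort decision and the separating
    families, whose answers then fix the edges of the target.\<close>
  have known: "ok k E = ok k E' \<and> (ok k E \<longrightarrow> (\<forall>j<k. X j E = X j E' \<and> E \<inter> X j E = E' \<inter> X j E))"
    if E: "E \<subseteq> pairs V" "E' \<subseteq> pairs V" and "k \<le> K" "agree (2 * k) E E'" for k E E'
    using that(3,4)
  proof (induction k)
    case 0
    then show ?case by (simp add: ok_def)
  next
    case (Suc k)
    have IH: "ok k E = ok k E'" "ok k E \<Longrightarrow> \<forall>j<k. X j E = X j E' \<and> E \<inter> X j E = E' \<inter> X j E"
      using Suc.IH Suc.prems agree_less[of "2 * Suc k" E E' "2 * k"] by auto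
    show ?case
    proof (cases "ok k E")
      case False
      then show ?thesis using IH(1) by (auto simp: ok_def)
    next
      case True
      have XX: "X k E = X k E'"
      proof (rule Xdet[OF _ E])
        show "k < K" using Suc.prems(1) by simp
        show "X j E = X j E' \<and> E \<inter> X j E = E' \<inter> X j E" if "j < k" for j
          using IH(2)[OF True] that by blast
      qed
      have "map (cut E) (q (2 * k) E) = map (cut E') (q (2 * k) E)"
        using agree_map[OF Suc.prems(2), of "2 * k"] by simp
      then have d: "deg (E \<inter> X k E) = deg (E' \<inter> X k E)"
        using True IH(1) XX Suc.prems(1) by (intro deg_eq E X) (simp add: q0)
      have c: "card (E \<inter> X k E) = card (E' \<inter> X k E')" using card_eq[OF E d] XX by simp
      have okS: "ok (Suc k) E = ok (Suc k) E'" using IH(1) c by (auto simp: ok_def less_Suc_eq)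
      have "E \<inter> X k E = E' \<inter> X k E" if o: "ok (Suc k) E"
      proof -
        have "map (cut E) (q (2 * k + 1) E) = map (cut E') (q (2 * k + 1) E)"
          using agree_map[OF Suc.prems(2), of "2 * k + 1"] by simp
        moreover have "q (2 * k + 1) E = rowq (X k E) (deg (E \<inter> X k E))"
          using q1[of k E] o Suc.prems(1) by simp
        ultimately have "E \<inter> X k E = E' \<inter> X k E" by (intro row_eq[OF E X d]) (simp only:)
        then show ?thesis using XX by simp
      qed
      then show ?thesis using okS IH(2)[OF True] XX by (auto simp: less_Suc_eq)
    qed
  qed
  have qdet: "q i E = q i E'"
    if E: "E \<subseteq> pairs V" "E' \<subseteq> pairs V" and ag: "agree i E E'" for i E E'
  proof (cases "i < 2 * K")
    case False
    then show ?thesis by (simp add: q_def)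
  next
    case True
    define k where "k = i div 2"
    have k: "k < K" using True by (auto simp: k_def)
    have kn: "ok k E = ok k E'" "ok k E \<Longrightarrow> \<forall>j<k. X j E = X j E' \<and> E \<inter> X j E = E' \<inter> X j E"
      using known[OF E, of k] agree_less[OF ag, of "2 * k"] k by (auto simp: k_def)
    show ?thesis
    proof (cases "ok k E")
      case False
      then show ?thesis using kn(1) by (simp add: q_def Let_def k_def[symmetric])
    next
      case okk: True
      have XX: "X k E = X k E'"
      proof (rule Xdet[OF k E])
        show "X j E = X j E' \<and> E \<inter> X j E = E' \<inter> X j E" if "j < k" for j
          using kn(2)[OF okk] that by blast
      qed
      show ?thesis
      proof (cases "even i")
        case True
        then show ?thesis using okk kn(1) XX by (simp add: q_def Let_def k_def[symmetric])
      next
        case False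
        then have i: "i = 2 * k + 1" by (simp add: k_def)
        have "map (cut E) (q (2 * k) E) = map (cut E') (q (2 * k) E)"
          using agree_map[OF ag, of "2 * k"] i by simp
        then have d: "deg (E \<inter> X k E) = deg (E' \<inter> X k E)"
          using okk kn(1) XX k by (intro deg_eq E X) (simp add: q0)
        have "card (E \<inter> X k E) = card (E' \<inter> X k E')" using card_eq[OF E d] XX by simp
        then have "ok (Suc k) E = ok (Suc k) E'" using kn(1) by (auto simp: ok_def less_Suc_eq)
        then show ?thesis using XX d k by (simp only: i q1)
      qed
    qed
  qed
  \<comment> \<open>The default 0 makes the answer of an aborted run depend on the history
    only.\<close>
  define res' where "res' = (\<lambda>E. if ok K E then res E else 0)"
  have resdet': "res' E = res' E'"
    if E: "E \<subseteq> pairs V" "E' \<subseteq> pairs V" and ag: "agree R E E'" for E E'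
  proof (cases "ok K E")
    case True
    have "res E = res E'"
    proof (rule resdet[OF E])
      show "X j E = X j E' \<and> E \<inter> X j E = E' \<inter> X j E" if "j < K" for j
        using known[OF E order_refl agree_less[OF ag R]] True that by blast
    qed
    then show ?thesis using known[OF E order_refl agree_less[OF ag R]] by (simp add: res'_def)
  next
    case False
    then show ?thesis using known[OF E order_refl agree_less[OF ag R]] by (simp add: res'_def)
  qed
  have "\<exists>a. \<forall>E\<in>{E. E \<subseteq> pairs V}.
    (\<forall>i<R. round_queries a E i = q i E) \<and> result a (history a E R) = res' E"
  proof (rule history_determines_algorithm)
    fix i E E' assume "E \<in> {E. E \<subseteq> pairs V}" "E' \<in> {E. E \<subseteq> pairs V}"
      "\<forall>j<i. q j E = q j E' \<and> map (cut E) (q j E) = map (cut E') (q j E')"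
    then show "q i E = q i E'" by (intro qdet) (simp_all only: mem_Collect_eq agree_def)
  next
    fix E E' assume "E \<in> {E. E \<subseteq> pairs V}" "E' \<in> {E. E \<subseteq> pairs V}"
      "\<forall>j<R. q j E = q j E' \<and> map (cut E) (q j E) = map (cut E') (q j E')"
    then show "res' E = res' E'" by (intro resdet') (simp_all only: mem_Collect_eq agree_def)
  qed
  then obtain a where a: "\<And>E. E \<subseteq> pairs V \<Longrightarrow>
    (\<forall>i<R. round_queries a E i = q i E) \<and> result a (history a E R) = res' E"
    by auto
  show ?thesis
  proof (intro exI[of _ a] allI impI)
    fix E assume "simple_graph V E"
    then have E: "E \<subseteq> pairs V" by (simp add: simple_graph_iff)
    have qa: "round_queries a E i = q i E" if "i < R" for i using a[OF E] that by blast
    have starV: "S \<subseteq> V" if "v \<in> V" "S \<in> set (star_queries (X k E) v T)" for v S k T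
      using that nbh_subset[OF X, of k E v] by (auto simp: star_queries_def)
    have degV: "S \<subseteq> V" if h: "S \<in> set (degq (X k E))" for S k
    proof -
      obtain v where "v \<in> V" "S \<in> set (star_queries (X k E) v V)"
        using h vs by (auto simp: degq_def)
      then show ?thesis by (rule starV)
    qed
    have rowV: "S \<subseteq> V" if h: "S \<in> set (rowq (X k E) d)" for S k d
    proof -
      obtain v T where "v \<in> V" "S \<in> set (star_queries (X k E) v T)"
        using h vs by (auto simp: rowq_def)
      then show ?thesis by (rule starV)
    qed
    have "S \<subseteq> V" if "S \<in> set (q i E)" for i S
      using that degV[of S "i div 2"] rowV[of S "i div 2"]
      by (simp add: q_def Let_def split: if_splits) blast
    moreover have "num_queries a E R \<le> K * (6 * card V + 12 * b * M)"
    proof -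
      have "num_queries a E R = (\<Sum>i<R. length (q i E))" by (simp add: num_queries_def qa)
      also have "\<dots> = (\<Sum>i<2 * K. length (q i E))"
        using R by (intro sum.mono_neutral_right) (auto simp: q_def Let_def)
      also have "\<dots> = (\<Sum>k<K. length (q (2 * k) E) + length (q (2 * k + 1) E))"
        by (rule sum_lessThan_double)
      also have "\<dots> \<le> (\<Sum>k<K. 6 * card V + 12 * b * M)"
      proof (intro sum_mono)
        fix k assume "k \<in> {..<K}"
        then have k: "k < K" by simp
        let ?Y = "X k E"
        have "length (degq ?Y) = 3 * card V"
          by (simp add: degq_def length_concat star_queries_def o_def sum_list_triv lvs)
        then have 0: "length (q (2 * k) E) \<le> 3 * card V" using q0[OF k] by simp
        \<comment> \<open>Three queries for each of the 2 d b + 1 tests at a vertex of degree d; the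
          degrees sum to twice the number of target edges, whence 12 b.\<close>
        have "length (rowq ?Y (deg (E \<inter> ?Y))) = (\<Sum>v\<leftarrow>vs. 6 * b * deg (E \<inter> ?Y) v + 3)"
          by (simp add: rowq_def length_concat star_queries_def o_def sum_list_triv Sep(1) algebra_simps
              numeral_3_eq_3)
        also have "\<dots> = (\<Sum>v\<in>V. 6 * b * deg (E \<inter> ?Y) v + 3)"
          using vs sum_list_distinct_conv_sum_set[OF vs(2)] by simp
        also have "\<dots> = 6 * b * (\<Sum>v\<in>V. deg (E \<inter> ?Y) v) + 3 * card V"
          by (simp add: sum.distrib sum_distrib_left)
        also have "(\<Sum>v\<in>V. deg (E \<inter> ?Y) v) = 2 * card (E \<inter> ?Y)"
          unfolding deg_def by (intro sum_card_nbh V) (use E in blast)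
        finally have row: "length (rowq ?Y (deg (E \<inter> ?Y))) = 12 * b * card (E \<inter> ?Y) + 3 * card V" by simp
        have 1: "length (q (2 * k + 1) E) \<le> 12 * b * M + 3 * card V"
        proof (cases "ok (Suc k) E")
          case True
          then have "card (E \<inter> ?Y) \<le> M" by (simp add: ok_def)
          then have "12 * b * card (E \<inter> ?Y) \<le> 12 * b * M" by (rule mult_le_mono2)
          then show ?thesis using row True q1[OF k] by simp
        qed (use q1[OF k] in simp)
        show "length (q (2 * k) E) + length (q (2 * k + 1) E) \<le> 6 * card V + 12 * b * M"
          using 0 1 by linarith
      qed
      finally show ?thesis by simp
    qed
    moreover have "result a (history a E R) = res E" if "\<forall>k<K. card (E \<inter> X k E) \<le> M"
      using a[OF E] that by (simp add: res'_def ok_def)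
    ultimately show "(\<forall>i<R. \<forall>S\<in>set (round_queries a E i). S \<subseteq> V) \<and>
      num_queries a E R \<le> K * (6 * card V + 12 * b * M) \<and>
      ((\<forall>k<K. card (E \<inter> X k E) \<le> M) \<longrightarrow> result a (history a E R) = res E)"
      using qa by auto
  qed
qed

subsection \<open>Random samples of pairs\<close>

lemma exp_le_quadratic:
  fixes x :: real
  assumes "\<bar>x\<bar> \<le> 1"
  shows "exp x \<le> 1 + x + x\<^sup>2"
proof (cases "x \<ge> 0")
  case True
  then show ?thesis using exp_bound[of x] assms by simp
next
  case False
  define y where "y = - x"
  have y: "y > 0" using False by (simp add: y_def)
  have "1 \<le> (1 + y) * (1 - y + y\<^sup>2)"
    using y by (simp add: algebra_simps power2_eq_square)
  then have "1 / (1 + y) \<le> 1 - y + y\<^sup>2" using y by (simp add: field_simps)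
  moreover have "exp x \<le> 1 / (1 + y)"
    using exp_ge_add_one_self[of y] y by (simp add: y_def exp_minus field_simps)
  ultimately show ?thesis by (simp add: y_def)
qed

lemma mgf_count_Pi_pmf:
  fixes p :: "'b pmf" and Q :: "'b \<Rightarrow> bool"
  assumes A: "finite A" "X \<subseteq> A"
  shows "measure_pmf.expectation (Pi_pmf A d (\<lambda>_. p)) (\<lambda>\<omega>. exp (l * real (card {x \<in> X. Q (\<omega> x)})))
    = (1 + measure_pmf.prob p {y. Q y} * (exp l - 1)) ^ card X"
proof -
  let ?f = "\<lambda>x y. if x \<in> X \<and> Q y then exp l else (1::real)"
  have "exp (l * real (card {x \<in> X. Q (\<omega> x)})) = (\<Prod>x\<in>A. ?f x (\<omega> x))" for \<omega>
  proof -
    have "(\<Prod>x\<in>A. ?f x (\<omega> x)) = (\<Prod>x\<in>A \<inter> {x. x \<in> X \<and> Q (\<omega> x)}. exp l)"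
      using A by (simp add: prod.If_cases)
    also have "A \<inter> {x. x \<in> X \<and> Q (\<omega> x)} = {x \<in> X. Q (\<omega> x)}" using A by auto
    finally show ?thesis by (simp add: exp_of_nat_mult[symmetric] mult.commute)
  qed
  then have "measure_pmf.expectation (Pi_pmf A d (\<lambda>_. p)) (\<lambda>\<omega>. exp (l * real (card {x \<in> X. Q (\<omega> x)})))
      = measure_pmf.expectation (Pi_pmf A d (\<lambda>_. p)) (\<lambda>\<omega>. \<Prod>x\<in>A. ?f x (\<omega> x))"
    by simp
  also have "\<dots> = (\<Prod>x\<in>A. measure_pmf.expectation p (?f x))"
  proof (rule expectation_prod_Pi_pmf[OF A(1)])
    show "integrable (measure_pmf p) (?f x)" for x
      by (rule measure_pmf.integrable_const_bound[where B = "max 1 (exp l)"]) auto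
  qed auto
  also have "\<dots> = (\<Prod>x\<in>A. if x \<in> X then 1 + measure_pmf.prob p {y. Q y} * (exp l - 1) else 1)"
  proof (intro prod.cong refl)
    fix x
    show "measure_pmf.expectation p (?f x) = (if x \<in> X then 1 + measure_pmf.prob p {y. Q y} * (exp l - 1) else 1)"
    proof (cases "x \<in> X")
      case True
      have "?f x = (\<lambda>y. 1 + indicator {y. Q y} y * (exp l - 1))"
        using True by (auto simp: indicator_def)
      moreover have "measure_pmf.expectation p (\<lambda>y. 1 + indicator {y. Q y} y * (exp l - 1))
          = 1 + measure_pmf.prob p {y. Q y} * (exp l - 1)"
      proof -
        have "integrable (measure_pmf p) (indicat_real {y. Q y})"
          by (rule measure_pmf.integrable_const_bound[where B = 1]) auto
        then show ?thesis by simp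
      qed
      ultimately show ?thesis using True by simp
    qed simp
  qed
  also have "\<dots> = (1 + measure_pmf.prob p {y. Q y} * (exp l - 1)) ^ card X"
    using A by (simp add: prod.If_cases Int_absorb1)
  finally show ?thesis .
qed

text \<open>The sign of l is free: positive l gives the upper tail and negative l the lower
  one.\<close>

lemma exp_markov_count:
  fixes p :: "'b pmf" and Q :: "'b \<Rightarrow> bool" and l a :: real
  assumes A: "finite A" "X \<subseteq> A"
  defines "q \<equiv> measure_pmf.prob p {y. Q y}"
  shows "measure_pmf.prob (Pi_pmf A d (\<lambda>_. p)) {\<omega>. a \<le> l * real (card {x \<in> X. Q (\<omega> x)})}
    \<le> exp (q * card X * (exp l - 1) - a)"
proof -
  let ?P = "Pi_pmf A d (\<lambda>_. p)" and ?N = "\<lambda>\<omega>. real (card {x \<in> X. Q (\<omega> x)})"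
  have fX: "finite X" using A finite_subset by blast
  have cle: "?N \<omega> \<le> real (card X)" for \<omega> using fX by (intro of_nat_mono card_mono) auto
  have int: "integrable ?P (\<lambda>\<omega>. exp (l * ?N \<omega>))"
  proof (rule measure_pmf.integrable_const_bound[where B = "exp (\<bar>l\<bar> * card X)"])
    have "l * ?N \<omega> \<le> \<bar>l\<bar> * card X" for \<omega>
    proof -
      have "l * ?N \<omega> \<le> \<bar>l\<bar> * ?N \<omega>" by (intro mult_right_mono) auto
      also have "\<dots> \<le> \<bar>l\<bar> * card X" using cle by (intro mult_left_mono) auto
      finally show ?thesis .
    qed
    then show "AE \<omega> in ?P. norm (exp (l * ?N \<omega>)) \<le> exp (\<bar>l\<bar> * card X)" by simp
  qed simp
  have "measure_pmf.prob ?P {\<omega>. a \<le> l * ?N \<omega>} = measure_pmf.expectation ?P (indicator {\<omega>. a \<le> l * ?N \<omega>})"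
    by simp
  also have "\<dots> \<le> measure_pmf.expectation ?P (\<lambda>\<omega>. exp (- a) * exp (l * ?N \<omega>))"
  proof (rule integral_mono)
    show "integrable ?P (indicator {\<omega>. a \<le> l * ?N \<omega>} :: _ \<Rightarrow> real)"
      by (rule measure_pmf.integrable_const_bound[where B = 1]) (auto simp: indicator_def)
    show "integrable ?P (\<lambda>\<omega>. exp (- a) * exp (l * ?N \<omega>))" using int by simp
    show "indicator {\<omega>. a \<le> l * ?N \<omega>} \<omega> \<le> exp (- a) * exp (l * ?N \<omega>)" for \<omega>
      by (auto simp: indicator_def simp flip: exp_add)
  qed
  also have "\<dots> = exp (- a) * (1 + q * (exp l - 1)) ^ card X"
    unfolding q_def by (simp add: mgf_count_Pi_pmf[OF A])
  also have "(1 + q * (exp l - 1)) ^ card X \<le> exp (q * (exp l - 1)) ^ card X"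
  proof (rule power_mono)
    show "1 + q * (exp l - 1) \<le> exp (q * (exp l - 1))" by (rule exp_ge_add_one_self)
    have "0 \<le> q" "q \<le> 1" by (simp_all add: q_def)
    then have "q * (- 1) \<le> q * (exp l - 1)" by (intro mult_left_mono) auto
    then show "0 \<le> 1 + q * (exp l - 1)" using \<open>q \<le> 1\<close> by linarith
  qed
  also have "exp (- a) * exp (q * (exp l - 1)) ^ card X = exp (q * card X * (exp l - 1) - a)"
    by (simp add: exp_of_nat_mult[symmetric] mult_ac flip: exp_add)
  finally show ?thesis by (simp add: mult_left_mono)
qed

text \<open>The deviation is measured against an upper bound \<mu> for card X, so that the same
  statement serves for sets much smaller than \<mu>.\<close>

lemma chernoff_count_Pi_pmf:
  fixes p :: "'b pmf" and Q :: "'b \<Rightarrow> bool" and \<epsilon> \<mu> :: real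
  assumes A: "finite A" "X \<subseteq> A" and \<mu>: "real (card X) \<le> \<mu>" and \<epsilon>: "0 < \<epsilon>" "\<epsilon> \<le> 1"
  defines "q \<equiv> measure_pmf.prob p {y. Q y}"
  shows "measure_pmf.prob (Pi_pmf A d (\<lambda>_. p))
      {\<omega>. \<not> \<bar>real (card {x \<in> X. Q (\<omega> x)}) - q * card X\<bar> < \<epsilon> * q * \<mu>}
    \<le> 2 * exp (- (\<epsilon>\<^sup>2 * q * \<mu> / 4))"
proof -
  let ?P = "Pi_pmf A d (\<lambda>_. p)" and ?N = "\<lambda>\<omega>. real (card {x \<in> X. Q (\<omega> x)})"
  let ?m = "real (card X)"
  have q: "0 \<le> q" by (simp add: q_def)
  \<comment> \<open>The parameter \<epsilon> / 2 makes the quadratic term at most \<epsilon>^2 q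
    \<mu> / 4, half of the gain \<epsilon>^2 q \<mu> / 2.\<close>
  define up where "up = {\<omega>. \<epsilon> / 2 * (q * ?m + \<epsilon> * q * \<mu>) \<le> \<epsilon> / 2 * ?N \<omega>}"
  define lo where "lo = {\<omega>. - (\<epsilon> / 2) * (q * ?m - \<epsilon> * q * \<mu>) \<le> - (\<epsilon> / 2) * ?N \<omega>}"
  have bound: "q * ?m * (exp l - 1) - l * (q * ?m) - \<epsilon>\<^sup>2 * q * \<mu> / 2 \<le> - (\<epsilon>\<^sup>2 * q * \<mu> / 4)"
    if "l\<^sup>2 = (\<epsilon> / 2)\<^sup>2" "\<bar>l\<bar> \<le> 1" for l
  proof -
    have "exp l - 1 \<le> l + (\<epsilon> / 2)\<^sup>2" using exp_le_quadratic[OF that(2)] that(1) by simp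
    then have "q * ?m * (exp l - 1) \<le> q * ?m * (l + (\<epsilon> / 2)\<^sup>2)"
      using q by (intro mult_left_mono) auto
    moreover have "q * ?m * (\<epsilon> / 2)\<^sup>2 \<le> q * \<mu> * (\<epsilon> / 2)\<^sup>2"
      using q \<mu> by (intro mult_right_mono mult_left_mono) auto
    ultimately show ?thesis by (simp add: algebra_simps power_divide)
  qed
  have "measure_pmf.prob ?P up \<le> exp (- (\<epsilon>\<^sup>2 * q * \<mu> / 4))"
  proof -
    have "measure_pmf.prob ?P up \<le> exp (q * ?m * (exp (\<epsilon> / 2) - 1) - \<epsilon> / 2 * (q * ?m + \<epsilon> * q * \<mu>))"
      unfolding up_def q_def by (rule exp_markov_count[OF A])
    also have "\<dots> \<le> exp (- (\<epsilon>\<^sup>2 * q * \<mu> / 4))"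
      using bound[of "\<epsilon> / 2"] \<epsilon> by (simp add: algebra_simps power2_eq_square)
    finally show ?thesis .
  qed
  moreover have "measure_pmf.prob ?P lo \<le> exp (- (\<epsilon>\<^sup>2 * q * \<mu> / 4))"
  proof -
    have "measure_pmf.prob ?P lo \<le> exp (q * ?m * (exp (- (\<epsilon> / 2)) - 1) - (- (\<epsilon> / 2) * (q * ?m - \<epsilon> * q * \<mu>)))"
      unfolding lo_def q_def by (rule exp_markov_count[OF A])
    also have "\<dots> \<le> exp (- (\<epsilon>\<^sup>2 * q * \<mu> / 4))"
      using bound[of "- (\<epsilon> / 2)"] \<epsilon> by (simp add: algebra_simps power2_eq_square)
    finally show ?thesis .
  qed
  moreover have "{\<omega>. \<not> \<bar>?N \<omega> - q * ?m\<bar> < \<epsilon> * q * \<mu>} \<subseteq> up \<union> lo"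
  proof
    fix \<omega> assume "\<omega> \<in> {\<omega>. \<not> \<bar>?N \<omega> - q * ?m\<bar> < \<epsilon> * q * \<mu>}"
    then have "q * ?m + \<epsilon> * q * \<mu> \<le> ?N \<omega> \<or> ?N \<omega> \<le> q * ?m - \<epsilon> * q * \<mu>" by auto
    then show "\<omega> \<in> up \<union> lo"
    proof
      assume "q * ?m + \<epsilon> * q * \<mu> \<le> ?N \<omega>"
      then have "\<omega> \<in> up" unfolding up_def using \<epsilon> by (intro CollectI mult_left_mono) auto
      then show ?thesis by simp
    next
      assume "?N \<omega> \<le> q * ?m - \<epsilon> * q * \<mu>"
      then have "\<omega> \<in> lo" unfolding lo_def using \<epsilon> by (intro CollectI mult_left_mono_neg) auto
      then show ?thesis by simp
    qed
  qed
  then have "measure_pmf.prob ?P {\<omega>. \<not> \<bar>?N \<omega> - q * ?m\<bar> < \<epsilon> * q * \<mu>} \<le> measure_pmf.prob ?P (up \<union> lo)"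
    by (intro measure_pmf.finite_measure_mono) auto
  moreover have "measure_pmf.prob ?P (up \<union> lo) \<le> measure_pmf.prob ?P up + measure_pmf.prob ?P lo"
    by (intro measure_Un_le) auto
  ultimately show ?thesis by linarith
qed

lemma prob_geometric_atLeast:
  assumes "0 < \<beta>" "\<beta> < 1"
  shows "measure_pmf.prob (geometric_pmf (1 - \<beta>)) {y. i \<le> y} = \<beta> ^ i"
proof -
  have "measure_pmf.prob (geometric_pmf (1 - \<beta>)) {..<i} = (\<Sum>k<i. \<beta> ^ k * (1 - \<beta>))"
    using assms by (simp add: measure_measure_pmf_finite)
  also have "\<dots> = 1 - \<beta> ^ i"
    by (induction i) (auto simp: algebra_simps)
  finally have "measure_pmf.prob (geometric_pmf (1 - \<beta>)) {..<i} = 1 - \<beta> ^ i" .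
  moreover have "{y. i \<le> y} = space (measure_pmf (geometric_pmf (1 - \<beta>))) - {..<i}" by auto
  ultimately show ?thesis
    using measure_pmf.prob_compl[of "{..<i}" "geometric_pmf (1 - \<beta>)"] by simp
qed

text \<open>
  The level of a pair is geometric, so the pairs of level at least \<open>i\<close> form nested samples, and
  the \<open>i\<close>-th one contains each pair independently with probability \<open>\<beta> ^ i\<close>.
\<close>

definition sample :: "'v set \<Rightarrow> real \<Rightarrow> ('v set \<Rightarrow> nat) pmf" where
  "sample V \<beta> = Pi_pmf (pairs V) 0 (\<lambda>_. geometric_pmf (1 - \<beta>))"

lemma sample_deviation:
  assumes "finite V" "X \<subseteq> pairs V" "0 < \<beta>" "\<beta> < 1" "real (card X) \<le> \<mu>" "0 < \<epsilon>" "\<epsilon> \<le> 1"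
  shows "measure_pmf.prob (sample V \<beta>)
      {\<omega>. \<not> \<bar>real (card {e \<in> X. i \<le> \<omega> e}) - \<beta> ^ i * card X\<bar> < \<epsilon> * \<beta> ^ i * \<mu>}
    \<le> 2 * exp (- (\<epsilon>\<^sup>2 * \<beta> ^ i * \<mu> / 4))"
  using chernoff_count_Pi_pmf[OF finite_pairs[OF assms(1)] assms(2,5-7), of 0 "geometric_pmf (1 - \<beta>)" "\<lambda>y. i \<le> y"]
  by (simp add: sample_def prob_geometric_atLeast[OF assms(3,4)])

section \<open>Union bounds\<close>

lemma prob_Bex_le_sum:
  assumes "finite I"
  shows "measure_pmf.prob p {\<omega>. \<exists>i\<in>I. B i \<omega>} \<le> (\<Sum>i\<in>I. measure_pmf.prob p {\<omega>. B i \<omega>})"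
proof -
  have "{\<omega>. \<exists>i\<in>I. B i \<omega>} = (\<Union>i\<in>I. {\<omega>. B i \<omega>})" by auto
  then show ?thesis using measure_UNION_le[OF assms, of "\<lambda>i. {\<omega>. B i \<omega>}" "measure_pmf p"] by simp
qed

lemma prob_Bex_le:
  fixes b :: real
  assumes "finite I" "\<And>i. i \<in> I \<Longrightarrow> measure_pmf.prob p {\<omega>. B i \<omega>} \<le> b"
  shows "measure_pmf.prob p {\<omega>. \<exists>i\<in>I. B i \<omega>} \<le> card I * b"
proof -
  have "(\<Sum>i\<in>I. measure_pmf.prob p {\<omega>. B i \<omega>}) \<le> card I * b"
    using sum_bounded_above[of I "\<lambda>i. measure_pmf.prob p {\<omega>. B i \<omega>}" b] assms(2) by simp
  then show ?thesis using prob_Bex_le_sum[OF assms(1), of p B] by linarith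
qed

lemma exp_neg_ln_le:
  fixes n :: nat
  assumes "n > 0" "real k * ln n \<le> x"
  shows "exp (- x) \<le> 1 / real n ^ k"
proof -
  have "exp (- x) \<le> exp (- (real k * ln n))" using assms(2) by simp
  also have "\<dots> = 1 / real n ^ k" using assms(1) by (simp add: exp_minus exp_of_nat_mult field_simps)
  finally show ?thesis .
qed

text \<open>Union bound over distinct edge sets, grouped by a = card X div \<kappa>: there are at
  most n^(8 a) of them, each failing with probability at most 2 / n^((c + 14) a). The deviation is
  relative to the whole cut, whose part in \<open>G\<close> may be small; \<open>G\<close> is any
  set fixed before sampling.\<close>

lemma projection_concentration:
  fixes E :: "'v set set" and V :: "'v set" and c :: nat and \<beta> \<epsilon> :: real
  assumes V: "finite V" and E: "E \<subseteq> pairs V" and n: "card V \<ge> 2" and \<kappa>: "\<kappa> > 0"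
    and \<beta>: "0 < \<beta>" "\<beta> < 1" and \<epsilon>: "0 < \<epsilon>" "\<epsilon> \<le> 1"
    and big: "real (c + 14) * ln (card V) \<le> \<epsilon>\<^sup>2 * \<beta> ^ i * \<kappa> / 4"
  defines "K \<equiv> {e \<in> E. inside V \<kappa> E e}"
  shows "measure_pmf.prob (sample V \<beta>) {\<omega>. \<exists>S. bd K S \<noteq> {} \<and>
      \<not> \<bar>real (card {e \<in> bd K S \<inter> G. i \<le> \<omega> e}) - \<beta> ^ i * card (bd K S \<inter> G)\<bar>
          < \<epsilon> * \<beta> ^ i * card (bd K S)} \<le> 1 / real (card V) ^ (c + 3)"
proof -
  let ?n = "real (card V)" and ?P = "sample V \<beta>"
  have fE: "finite E" using V E finite_pairs finite_subset by blast
  have KE: "K \<subseteq> E" by (auto simp: K_def)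
  then have KV: "K \<subseteq> pairs V" and fK: "finite K" using E fE finite_subset by blast+
  have heavy: "bd K S = {} \<or> \<kappa> \<le> card (bd K S)" for S
    unfolding K_def by (rule inside_cut_ge[OF fE E])
  define \<D> where "\<D> = {X. \<exists>S. X = bd K S} - {{}}"
  define bad where "bad = (\<lambda>X \<omega>. \<not> \<bar>real (card {e \<in> X \<inter> G. i \<le> \<omega> e}) - \<beta> ^ i * card (X \<inter> G)\<bar>
          < \<epsilon> * \<beta> ^ i * card X)"
  have DK: "X \<subseteq> K" if "X \<in> \<D>" for X using that bd_subset[of K] by (auto simp: \<D>_def)
  then have fD: "finite \<D>" using fK by (intro finite_subset[of \<D> "Pow K"]) auto
  define a where "a = (\<lambda>X :: 'v set set. card X div \<kappa>)"
  have aD: "a X \<in> {1..card V ^ 2}" if "X \<in> \<D>" for X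
  proof -
    have "\<kappa> \<le> card X" using that heavy by (auto simp: \<D>_def)
    then have "1 \<le> a X" using \<kappa> by (simp add: a_def div_greater_zero_iff Suc_leI)
    moreover have "a X \<le> card X" by (simp add: a_def)
    moreover have "card X \<le> card (pairs V)"
      using DK[OF that] KV finite_pairs[OF V] by (intro card_mono) auto
    ultimately show ?thesis using card_pairs_le[OF V] by simp
  qed
  have prob: "measure_pmf.prob ?P {\<omega>. bad X \<omega>} \<le> 2 / ?n ^ ((c + 14) * a X)" if X: "X \<in> \<D>" for X
  proof -
    have fX: "finite X" using DK[OF X] fK finite_subset by blast
    have "measure_pmf.prob ?P {\<omega>. bad X \<omega>} \<le> 2 * exp (- (\<epsilon>\<^sup>2 * \<beta> ^ i * card X / 4))"
      unfolding bad_def using DK[OF X] KV fX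
      by (intro sample_deviation V \<beta> \<epsilon>) (auto intro: card_mono)
    also have "exp (- (\<epsilon>\<^sup>2 * \<beta> ^ i * card X / 4)) \<le> 1 / ?n ^ ((c + 14) * a X)"
    proof (rule exp_neg_ln_le)
      show "0 < card V" using n by simp
      have "a X * \<kappa> \<le> card X" by (simp add: a_def)
      then have le: "real (a X) * real \<kappa> \<le> real (card X)" by (simp flip: of_nat_mult)
      have "real ((c + 14) * a X) * ln ?n = (real (c + 14) * ln ?n) * real (a X)" by (simp only: of_nat_mult mult_ac)
      also have "\<dots> \<le> (\<epsilon>\<^sup>2 * \<beta> ^ i * \<kappa> / 4) * real (a X)" using big by (rule mult_right_mono) simp
      also have "\<dots> = (\<epsilon>\<^sup>2 * \<beta> ^ i / 4) * (real (a X) * real \<kappa>)" by (simp add: mult_ac)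
      also have "\<dots> \<le> (\<epsilon>\<^sup>2 * \<beta> ^ i / 4) * real (card X)" using le \<beta> by (intro mult_left_mono) auto
      finally show "real ((c + 14) * a X) * ln ?n \<le> \<epsilon>\<^sup>2 * \<beta> ^ i * real (card X) / 4" by simp
    qed
    finally show ?thesis by simp
  qed
  have "measure_pmf.prob ?P {\<omega>. \<exists>X\<in>\<D>. bad X \<omega>} \<le> (\<Sum>X\<in>\<D>. measure_pmf.prob ?P {\<omega>. bad X \<omega>})"
    by (rule prob_Bex_le_sum[OF fD])
  also have "\<dots> \<le> (\<Sum>X\<in>\<D>. 2 / ?n ^ ((c + 14) * a X))" by (intro sum_mono prob)
  also have "\<dots> = (\<Sum>j\<in>{1..card V ^ 2}. \<Sum>X\<in>{X \<in> \<D>. a X = j}. 2 / ?n ^ ((c + 14) * a X))"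
    using aD by (intro sum.group[symmetric] fD) auto
  \<comment> \<open>Of the 14 in the exponent, 8 pay for the number of cuts; of the remaining 6, 3
    pay for the n^2 groups and the factor 2.\<close>
  also have "\<dots> \<le> (\<Sum>j\<in>{1..card V ^ 2}. 2 / ?n ^ (c + 6))"
  proof (intro sum_mono)
    fix j assume j: "j \<in> {1..card V ^ 2}"
    have "{X \<in> \<D>. a X = j} \<subseteq> {X. \<exists>S. X = bd K S \<and> card X \<le> (j + 1) * \<kappa>}"
    proof
      fix X assume X: "X \<in> {X \<in> \<D>. a X = j}"
      have "card X < (card X div \<kappa> + 1) * \<kappa>" using \<kappa>
        by (metis Suc_eq_plus1 dividend_less_div_times mult_Suc add.commute)
      then show "X \<in> {X. \<exists>S. X = bd K S \<and> card X \<le> (j + 1) * \<kappa>}"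
        using X by (auto simp: \<D>_def a_def)
    qed
    then have "card {X \<in> \<D>. a X = j} \<le> card {X. \<exists>S. X = bd K S \<and> card X \<le> (j + 1) * \<kappa>}"
    proof (rule card_mono[rotated])
      have "{X. \<exists>S. X = bd K S \<and> card X \<le> (j + 1) * \<kappa>} \<subseteq> Pow K"
        using bd_subset by fast
      then show "finite {X. \<exists>S. X = bd K S \<and> card X \<le> (j + 1) * \<kappa>}"
        by (rule finite_subset) (simp add: fK)
    qed
    also have "\<dots> \<le> (2 * card V) ^ (2 * (j + 1))"
      using V n KV heavy \<kappa> by (intro karger_count) auto
    also have "\<dots> \<le> (card V ^ 2) ^ (2 * (j + 1))"
      using n by (intro power_mono) (simp_all add: power2_eq_square)
    \<comment> \<open>Here j is at least 1, so 4 (j + 1) is at most 8 j.\<close>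
    also have "\<dots> \<le> card V ^ (8 * j)"
      unfolding power_mult[symmetric] using n j by (intro power_increasing) auto
    finally have "card {X \<in> \<D>. a X = j} \<le> card V ^ (8 * j)" .
    then have cnt: "real (card {X \<in> \<D>. a X = j}) \<le> ?n ^ (8 * j)"
      by (simp only: of_nat_le_iff flip: of_nat_power)
    have "(\<Sum>X\<in>{X \<in> \<D>. a X = j}. 2 / ?n ^ ((c + 14) * a X)) = real (card {X \<in> \<D>. a X = j}) * (2 / ?n ^ ((c + 14) * j))"
      by simp
    also have "\<dots> \<le> ?n ^ (8 * j) * (2 / ?n ^ ((c + 14) * j))"
      using cnt by (rule mult_right_mono) simp
    also have "?n ^ ((c + 14) * j) = ?n ^ (8 * j) * ?n ^ ((c + 6) * j)"
      by (simp add: algebra_simps flip: power_add)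
    also have "?n ^ (8 * j) * (2 / (?n ^ (8 * j) * ?n ^ ((c + 6) * j))) = 2 / ?n ^ ((c + 6) * j)"
      using n by simp
    also have "\<dots> \<le> 2 / ?n ^ (c + 6)"
      using n j by (intro divide_left_mono power_increasing) auto
    finally show "(\<Sum>X\<in>{X \<in> \<D>. a X = j}. 2 / ?n ^ ((c + 14) * a X)) \<le> 2 / ?n ^ (c + 6)" .
  qed
  also have "\<dots> = ?n ^ 2 * 2 / ?n ^ (c + 6)" by simp
  also have "\<dots> \<le> ?n ^ 2 * ?n / ?n ^ (c + 6)"
    using n by (intro divide_right_mono mult_left_mono) auto
  also have "?n ^ 2 * ?n = ?n ^ 3" by (simp add: power2_eq_square power3_eq_cube)
  also have "?n ^ (c + 6) = ?n ^ 3 * ?n ^ (c + 3)" by (simp add: add_ac flip: power_add)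
  also have "?n ^ 3 / (?n ^ 3 * ?n ^ (c + 3)) = 1 / ?n ^ (c + 3)" using n by simp
  finally have "measure_pmf.prob ?P {\<omega>. \<exists>X\<in>\<D>. bad X \<omega>} \<le> 1 / ?n ^ (c + 3)" .
  moreover have "{\<omega>. \<exists>S. bd K S \<noteq> {} \<and>
      \<not> \<bar>real (card {e \<in> bd K S \<inter> G. i \<le> \<omega> e}) - \<beta> ^ i * card (bd K S \<inter> G)\<bar>
          < \<epsilon> * \<beta> ^ i * card (bd K S)} = {\<omega>. \<exists>X\<in>\<D>. bad X \<omega>}"
    by (auto simp: \<D>_def bad_def)
  ultimately show ?thesis by simp
qed

subsection \<open>The sparsifier\<close>

text \<open>Independence enters here: the bound for \<open>Q x\<close> holds for every fixed x, so
  events of the second sample may refer to the first.\<close>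

lemma prob_pair_pmf_le:
  assumes "measure_pmf.prob A {x. \<not> P x} \<le> a" "\<And>x. measure_pmf.prob B {y. \<not> Q x y} \<le> b"
  shows "measure_pmf.prob (pair_pmf A B) {(x, y). \<not> (P x \<and> Q x y)} \<le> a + b"
proof -
  have nn: "0 \<le> a" "0 \<le> b" using assms measure_nonneg order_trans by blast+
  have "emeasure (measure_pmf (pair_pmf A B)) {(x, y). \<not> (P x \<and> Q x y)}
      = (\<integral>\<^sup>+x. emeasure (measure_pmf (map_pmf (Pair x) B)) {(x, y). \<not> (P x \<and> Q x y)} \<partial>measure_pmf A)"
    unfolding pair_pmf_def map_pmf_def[symmetric] by (simp add: emeasure_bind_pmf map_pmf_def)
  also have "\<dots> \<le> (\<integral>\<^sup>+x. indicator {x. \<not> P x} x + ennreal b \<partial>measure_pmf A)"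
  proof (rule nn_integral_mono)
    fix x
    show "emeasure (measure_pmf (map_pmf (Pair x) B)) {(x, y). \<not> (P x \<and> Q x y)}
      \<le> indicator {x. \<not> P x} x + ennreal b"
    proof (cases "P x")
      case True
      have "emeasure (measure_pmf (map_pmf (Pair x) B)) {(x, y). \<not> (P x \<and> Q x y)}
          = emeasure (measure_pmf B) {y. \<not> Q x y}"
        using True by (simp add: vimage_def)
      also have "\<dots> \<le> ennreal b"
        using assms(2)[of x] by (simp add: measure_pmf.emeasure_eq_measure ennreal_leI)
      finally show ?thesis using True by simp
    next
      case False
      have "emeasure (measure_pmf (map_pmf (Pair x) B)) {(x, y). \<not> (P x \<and> Q x y)} \<le> 1"
        by (rule measure_pmf.emeasure_le_1)
      then show ?thesis using False by (simp add: add_increasing2)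
    qed
  qed
  also have "\<dots> = emeasure (measure_pmf A) {x. \<not> P x} + ennreal b"
    by (subst nn_integral_add) auto
  also have "\<dots> \<le> ennreal a + ennreal b"
    using assms(1) by (intro add_right_mono) (simp add: measure_pmf.emeasure_eq_measure ennreal_leI)
  finally have "emeasure (measure_pmf (pair_pmf A B)) {(x, y). \<not> (P x \<and> Q x y)} \<le> ennreal (a + b)"
    using nn by simp
  then show ?thesis
    unfolding measure_pmf.emeasure_eq_measure using nn by (subst (asm) ennreal_le_iff) auto
qed

text \<open>
  \<open>T\<close> is the connectivity threshold, \<open>\<beta> ^ i\<close> the rate of the \<open>i\<close>-th sample, \<open>\<epsilon>\<close> the relative error
  per level, and \<open>\<theta>\<close> (of order \<open>n\<^sup>2\<^sup>/\<^sup>3\<close>) the additive slack that defines near-minimum cuts.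
\<close>

locale sparsifier =
  fixes V :: "'v set" and s t :: 'v and T m c :: nat and \<beta> \<epsilon> \<theta> :: real
  assumes V: "finite V" and st: "s \<in> V" "t \<in> V" "s \<noteq> t"
    and \<beta>: "0 < \<beta>" "\<beta> < 1" and \<epsilon>: "0 < \<epsilon>" "\<epsilon> \<le> 1" and m: "m \<le> card V"
    and big: "real (c + 14) * ln (card V) \<le> \<epsilon>\<^sup>2 * T / 8"
    and top: "real (card V) ^ 2 \<le> 2 * T * card V / \<beta> ^ Suc m"
    and \<epsilon>m: "\<epsilon> * m \<le> 1 / 2" "2 * (\<epsilon> * m) * card V \<le> \<theta>"
    and \<theta>: "1 \<le> \<theta>" "sqrt (card V) \<le> \<theta>" "2 * \<theta> \<le> T"
begin

lemma n2: "card V \<ge> 2"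
proof -
  have "card {s,t} \<le> card V" using V st by (intro card_mono) auto
  then show ?thesis using st by simp
qed

lemma T_pos: "T > 0"
proof -
  have "real T > 0" using \<theta> by linarith
  then show ?thesis by simp
qed

text \<open>The sample above level m is empty, so nothing counts as contracted when the sparsest
  sample is read.\<close>

definition U :: "('v set \<Rightarrow> nat) \<Rightarrow> nat \<Rightarrow> 'v set set" where
  "U \<omega> i = (if i \<le> m then {e \<in> pairs V. i \<le> \<omega> e} else {})"

text \<open>The index is shifted: these are the pairs still uncontracted after level i + 1, hence
  the ones to read at level i.\<close>

definition B :: "('v set \<Rightarrow> nat) \<Rightarrow> nat \<Rightarrow> 'v set set \<Rightarrow> 'v set set" where
  "B \<omega> i E = {e \<in> pairs V. \<not> inside V T (E \<inter> U \<omega> (Suc i)) e}"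

text \<open>
  A pair leaves \<open>B \<omega> i E\<close> at the first level at which its endpoints are strongly connected in the
  sample; from then on it is represented by the independent sample \<open>\<omega>'\<close> of that level.
\<close>

definition H :: "('v set \<Rightarrow> nat) \<Rightarrow> ('v set \<Rightarrow> nat) \<Rightarrow> 'v set set \<Rightarrow> 'v set \<Rightarrow> real" where
  "H \<omega> \<omega>' E S = card (bd (E \<inter> B \<omega> 0 E) S) +
    (\<Sum>i\<in>{1..m}. card (bd (E \<inter> U \<omega>' i \<inter> (B \<omega> i E - B \<omega> (i - 1) E)) S) / \<beta> ^ i)"

definition st_cuts :: "'v set set" where
  "st_cuts = {S. S \<subseteq> V \<and> s \<in> S \<and> t \<notin> S}"

text \<open>Defined through \<open>H\<close> alone, hence known before the last stage. The slack
  \<theta> is twice the error \<theta> / 2 that an accurate \<open>H\<close> makes at the minimum,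
  which keeps the minimum cuts in the set.\<close>

definition near :: "('v set \<Rightarrow> nat) \<Rightarrow> ('v set \<Rightarrow> nat) \<Rightarrow> 'v set set \<Rightarrow> 'v set set" where
  "near \<omega> \<omega>' E = {S \<in> st_cuts. \<forall>S'\<in>st_cuts. H \<omega> \<omega>' E S \<le> H \<omega> \<omega>' E S' + \<theta>}"

text \<open>Stages run from the sparsest level m down to level 0, reading both samples of a level at
  once; stage m + 1 is the final exact reading.\<close>

definition X :: "('v set \<Rightarrow> nat) \<Rightarrow> ('v set \<Rightarrow> nat) \<Rightarrow> nat \<Rightarrow> 'v set set \<Rightarrow> 'v set set" where
  "X \<omega> \<omega>' k E = (if k \<le> m then (U \<omega> (m - k) \<union> U \<omega>' (m - k)) \<inter> B \<omega> (m - k) E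
     else {e \<in> pairs V. \<exists>S\<in>near \<omega> \<omega>' E. card (e \<inter> S) = 1})"

definition res :: "('v set \<Rightarrow> nat) \<Rightarrow> ('v set \<Rightarrow> nat) \<Rightarrow> 'v set set \<Rightarrow> nat" where
  "res \<omega> \<omega>' E = Min ((\<lambda>S. card (bd (E \<inter> X \<omega> \<omega>' (Suc m) E) S)) ` near \<omega> \<omega>' E)"

section \<open>What the answers of earlier stages determine\<close>

lemma X_subset: "X \<omega> \<omega>' k E \<subseteq> pairs V"
  by (auto simp: X_def B_def)

lemma U_antimono: "U \<omega> (Suc i) \<subseteq> U \<omega> i"
  by (auto simp: U_def)

lemma finite_simple: "E \<subseteq> pairs V \<Longrightarrow> finite E"
  using finite_pairs[OF V] finite_subset by blast

lemma B_mono: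
  assumes E: "E \<subseteq> pairs V"
  shows "B \<omega> i E \<subseteq> B \<omega> (Suc i) E"
proof -
  have "inside V T (E \<inter> U \<omega> (Suc i)) e" if "inside V T (E \<inter> U \<omega> (Suc (Suc i))) e" for e
  proof (rule inside_mono[OF _ _ that])
    show "finite (E \<inter> U \<omega> (Suc i))" using finite_simple[OF E] by simp
    show "E \<inter> U \<omega> (Suc (Suc i)) \<subseteq> E \<inter> U \<omega> (Suc i)" using U_antimono[of \<omega> "Suc i"] by blast
  qed
  then show ?thesis by (auto simp: B_def)
qed

lemma B_top: "B \<omega> m E = pairs V"
proof -
  have "\<not> inside V T {} e" if e: "e \<in> pairs V" for e
  proof
    assume "inside V T {} e"
    then obtain D where D: "e \<subseteq> D" "tconn T {} D" unfolding inside_def by blast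
    obtain x y where "e = {x,y}" "x \<noteq> y" using e by (auto simp: pairs_def card_2_iff)
    then have "T \<le> card (bd {e \<in> {}. e \<subseteq> D} {x})"
      using D by (intro tconn_bound[of "{}" T D D x y "{x}"]) auto
    then show False using T_pos by (simp add: bd_def)
  qed
  then show ?thesis by (auto simp: B_def U_def)
qed

text \<open>Induction from the sparsest level: components at level i + 1 fix which pairs are read at
  level i, and by \<open>inside_determined\<close> these pairs suffice to find the components at
  level i. Agreement on the targets computed from \<open>E\<close> alone is enough.\<close>

lemma inside_sample_determined:
  assumes E: "E \<subseteq> pairs V" "E' \<subseteq> pairs V" and k: "k \<le> Suc m"
    and same: "\<And>j. j < k \<Longrightarrow> E \<inter> X \<omega> \<omega>' j E = E' \<inter> X \<omega> \<omega>' j E"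
    and xy: "x \<in> V" "y \<in> V"
  shows "inside V T (E \<inter> U \<omega> (Suc m - k)) {x,y} \<longleftrightarrow> inside V T (E' \<inter> U \<omega> (Suc m - k)) {x,y}"
  using k same xy
proof (induction k arbitrary: x y)
  case 0
  then show ?case by (simp add: U_def)
next
  case (Suc k)
  define i where "i = m - k"
  have ki: "k \<le> m" "Suc m - Suc k = i" "Suc m - k = Suc i" using Suc.prems(1) by (auto simp: i_def)
  have IH: "inside V T (E \<inter> U \<omega> (Suc i)) {x,y} \<longleftrightarrow> inside V T (E' \<inter> U \<omega> (Suc i)) {x,y}"
    if "x \<in> V" "y \<in> V" for x y
    using Suc.IH[OF _ _ that] Suc.prems(1,2) ki by simp
  have new: "e \<in> E \<inter> U \<omega> i \<longleftrightarrow> e \<in> E' \<inter> U \<omega> i"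
    if "e \<in> pairs V" "\<not> inside V T (E \<inter> U \<omega> (Suc i)) e" for e
  proof -
    have "e \<in> B \<omega> i E" using that by (simp add: B_def)
    moreover have "E \<inter> ((U \<omega> i \<union> U \<omega>' i) \<inter> B \<omega> i E) = E' \<inter> ((U \<omega> i \<union> U \<omega>' i) \<inter> B \<omega> i E)"
      using Suc.prems(2)[of k] ki(1) by (simp add: X_def i_def)
    ultimately show ?thesis by blast
  qed
  \<comment> \<open>The target was computed from \<open>E\<close>; by the induction hypothesis
    \<open>E'\<close> contracts the same pairs.\<close>
  have new': "e \<in> E' \<inter> U \<omega> i \<longleftrightarrow> e \<in> E \<inter> U \<omega> i"
    if e: "e \<in> pairs V" "\<not> inside V T (E' \<inter> U \<omega> (Suc i)) e" for e
  proof -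
    obtain u v where "e = {u,v}" "u \<in> V" "v \<in> V" using e(1) by (auto simp: pairs_def card_2_iff)
    then show ?thesis using new[OF e(1)] e(2) IH by blast
  qed
  have fin: "finite (E \<inter> U \<omega> i)" "finite (E' \<inter> U \<omega> i)" using finite_simple E by auto
  have sub: "E \<inter> U \<omega> (Suc i) \<subseteq> E \<inter> U \<omega> i" "E' \<inter> U \<omega> (Suc i) \<subseteq> E' \<inter> U \<omega> i"
    using U_antimono[of \<omega> i] by auto
  have pr: "E \<inter> U \<omega> i \<subseteq> pairs V" "E' \<inter> U \<omega> i \<subseteq> pairs V" using E by auto
  show ?case
    unfolding ki(2)
  proof
    assume "inside V T (E \<inter> U \<omega> i) {x,y}"
    with inside_determined[OF fin sub pr(1) IH new] show "inside V T (E' \<inter> U \<omega> i) {x,y}" by blast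
  next
    assume "inside V T (E' \<inter> U \<omega> i) {x,y}"
    with inside_determined[OF fin(2,1) sub(2,1) pr(2) IH[symmetric] new']
    show "inside V T (E \<inter> U \<omega> i) {x,y}" by blast
  qed
qed

lemma B_determined:
  assumes E: "E \<subseteq> pairs V" "E' \<subseteq> pairs V" and k: "k \<le> m"
    and same: "\<And>j. j < k \<Longrightarrow> E \<inter> X \<omega> \<omega>' j E = E' \<inter> X \<omega> \<omega>' j E"
  shows "B \<omega> (m - k) E = B \<omega> (m - k) E'"
proof -
  have k': "Suc m - k = Suc (m - k)" "k \<le> Suc m" using k by auto
  have "inside V T (E \<inter> U \<omega> (Suc (m - k))) e \<longleftrightarrow> inside V T (E' \<inter> U \<omega> (Suc (m - k))) e"
    if e: "e \<in> pairs V" for e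
  proof -
    obtain u v where uv: "e = {u,v}" "u \<in> V" "v \<in> V" using e by (auto simp: pairs_def card_2_iff)
    show ?thesis
      unfolding uv(1) k'(1)[symmetric] by (rule inside_sample_determined[OF E k'(2) same uv(2,3)])
  qed
  then show ?thesis by (auto simp: B_def)
qed

lemma H_determined:
  assumes E: "E \<subseteq> pairs V" "E' \<subseteq> pairs V"
    and same: "\<And>j. j < Suc m \<Longrightarrow> E \<inter> X \<omega> \<omega>' j E = E' \<inter> X \<omega> \<omega>' j E"
  shows "H \<omega> \<omega>' E S = H \<omega> \<omega>' E' S"
proof -
  have BB: "B \<omega> i E = B \<omega> i E'" if "i \<le> m" for i
    using B_determined[OF E, of "m - i" \<omega> \<omega>'] same that by simp
  have eq: "E \<inter> ((U \<omega> i \<union> U \<omega>' i) \<inter> B \<omega> i E) = E' \<inter> ((U \<omega> i \<union> U \<omega>' i) \<inter> B \<omega> i E)" if "i \<le> m" for i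
    using same[of "m - i"] that by (simp add: X_def)
  \<comment> \<open>At rate \<beta>^0 = 1 the sample is complete, so the first summand of
    \<open>H\<close> is known exactly.\<close>
  have "U \<omega> 0 = pairs V" by (simp add: U_def)
  then have "E \<inter> B \<omega> 0 E = E' \<inter> B \<omega> 0 E" using eq[of 0] E by blast
  moreover have "(\<Sum>i\<in>{1..m}. card (bd (E \<inter> U \<omega>' i \<inter> (B \<omega> i E - B \<omega> (i - 1) E)) S) / \<beta> ^ i)
      = (\<Sum>i\<in>{1..m}. card (bd (E' \<inter> U \<omega>' i \<inter> (B \<omega> i E' - B \<omega> (i - 1) E')) S) / \<beta> ^ i)"
  proof (intro sum.cong refl)
    fix i assume "i \<in> {1..m}"
    then have "i \<le> m" "i - 1 \<le> m" by auto
    then have "E \<inter> U \<omega>' i \<inter> (B \<omega> i E - B \<omega> (i - 1) E) = E' \<inter> U \<omega>' i \<inter> (B \<omega> i E' - B \<omega> (i - 1) E')"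
      using eq[of i] BB[of i] BB[of "i - 1"] by blast
    then show "card (bd (E \<inter> U \<omega>' i \<inter> (B \<omega> i E - B \<omega> (i - 1) E)) S) / \<beta> ^ i
      = card (bd (E' \<inter> U \<omega>' i \<inter> (B \<omega> i E' - B \<omega> (i - 1) E')) S) / \<beta> ^ i" by (rule arg_cong)
  qed
  ultimately show ?thesis using BB[of 0] by (simp only: H_def)
qed

lemma X_determined:
  assumes E: "E \<subseteq> pairs V" "E' \<subseteq> pairs V" and k: "k \<le> Suc m"
    and same: "\<And>j. j < k \<Longrightarrow> X \<omega> \<omega>' j E = X \<omega> \<omega>' j E' \<and> E \<inter> X \<omega> \<omega>' j E = E' \<inter> X \<omega> \<omega>' j E"
  shows "X \<omega> \<omega>' k E = X \<omega> \<omega>' k E'"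
proof (cases "k \<le> m")
  case True
  have "B \<omega> (m - k) E = B \<omega> (m - k) E'"
    by (rule B_determined[OF E True]) (use same in blast)
  then show ?thesis using True by (simp add: X_def)
next
  case False
  then have "H \<omega> \<omega>' E = H \<omega> \<omega>' E'"
  proof (intro ext H_determined[OF E])
    fix j assume "j < Suc m"
    then have "j < k" using False by simp
    then show "E \<inter> X \<omega> \<omega>' j E = E' \<inter> X \<omega> \<omega>' j E" using same by blast
  qed
  then show ?thesis using False by (simp add: X_def near_def)
qed

lemma res_determined:
  assumes E: "E \<subseteq> pairs V" "E' \<subseteq> pairs V"
    and same: "\<And>j. j < m + 2 \<Longrightarrow> X \<omega> \<omega>' j E = X \<omega> \<omega>' j E' \<and> E \<inter> X \<omega> \<omega>' j E = E' \<inter> X \<omega> \<omega>' j E"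
  shows "res \<omega> \<omega>' E = res \<omega> \<omega>' E'"
proof -
  have "H \<omega> \<omega>' E = H \<omega> \<omega>' E'"
  proof (intro ext H_determined[OF E])
    fix j assume "j < Suc m"
    then have "j < m + 2" by simp
    then show "E \<inter> X \<omega> \<omega>' j E = E' \<inter> X \<omega> \<omega>' j E" using same by blast
  qed
  then have "near \<omega> \<omega>' E = near \<omega> \<omega>' E'" by (simp add: near_def)
  moreover have "E \<inter> X \<omega> \<omega>' (Suc m) E = E' \<inter> X \<omega> \<omega>' (Suc m) E'"
    using same[of "Suc m"] by (metis add_2_eq_Suc' lessI)
  ultimately show ?thesis by (simp add: res_def)
qed

text \<open>A set with fewer edges than this has at most T / 2 expected edges in the i-th sample;
  the factor 2 leaves room for deviations below \<open>T\<close>.\<close>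

definition \<kappa> :: "nat \<Rightarrow> nat" where
  "\<kappa> i = nat \<lceil>T / (2 * \<beta> ^ i)\<rceil>"

definition strong :: "nat \<Rightarrow> 'v set set \<Rightarrow> 'v set set" where
  "strong i E = {e \<in> E. inside V (\<kappa> i) E e}"

text \<open>No pair is contracted merely by a lucky sample: this puts the edges handled at level i
  into a graph with heavy cuts.\<close>

definition levels_strong :: "('v set \<Rightarrow> nat) \<Rightarrow> 'v set set \<Rightarrow> bool" where
  "levels_strong \<omega> E \<longleftrightarrow> (\<forall>i\<in>{1..m}. \<forall>e\<in>E. inside V T (E \<inter> U \<omega> i) e \<longrightarrow> e \<in> strong i E)"

text \<open>The cuts are those of the strong part, since \<open>karger_count\<close> requires all
  nonempty cuts to be heavy. The share of the level itself in such a cut may be small, so the error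
  is relative to the strong cut.\<close>

definition concentrated :: "('v set \<Rightarrow> nat) \<Rightarrow> ('v set \<Rightarrow> nat) \<Rightarrow> 'v set set \<Rightarrow> bool" where
  "concentrated \<omega> \<omega>' E \<longleftrightarrow> (\<forall>i\<in>{1..m}. \<forall>S. bd (strong i E) S \<noteq> {} \<longrightarrow>
    \<bar>real (card {e \<in> bd (strong i E) S \<inter> (B \<omega> i E - B \<omega> (i - 1) E). i \<le> \<omega>' e})
       - \<beta> ^ i * card (bd (strong i E) S \<inter> (B \<omega> i E - B \<omega> (i - 1) E))\<bar>
     < \<epsilon> * \<beta> ^ i * card (bd (strong i E) S))"

text \<open>The differences of consecutive \<open>B\<close> sets, together with the bottom one,
  partition all pairs because nothing is contracted at level m. Each of the m levels contributes an
  error of at most \<epsilon> times the whole cut.\<close>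

lemma H_approx:
  assumes E: "E \<subseteq> pairs V" and ls: "levels_strong \<omega> E" and conc: "concentrated \<omega> \<omega>' E"
  shows "\<bar>H \<omega> \<omega>' E S - cut E S\<bar> \<le> \<epsilon> * m * cut E S"
proof -
  have fE: "finite E" by (rule finite_simple[OF E])
  let ?G = "\<lambda>i. B \<omega> i E - B \<omega> (i - 1) E"
  have tele: "card (bd (E \<inter> B \<omega> j E) S) = card (bd (E \<inter> B \<omega> 0 E) S) + (\<Sum>i\<in>{1..j}. card (bd (E \<inter> ?G i) S))" for j
  proof (induction j)
    case (Suc j)
    have "bd (E \<inter> B \<omega> (Suc j) E) S = bd (E \<inter> B \<omega> j E) S \<union> bd (E \<inter> ?G (Suc j)) S"
      using B_mono[OF E, of \<omega> j] by (auto simp: bd_def)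
    moreover have "bd (E \<inter> B \<omega> j E) S \<inter> bd (E \<inter> ?G (Suc j)) S = {}" by (auto simp: bd_def)
    ultimately have "card (bd (E \<inter> B \<omega> (Suc j) E) S) = card (bd (E \<inter> B \<omega> j E) S) + card (bd (E \<inter> ?G (Suc j)) S)"
      using fE by (simp add: card_Un_disjoint bd_def)
    then show ?case using Suc.IH by simp
  qed simp
  have "E \<inter> B \<omega> m E = E" using B_top E by auto
  then have cutE: "real (cut E S) = card (bd (E \<inter> B \<omega> 0 E) S) + (\<Sum>i\<in>{1..m}. real (card (bd (E \<inter> ?G i) S)))"
    using tele[of m] by (simp add: cut_eq_card_bd)
  have lvl: "\<bar>card (bd (E \<inter> U \<omega>' i \<inter> ?G i) S) / \<beta> ^ i - real (card (bd (E \<inter> ?G i) S))\<bar> \<le> \<epsilon> * cut E S"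
    if i: "i \<in> {1..m}" for i
  proof -
    \<comment> \<open>A pair outside \<open>B \<omega> (i - 1) E\<close> lies inside a T-connected
      set of the i-th sample, which is what \<open>levels_strong\<close> speaks of.\<close>
    have sub: "E \<inter> ?G i \<subseteq> strong i E"
      using ls i by (auto simp: levels_strong_def B_def)
    have eq1: "bd (E \<inter> ?G i) S = bd (strong i E) S \<inter> ?G i"
      using sub by (auto simp: bd_def strong_def)
    have eq2: "bd (E \<inter> U \<omega>' i \<inter> ?G i) S = {e \<in> bd (strong i E) S \<inter> ?G i. i \<le> \<omega>' e}"
      using sub i E by (auto simp: bd_def strong_def U_def)
    have b: "\<beta> ^ i > 0" using \<beta> by simp
    show ?thesis
    proof (cases "bd (strong i E) S = {}")
      case True
      then show ?thesis unfolding eq1 eq2 using \<epsilon> by simp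
    next
      case False
      let ?N = "real (card (bd (E \<inter> U \<omega>' i \<inter> ?G i) S))" and ?M = "real (card (bd (E \<inter> ?G i) S))"
      have "\<bar>?N - \<beta> ^ i * ?M\<bar> \<le> \<epsilon> * \<beta> ^ i * card (bd (strong i E) S)"
        using conc i False unfolding concentrated_def eq1 eq2 by (meson less_imp_le)
      also have "\<dots> \<le> \<epsilon> * \<beta> ^ i * cut E S"
        unfolding cut_eq_card_bd using fE \<epsilon> \<beta>
        by (intro mult_left_mono of_nat_mono card_mono bd_mono) (auto simp: bd_def strong_def)
      finally have "\<bar>?N - \<beta> ^ i * ?M\<bar> / \<beta> ^ i \<le> \<epsilon> * cut E S" using b by (simp add: field_simps)
      moreover have "?N / \<beta> ^ i - ?M = (?N - \<beta> ^ i * ?M) / \<beta> ^ i"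
        using \<beta> by (simp add: diff_divide_distrib)
      then have "\<bar>?N / \<beta> ^ i - ?M\<bar> = \<bar>?N - \<beta> ^ i * ?M\<bar> / \<beta> ^ i"
        using b by (simp only: abs_divide abs_of_pos)
      ultimately show ?thesis by simp
    qed
  qed
  have diff: "H \<omega> \<omega>' E S - cut E S =
      (\<Sum>i\<in>{1..m}. card (bd (E \<inter> U \<omega>' i \<inter> ?G i) S) / \<beta> ^ i - real (card (bd (E \<inter> ?G i) S)))"
    unfolding H_def cutE sum_subtractf by (rule add_diff_cancel_left)
  have "\<bar>H \<omega> \<omega>' E S - cut E S\<bar>
      \<le> (\<Sum>i\<in>{1..m}. \<bar>card (bd (E \<inter> U \<omega>' i \<inter> ?G i) S) / \<beta> ^ i - real (card (bd (E \<inter> ?G i) S))\<bar>)"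
    unfolding diff by (rule sum_abs)
  also have "\<dots> \<le> (\<Sum>i\<in>{1..m}. \<epsilon> * cut E S)" by (rule sum_mono) (rule lvl)
  also have "\<dots> = \<epsilon> * m * cut E S" by (simp add: mult_ac)
  finally show ?thesis .
qed

section \<open>Near-minimum cuts and exactness of the answer\<close>

lemma finite_st_cuts: "finite st_cuts"
  by (rule finite_subset[of _ "Pow V"]) (auto simp: st_cuts_def V)

lemma min_st_cut_eq: "min_st_cut V E s t = Min (cut E ` st_cuts)"
  unfolding min_st_cut_def st_cuts_def by (rule arg_cong[of _ _ Min]) auto

lemma near_correct:
  assumes E: "E \<subseteq> pairs V" and ls: "levels_strong \<omega> E" and conc: "concentrated \<omega> \<omega>' E"
  defines "F \<equiv> min_st_cut V E s t"
  shows "\<exists>S\<in>near \<omega> \<omega>' E. cut E S = F" and "\<And>S. S \<in> st_cuts \<Longrightarrow> F \<le> cut E S"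
    and "\<And>S. S \<in> near \<omega> \<omega>' E \<Longrightarrow> real (cut E S) \<le> F + 4 * \<theta>" and "F \<le> card V"
proof -
  let ?\<eta> = "\<epsilon> * m" and ?H = "H \<omega> \<omega>' E"
  have \<eta>: "0 \<le> ?\<eta>" "?\<eta> \<le> 1 / 2" "?\<eta> * card V \<le> \<theta> / 2" using \<epsilon> \<epsilon>m by auto
  have s_cut: "{s} \<in> st_cuts" using st by (auto simp: st_cuts_def)
  show F_le: "F \<le> cut E S" if "S \<in> st_cuts" for S
    unfolding F_def min_st_cut_eq using that finite_st_cuts by (intro Min_le) auto
  have "F \<in> cut E ` st_cuts"
    unfolding F_def min_st_cut_eq using s_cut finite_st_cuts by (intro Min_in) auto
  then obtain S0 where S0: "S0 \<in> st_cuts" "cut E S0 = F" by auto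
  \<comment> \<open>The degree of s bounds the minimum, which turns the relative error of
    \<open>H\<close> into the additive \<theta> / 2.\<close>
  have "cut E {s} \<le> card V"
  proof -
    have "bd E {s} \<subseteq> (\<lambda>v. {s,v}) ` V"
    proof
      fix e assume e: "e \<in> bd E {s}"
      then have e2: "card e = 2" "e \<subseteq> V" using E by (auto simp: bd_def pairs_def)
      have "s \<in> e" using e e2 by (auto simp: bd_iff)
      then obtain v where "e = {s,v}" using e2(1) by (auto simp: card_2_iff)
      then show "e \<in> (\<lambda>v. {s,v}) ` V" using e2 by auto
    qed
    then show ?thesis unfolding cut_eq_card_bd using V by (meson surj_card_le)
  qed
  then show Fn: "F \<le> card V" using F_le[OF s_cut] by linarith
  have \<eta>F: "?\<eta> * F \<le> \<theta> / 2"
    using \<eta> Fn mult_left_mono[of "real F" "real (card V)" ?\<eta>] by simp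
  have up: "?H S \<le> (1 + ?\<eta>) * cut E S" and lo: "(1 - ?\<eta>) * cut E S \<le> ?H S" for S
    using H_approx[OF E ls conc, of S] by (auto simp: algebra_simps abs_le_iff)
  have H0: "?H S0 \<le> F + \<theta> / 2" using up[of S0] \<eta>F S0 by (simp add: algebra_simps)
  have Hge: "F - \<theta> / 2 \<le> ?H S" if "S \<in> st_cuts" for S
  proof -
    have "(1 - ?\<eta>) * F \<le> (1 - ?\<eta>) * cut E S"
      using F_le[OF that] \<eta> by (intro mult_left_mono) auto
    then show ?thesis using lo[of S] \<eta>F by (simp add: algebra_simps)
  qed
  have S0_near: "S0 \<in> near \<omega> \<omega>' E"
    unfolding near_def using S0(1) H0 Hge by fastforce
  then show "\<exists>S\<in>near \<omega> \<omega>' E. cut E S = F" using S0(2) by blast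
  show "real (cut E S) \<le> F + 4 * \<theta>" if S: "S \<in> near \<omega> \<omega>' E" for S
  proof -
    have "?H S \<le> ?H S0 + \<theta>" using S S0(1) by (simp add: near_def)
    then have "(1 - ?\<eta>) * cut E S \<le> F + 3 / 2 * \<theta>" using lo[of S] H0 by linarith
    \<comment> \<open>As \<eta> is at most 1/2, the right side is at least F - \<theta> / 2 + 2
      \<theta>.\<close>
    also have "\<dots> \<le> (1 - ?\<eta>) * (F + 4 * \<theta>)"
    proof -
      have "?\<eta> * (4 * \<theta>) \<le> 1 / 2 * (4 * \<theta>)" using \<eta> \<theta> by (intro mult_right_mono) auto
      then show ?thesis using \<eta>F by (simp add: algebra_simps)
    qed
    finally show ?thesis using \<eta> by (simp add: mult_le_cancel_left_pos)
  qed
qed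

text \<open>All edges of every near-minimum cut are read, so the minimum is taken over exact values.
  The 9 is 5 + 4: \<Delta> + 1 is at most 5 \<theta>, and the flow term 4 n sqrt F is at most 4 n
  \<theta>.\<close>

lemma res_correct:
  assumes E: "E \<subseteq> pairs V" and ls: "levels_strong \<omega> E" and conc: "concentrated \<omega> \<omega>' E"
  shows "res \<omega> \<omega>' E = min_st_cut V E s t"
    and "real (card (E \<inter> X \<omega> \<omega>' (Suc m) E)) \<le> 9 * \<theta> * card V"
proof -
  let ?F = "min_st_cut V E s t" and ?N = "near \<omega> \<omega>' E"
  note near = near_correct[OF E ls conc]
  have fE: "finite E" by (rule finite_simple[OF E])
  have Xeq: "E \<inter> X \<omega> \<omega>' (Suc m) E = (\<Union>S\<in>?N. bd E S)"
    using E by (auto simp: X_def bd_def)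
  have "bd (E \<inter> X \<omega> \<omega>' (Suc m) E) S = bd E S" if "S \<in> ?N" for S
    unfolding Xeq using that by (auto simp: bd_def)
  then have "res \<omega> \<omega>' E = Min (cut E ` ?N)"
    unfolding res_def cut_eq_card_bd by (metis (mono_tags, lifting) image_cong)
  moreover have "Min (cut E ` ?N) = ?F"
  proof (rule Min_eqI)
    have "?N \<subseteq> st_cuts" by (auto simp: near_def)
    then show "finite (cut E ` ?N)" using finite_st_cuts finite_subset by blast
    show "?F \<le> y" if "y \<in> cut E ` ?N" for y using that near(2) by (auto simp: near_def)
    show "?F \<in> cut E ` ?N" using near(1) by force
  qed
  ultimately show "res \<omega> \<omega>' E = ?F" by simp
  define \<Delta> where "\<Delta> = nat \<lfloor>4 * \<theta>\<rfloor>"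
  let ?C = "{S. S \<subseteq> V \<and> s \<in> S \<and> t \<notin> S \<and> card (bd E S) \<le> ?F + \<Delta>}"
  have NC: "?N \<subseteq> ?C"
  proof
    fix S assume S: "S \<in> ?N"
    have "real (cut E S) \<le> ?F + 4 * \<theta>" by (rule near(3)[OF S])
    then have "cut E S \<le> ?F + \<Delta>" unfolding \<Delta>_def using \<theta> by linarith
    then show "S \<in> ?C" using S by (auto simp: near_def st_cuts_def cut_eq_card_bd)
  qed
  have "card (E \<inter> X \<omega> \<omega>' (Suc m) E) \<le> card (\<Union>S\<in>?C. bd E S)"
    unfolding Xeq
  proof (intro card_mono)
    have "(\<Union>S\<in>?C. bd E S) \<subseteq> E" using bd_subset by fast
    then show "finite (\<Union>S\<in>?C. bd E S)" using fE finite_subset by blast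
    show "(\<Union>S\<in>?N. bd E S) \<subseteq> (\<Union>S\<in>?C. bd E S)" using NC by (rule UN_mono) simp
  qed
  then have "real (card (E \<inter> X \<omega> \<omega>' (Suc m) E)) \<le> real (card (\<Union>S\<in>?C. bd E S))" by simp
  also have "\<dots> \<le> (\<Delta> + 1) * card V + 4 * card V * sqrt ?F"
    using near(2) by (intro card_near_min_cut_edges_le[OF V E st]) (auto simp: st_cuts_def cut_eq_card_bd)
  also have "\<dots> \<le> (5 * \<theta>) * card V + 4 * card V * \<theta>"
  proof (intro add_mono)
    have "real (\<Delta> + 1) \<le> 5 * \<theta>" unfolding \<Delta>_def using \<theta> by linarith
    then show "real ((\<Delta> + 1) * card V) \<le> 5 * \<theta> * card V"
      unfolding of_nat_mult by (rule mult_right_mono) simp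
    have "sqrt ?F \<le> sqrt (card V)" using near(4) by simp
    then have "sqrt ?F \<le> \<theta>" using \<theta> by linarith
    then show "real (4 * card V) * sqrt ?F \<le> 4 * card V * \<theta>" by (intro mult_left_mono) auto
  qed
  finally show "real (card (E \<inter> X \<omega> \<omega>' (Suc m) E)) \<le> 9 * \<theta> * card V" by (simp add: algebra_simps)
qed

end

subsection \<open>Probability of success\<close>

context sparsifier
begin

definition crossing :: "('v \<Rightarrow> 'v) \<Rightarrow> 'v set set \<Rightarrow> 'v set set" where
  "crossing f E = {e \<in> E. \<not> card (f ` e) \<le> 1}"

text \<open>Out of this many edges the i-th sample contains 2 T n in expectation, about twice what
  \<open>card_weak_edges_le\<close> allows between strong components.\<close>

definition \<mu> :: "nat \<Rightarrow> real" where
  "\<mu> i = 2 * T * card V / \<beta> ^ i"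

text \<open>The partition found by the algorithm depends on the sample, so the event quantifies over
  all labellings beforehand.\<close>

definition upper :: "('v set \<Rightarrow> nat) \<Rightarrow> 'v set set \<Rightarrow> bool" where
  "upper \<omega> E \<longleftrightarrow> (\<forall>i\<in>{..m}. \<forall>f\<in>V \<rightarrow>\<^sub>E V. card (crossing f E) \<le> \<mu> (Suc i) \<longrightarrow>
    card {e \<in> crossing f E. i \<le> \<omega> e} \<le> 2 * \<beta> ^ i * \<mu> (Suc i))"

definition lower :: "('v set \<Rightarrow> nat) \<Rightarrow> 'v set set \<Rightarrow> bool" where
  "lower \<omega> E \<longleftrightarrow> (\<forall>i\<in>{1..m}. \<forall>f\<in>V \<rightarrow>\<^sub>E V. \<mu> i \<le> card (crossing f E) \<longrightarrow>
    T * card V \<le> card {e \<in> crossing f E. i \<le> \<omega> e})"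

lemma B_labels:
  assumes E: "E \<subseteq> pairs V"
  obtains f where "f \<in> V \<rightarrow>\<^sub>E V" "E \<inter> B \<omega> i E = crossing f E"
proof -
  have "finite (E \<inter> U \<omega> (Suc i))" "E \<inter> U \<omega> (Suc i) \<subseteq> pairs V" using finite_simple E by auto
  from inside_labels[OF this(1) V this(2), of T] obtain f where f: "f \<in> V \<rightarrow>\<^sub>E V"
    "\<And>e. e \<in> pairs V \<Longrightarrow> inside V T (E \<inter> U \<omega> (Suc i)) e \<longleftrightarrow> card (f ` e) \<le> 1" by blast
  have "E \<inter> B \<omega> i E = crossing f E"
    using E f(2) by (auto simp: B_def crossing_def)
  then show ?thesis using that f(1) by blast
qed

text \<open>Weak edges of the (i + 1)-st sample number at most T (n - 1), but more than
  \<open>\<mu> (Suc i)\<close> uncontracted edges would put at least T n of them there. At i = m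
  nothing is contracted, and \<open>top\<close> bounds all pairs.\<close>

lemma card_B_le:
  assumes E: "E \<subseteq> pairs V" and lower: "lower \<omega> E" and i: "i \<le> m"
  shows "card (E \<inter> B \<omega> i E) \<le> \<mu> (Suc i)"
proof (cases "i = m")
  case True
  have "card (E \<inter> B \<omega> i E) \<le> card (pairs V)"
    using E finite_pairs[OF V] by (intro card_mono) auto
  also have "\<dots> \<le> card V ^ 2" by (rule card_pairs_le[OF V])
  finally have "real (card (E \<inter> B \<omega> i E)) \<le> real (card V ^ 2)" by (rule of_nat_mono)
  then have "real (card (E \<inter> B \<omega> i E)) \<le> real (card V) ^ 2" by (simp only: of_nat_power)
  then show ?thesis unfolding True \<mu>_def by (rule order_trans[OF _ top])
next
  case False
  then have im: "Suc i \<in> {1..m}" using i by auto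
  obtain f where f: "f \<in> V \<rightarrow>\<^sub>E V" "E \<inter> B \<omega> i E = crossing f E" using B_labels[OF E] .
  show ?thesis
  proof (rule ccontr)
    assume "\<not> ?thesis"
    then have "\<mu> (Suc i) \<le> card (crossing f E)" using f(2) by simp
    then have "T * card V \<le> card {e \<in> crossing f E. Suc i \<le> \<omega> e}"
      using lower im f(1) unfolding lower_def by blast
    moreover have "{e \<in> crossing f E. Suc i \<le> \<omega> e} \<subseteq>
        {e \<in> E \<inter> U \<omega> (Suc i). card e = 2 \<and> e \<subseteq> V \<and> \<not> inside V T (E \<inter> U \<omega> (Suc i)) e}"
      using im unfolding f(2)[symmetric] by (auto simp: B_def U_def pairs_def)
    then have "card {e \<in> crossing f E. Suc i \<le> \<omega> e} \<le>
        card {e \<in> E \<inter> U \<omega> (Suc i). card e = 2 \<and> e \<subseteq> V \<and> \<not> inside V T (E \<inter> U \<omega> (Suc i)) e}"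
      using finite_simple[OF E] by (intro card_mono) auto
    moreover have "\<dots> \<le> T * (card V - 1)"
      using finite_simple[OF E] by (intro card_weak_edges_le V) simp
    moreover have "T * (card V - 1) < T * card V" using T_pos n2 by simp
    ultimately show False by linarith
  qed
qed

lemma \<mu>_Suc: "2 * \<beta> ^ i * \<mu> (Suc i) = 4 * T * card V / \<beta>"
  using \<beta> by (simp add: \<mu>_def field_simps)

text \<open>Pairs left after sampling at rate \<beta>^(i + 1) are read at the denser rate \<beta>^i,
  which costs the factor 1 / \<beta>; the two samples double it.\<close>

lemma card_X_le:
  assumes E: "E \<subseteq> pairs V" and "lower \<omega> E" "upper \<omega> E" "upper \<omega>' E" and k: "k \<le> m"
  shows "card (E \<inter> X \<omega> \<omega>' k E) \<le> 8 * T * card V / \<beta>"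
proof -
  define i where "i = m - k"
  have i: "i \<in> {..m}" by (simp add: i_def)
  obtain f where f: "f \<in> V \<rightarrow>\<^sub>E V" "E \<inter> B \<omega> i E = crossing f E" using B_labels[OF E] .
  let ?Y = "\<lambda>\<omega>. {e \<in> crossing f E. i \<le> \<omega> e}"
  have le: "card (crossing f E) \<le> \<mu> (Suc i)" using card_B_le[OF E assms(2), of i] i f(2) by simp
  have c: "card (?Y \<omega>) \<le> 4 * T * card V / \<beta>" "card (?Y \<omega>') \<le> 4 * T * card V / \<beta>"
    using assms(3,4) i f(1) le unfolding upper_def \<mu>_Suc by blast+
  have "E \<inter> X \<omega> \<omega>' k E \<subseteq> ?Y \<omega> \<union> ?Y \<omega>'"
    using k unfolding f(2)[symmetric] by (auto simp: X_def U_def i_def)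
  then have "card (E \<inter> X \<omega> \<omega>' k E) \<le> card (?Y \<omega> \<union> ?Y \<omega>')"
    using finite_simple[OF E] by (intro card_mono) (auto simp: crossing_def)
  also have "\<dots> \<le> card (?Y \<omega>) + card (?Y \<omega>')" by (rule card_Un_le)
  finally have "real (card (E \<inter> X \<omega> \<omega>' k E)) \<le> real (card (?Y \<omega>)) + real (card (?Y \<omega>'))"
    by (simp flip: of_nat_add)
  also have "\<dots> \<le> 4 * T * card V / \<beta> + 4 * T * card V / \<beta>" using c by (rule add_mono)
  finally show ?thesis by (simp add: algebra_simps)
qed

section \<open>Failure probabilities of the four events\<close>

lemma exp_T_le: "exp (- (T / 8)) \<le> 1 / real (card V) ^ (c + 14)"
proof (rule exp_neg_ln_le)
  show "0 < card V" using n2 by simp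
  have "\<epsilon>\<^sup>2 \<le> 1" using \<epsilon> by (intro power_le_one) auto
  then have "\<epsilon>\<^sup>2 * T / 8 \<le> T / 8" using mult_right_mono[of "\<epsilon>\<^sup>2" 1 "real T"] by simp
  then show "real (c + 14) * ln (card V) \<le> T / 8" using big by simp
qed

text \<open>The failure bound is exponential in T n, and T / 8 is at least (c + 14) ln n, so it
  outweighs the n^n labellings.\<close>

lemma exp_Tn_le: "real (card V ^ card V) * (2 * exp (- (T * card V / 8))) \<le> 2 / real (card V) ^ (c + 13)"
proof -
  let ?n = "real (card V)"
  have "exp (- (T * card V / 8)) = exp (- (T / 8)) ^ card V"
    by (simp add: exp_of_nat_mult[symmetric] algebra_simps)
  also have "\<dots> \<le> (1 / ?n ^ (c + 14)) ^ card V"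
    using exp_T_le by (intro power_mono) auto
  also have "\<dots> = 1 / ?n ^ ((c + 14) * card V)"
    by (simp only: power_divide power_one power_mult)
  finally have "?n ^ card V * (2 * exp (- (T * card V / 8))) \<le> ?n ^ card V * (2 * (1 / ?n ^ ((c + 14) * card V)))"
    by (intro mult_left_mono) auto
  also have "?n ^ ((c + 14) * card V) = ?n ^ card V * ?n ^ ((c + 13) * card V)"
    by (simp add: algebra_simps flip: power_add)
  also have "?n ^ card V * (2 * (1 / (?n ^ card V * ?n ^ ((c + 13) * card V)))) = 2 / ?n ^ ((c + 13) * card V)"
    using n2 by simp
  also have "\<dots> \<le> 2 / ?n ^ (c + 13)"
    using n2 by (intro divide_left_mono power_increasing) auto
  finally show ?thesis by simp
qed

lemma card_labels: "card (V \<rightarrow>\<^sub>E V) = card V ^ card V" "finite (V \<rightarrow>\<^sub>E V)"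
  using V by (simp_all add: card_PiE finite_PiE)

lemma prob_labels_le:
  assumes I: "finite I" "card I \<le> card V + 1"
    and P: "\<And>i f. i \<in> I \<Longrightarrow> f \<in> V \<rightarrow>\<^sub>E V \<Longrightarrow>
      measure_pmf.prob p {\<omega>. Q i f \<omega>} \<le> 2 * exp (- (T * card V / 8))"
  shows "measure_pmf.prob p {\<omega>. \<exists>i\<in>I. \<exists>f\<in>V \<rightarrow>\<^sub>E V. Q i f \<omega>} \<le> 1 / real (card V) ^ (c + 10)"
proof -
  let ?n = "real (card V)"
  have "measure_pmf.prob p {\<omega>. \<exists>f\<in>V \<rightarrow>\<^sub>E V. Q i f \<omega>} \<le> 2 / ?n ^ (c + 13)" if "i \<in> I" for i
  proof -
    have "measure_pmf.prob p {\<omega>. \<exists>f\<in>V \<rightarrow>\<^sub>E V. Q i f \<omega>}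
        \<le> real (card (V \<rightarrow>\<^sub>E V)) * (2 * exp (- (T * card V / 8)))"
      by (rule prob_Bex_le[OF card_labels(2) P[OF that]])
    then show ?thesis using exp_Tn_le unfolding card_labels(1) by linarith
  qed
  then have "measure_pmf.prob p {\<omega>. \<exists>i\<in>I. \<exists>f\<in>V \<rightarrow>\<^sub>E V. Q i f \<omega>} \<le> card I * (2 / ?n ^ (c + 13))"
    by (rule prob_Bex_le[OF I(1)])
  also have "\<dots> \<le> ?n ^ 3 / ?n ^ (c + 13)"
  proof -
    have "2 * (card V + 1) \<le> 3 * card V" using n2 by simp
    also have "3 \<le> card V * card V" using mult_le_mono[OF n2 n2] by simp
    then have "3 * card V \<le> (card V * card V) * card V" by (rule mult_right_mono) simp
    finally have "2 * (card V + 1) \<le> card V ^ 3" by (simp add: power3_eq_cube)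
    moreover have "card I * 2 \<le> 2 * (card V + 1)" using I(2) by simp
    ultimately have "card I * 2 \<le> card V ^ 3" by (rule order_trans[rotated])
    then have "real (card I * 2) \<le> real (card V ^ 3)" by (rule of_nat_mono)
    then show ?thesis by (simp add: divide_right_mono)
  qed
  also have "?n ^ (c + 13) = ?n ^ 3 * ?n ^ (c + 10)" by (simp add: add_ac flip: power_add)
  also have "?n ^ 3 / (?n ^ 3 * ?n ^ (c + 10)) = 1 / ?n ^ (c + 10)" using n2 by simp
  finally show ?thesis .
qed

lemma crossing_subset: "E \<subseteq> pairs V \<Longrightarrow> crossing f E \<subseteq> pairs V"
  by (auto simp: crossing_def)

lemma prob_upper:
  assumes E: "E \<subseteq> pairs V"
  shows "measure_pmf.prob (sample V \<beta>) {\<omega>. \<not> upper \<omega> E} \<le> 1 / real (card V) ^ (c + 10)"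
proof -
  define Q where "Q = (\<lambda>i f \<omega>. card (crossing f E) \<le> \<mu> (Suc i) \<and>
    \<not> card {e \<in> crossing f E. i \<le> \<omega> e} \<le> 2 * \<beta> ^ i * \<mu> (Suc i))"
  have eq: "{\<omega>. \<not> upper \<omega> E} = {\<omega>. \<exists>i\<in>{..m}. \<exists>f\<in>V \<rightarrow>\<^sub>E V. Q i f \<omega>}"
    by (auto simp: upper_def Q_def)
  have "measure_pmf.prob (sample V \<beta>) {\<omega>. Q i f \<omega>} \<le> 2 * exp (- (T * card V / 8))" for i f
  proof (cases "card (crossing f E) \<le> \<mu> (Suc i)")
    case True
    let ?c = "real (card (crossing f E))"
    have le: "\<beta> ^ i * ?c \<le> \<beta> ^ i * \<mu> (Suc i)" using True \<beta> by (intro mult_left_mono) auto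
    have "measure_pmf.prob (sample V \<beta>) {\<omega>. Q i f \<omega>} \<le> measure_pmf.prob (sample V \<beta>)
      {\<omega>. \<not> \<bar>real (card {e \<in> crossing f E. i \<le> \<omega> e}) - \<beta> ^ i * ?c\<bar> < 1 * \<beta> ^ i * \<mu> (Suc i)}"
    proof (intro measure_pmf.finite_measure_mono subsetI CollectI notI)
      fix \<omega>
      assume "\<omega> \<in> {\<omega>. Q i f \<omega>}"
        "\<bar>real (card {e \<in> crossing f E. i \<le> \<omega> e}) - \<beta> ^ i * ?c\<bar> < 1 * \<beta> ^ i * \<mu> (Suc i)"
      then show False using le by (simp add: Q_def abs_less_iff)
    qed simp
    also have "\<dots> \<le> 2 * exp (- (1\<^sup>2 * \<beta> ^ i * \<mu> (Suc i) / 4))"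
      using True by (intro sample_deviation V \<beta> crossing_subset E) auto
    also have "\<dots> \<le> 2 * exp (- (T * card V / 8))"
    proof -
      have "real (T * card V) * \<beta> \<le> real (T * card V) * 4" using \<beta> by (intro mult_left_mono) auto
      then have "T * card V / 8 \<le> T * card V / (2 * \<beta>)" using \<beta> by (simp add: field_simps)
      then show ?thesis using \<mu>_Suc[of i] by simp
    qed
    finally show ?thesis .
  next
    case False
    then have "{\<omega>. Q i f \<omega>} = {}" by (simp add: Q_def)
    then show ?thesis by simp
  qed
  then show ?thesis unfolding eq using m by (intro prob_labels_le) auto
qed

lemma prob_lower:
  assumes E: "E \<subseteq> pairs V"
  shows "measure_pmf.prob (sample V \<beta>) {\<omega>. \<not> lower \<omega> E} \<le> 1 / real (card V) ^ (c + 10)"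
proof -
  define Q where "Q = (\<lambda>i f \<omega>. \<mu> i \<le> card (crossing f E) \<and>
    \<not> T * card V \<le> card {e \<in> crossing f E. i \<le> \<omega> e})"
  have eq: "{\<omega>. \<not> lower \<omega> E} = {\<omega>. \<exists>i\<in>{1..m}. \<exists>f\<in>V \<rightarrow>\<^sub>E V. Q i f \<omega>}"
    by (auto simp: lower_def Q_def)
  have "measure_pmf.prob (sample V \<beta>) {\<omega>. Q i f \<omega>} \<le> 2 * exp (- (T * card V / 8))" for i f
  proof (cases "\<mu> i \<le> card (crossing f E)")
    case True
    let ?c = "real (card (crossing f E))"
    have "\<beta> ^ i * \<mu> i \<le> \<beta> ^ i * ?c" using True \<beta> by (intro mult_left_mono) auto
    moreover have "\<beta> ^ i * \<mu> i = 2 * T * card V" using \<beta> by (simp add: \<mu>_def)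
    ultimately have ge: "2 * T * card V \<le> \<beta> ^ i * ?c" by simp
    have "measure_pmf.prob (sample V \<beta>) {\<omega>. Q i f \<omega>} \<le> measure_pmf.prob (sample V \<beta>)
      {\<omega>. \<not> \<bar>real (card {e \<in> crossing f E. i \<le> \<omega> e}) - \<beta> ^ i * ?c\<bar> < 1 / 2 * \<beta> ^ i * ?c}"
    proof (intro measure_pmf.finite_measure_mono subsetI CollectI notI)
      fix \<omega>
      assume "\<omega> \<in> {\<omega>. Q i f \<omega>}"
        and dev: "\<bar>real (card {e \<in> crossing f E. i \<le> \<omega> e}) - \<beta> ^ i * ?c\<bar> < 1 / 2 * \<beta> ^ i * ?c"
      then have "card {e \<in> crossing f E. i \<le> \<omega> e} < T * card V" by (simp add: Q_def)
      then have "real (card {e \<in> crossing f E. i \<le> \<omega> e}) < real (T * card V)" by (rule of_nat_less_iff[THEN iffD2])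
      then show False using ge dev by (simp add: abs_less_iff)
    qed simp
    also have "\<dots> \<le> 2 * exp (- ((1 / 2)\<^sup>2 * \<beta> ^ i * ?c / 4))"
      by (intro sample_deviation V \<beta> crossing_subset E) auto
    also have "\<dots> \<le> 2 * exp (- (T * card V / 8))"
      using ge by (simp add: power_divide)
    finally show ?thesis .
  next
    case False
    then have "{\<omega>. Q i f \<omega>} = {}" by (simp add: Q_def)
    then show ?thesis by simp
  qed
  then show ?thesis unfolding eq using m by (intro prob_labels_le) auto
qed

lemma \<kappa>_ge: "T / (2 * \<beta> ^ i) \<le> \<kappa> i"
  unfolding \<kappa>_def by (rule real_nat_ceiling_ge)

lemma \<kappa>_less: "k < \<kappa> i \<Longrightarrow> real k \<le> T / (2 * \<beta> ^ i)"
  unfolding \<kappa>_def by linarith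

text \<open>The at most n - 1 cuts of \<open>split_family\<close> are chosen from \<open>E\<close>
  before sampling. Each has expected sample size at most T / 2, and if all samples stay below T,
  every T-connected set of the sample lies in a set that is \<open>\<kappa> i\<close>-connected in
  \<open>E\<close>.\<close>

lemma prob_levels_strong:
  assumes E: "E \<subseteq> pairs V"
  shows "measure_pmf.prob (sample V \<beta>) {\<omega>. \<not> levels_strong \<omega> E} \<le> 1 / real (card V) ^ (c + 10)"
proof -
  let ?n = "real (card V)"
  have fE: "finite E" by (rule finite_simple[OF E])
  have "\<exists>\<F>. finite \<F> \<and> card \<F> \<le> card V - 1 \<and> (\<forall>X\<in>\<F>. X \<subseteq> E \<and> card X < \<kappa> i) \<and>
    (\<forall>E' t. E' \<subseteq> E \<longrightarrow> (\<forall>X\<in>\<F>. card (X \<inter> E') < t) \<longrightarrow>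
       (\<forall>D\<subseteq>V. D \<noteq> {} \<longrightarrow> tconn t E' D \<longrightarrow> inside V (\<kappa> i) E D))" for i
    by (rule split_family[OF V fE])
  then obtain \<F> where \<F>: "\<And>i. finite (\<F> i)" "\<And>i. card (\<F> i) \<le> card V - 1"
    "\<And>i X. X \<in> \<F> i \<Longrightarrow> X \<subseteq> E \<and> card X < \<kappa> i"
    "\<And>i E' t D. E' \<subseteq> E \<Longrightarrow> (\<forall>X\<in>\<F> i. card (X \<inter> E') < t) \<Longrightarrow>
       D \<subseteq> V \<Longrightarrow> D \<noteq> {} \<Longrightarrow> tconn t E' D \<Longrightarrow> inside V (\<kappa> i) E D"
    by metis
  have sub: "{\<omega>. \<not> levels_strong \<omega> E} \<subseteq> {\<omega>. \<exists>i\<in>{1..m}. \<exists>X\<in>\<F> i. \<not> card {e \<in> X. i \<le> \<omega> e} < T}"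
  proof (rule subsetI, rule ccontr)
    fix \<omega> assume h: "\<omega> \<in> {\<omega>. \<not> levels_strong \<omega> E}"
      "\<omega> \<notin> {\<omega>. \<exists>i\<in>{1..m}. \<exists>X\<in>\<F> i. \<not> card {e \<in> X. i \<le> \<omega> e} < T}"
    have "e \<in> strong i E" if i: "i \<in> {1..m}" and e: "e \<in> E" "inside V T (E \<inter> U \<omega> i) e" for i e
    proof -
      obtain D where D: "D \<subseteq> V" "e \<subseteq> D" "tconn T (E \<inter> U \<omega> i) D" using e(2) unfolding inside_def by blast
      have "card e = 2" using e(1) E by (auto simp: pairs_def)
      then have "D \<noteq> {}" using D(2) by auto
      have "card (X \<inter> (E \<inter> U \<omega> i)) < T" if X: "X \<in> \<F> i" for X
      proof -
        have "card (X \<inter> (E \<inter> U \<omega> i)) \<le> card {e \<in> X. i \<le> \<omega> e}"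
        proof (rule card_mono)
          have "finite X" using \<F>(3)[OF X] fE finite_subset by blast
          then show "finite {e \<in> X. i \<le> \<omega> e}" by simp
          show "X \<inter> (E \<inter> U \<omega> i) \<subseteq> {e \<in> X. i \<le> \<omega> e}" by (auto simp: U_def split: if_splits)
        qed
        also have "\<dots> < T" using h(2) i X by auto
        finally show ?thesis .
      qed
      then have "inside V (\<kappa> i) E D" using \<F>(4)[of "E \<inter> U \<omega> i" i T D] D \<open>D \<noteq> {}\<close> by blast
      then show ?thesis using inside_subset[OF D(2)] e(1) by (simp add: strong_def)
    qed
    then show False using h(1) by (auto simp: levels_strong_def)
  qed
  have one: "measure_pmf.prob (sample V \<beta>) {\<omega>. \<not> card {e \<in> X. i \<le> \<omega> e} < T} \<le> 2 / ?n ^ (c + 14)"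
    if X: "X \<in> \<F> i" for i X
  proof -
    let ?\<mu> = "T / (2 * \<beta> ^ i)"
    have cX: "real (card X) \<le> ?\<mu>" using \<kappa>_less \<F>(3)[OF X] by blast
    have b: "\<beta> ^ i > 0" using \<beta> by simp
    have half: "\<beta> ^ i * ?\<mu> = T / 2" using \<beta> by simp
    have le: "\<beta> ^ i * card X \<le> T / 2" using mult_left_mono[OF cX, of "\<beta> ^ i"] b half by simp
    have "measure_pmf.prob (sample V \<beta>) {\<omega>. \<not> card {e \<in> X. i \<le> \<omega> e} < T} \<le> measure_pmf.prob (sample V \<beta>)
      {\<omega>. \<not> \<bar>real (card {e \<in> X. i \<le> \<omega> e}) - \<beta> ^ i * card X\<bar> < 1 * \<beta> ^ i * ?\<mu>}"
    proof (intro measure_pmf.finite_measure_mono subsetI CollectI notI)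
      fix \<omega>
      assume "\<omega> \<in> {\<omega>. \<not> card {e \<in> X. i \<le> \<omega> e} < T}"
        and dev: "\<bar>real (card {e \<in> X. i \<le> \<omega> e}) - \<beta> ^ i * card X\<bar> < 1 * \<beta> ^ i * ?\<mu>"
      then have "real T \<le> real (card {e \<in> X. i \<le> \<omega> e})" by simp
      then show False using dev le half by (simp add: abs_less_iff)
    qed simp
    also have "\<dots> \<le> 2 * exp (- (1\<^sup>2 * \<beta> ^ i * ?\<mu> / 4))"
      using \<F>(3)[OF X] E by (intro sample_deviation V \<beta> cX) auto
    also have "1\<^sup>2 * \<beta> ^ i * ?\<mu> / 4 = T / 8" using \<beta> by simp
    also have "2 * exp (- (T / 8)) \<le> 2 / ?n ^ (c + 14)" using exp_T_le by simp
    finally show ?thesis .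
  qed
  have "measure_pmf.prob (sample V \<beta>) {\<omega>. \<exists>X\<in>\<F> i. \<not> card {e \<in> X. i \<le> \<omega> e} < T} \<le> ?n * (2 / ?n ^ (c + 14))" for i
  proof -
    have "measure_pmf.prob (sample V \<beta>) {\<omega>. \<exists>X\<in>\<F> i. \<not> card {e \<in> X. i \<le> \<omega> e} < T} \<le> card (\<F> i) * (2 / ?n ^ (c + 14))"
      by (rule prob_Bex_le[OF \<F>(1) one])
    also have "\<dots> \<le> ?n * (2 / ?n ^ (c + 14))"
      using \<F>(2)[of i] by (intro mult_right_mono) auto
    finally show ?thesis .
  qed
  then have "measure_pmf.prob (sample V \<beta>) {\<omega>. \<exists>i\<in>{1..m}. \<exists>X\<in>\<F> i. \<not> card {e \<in> X. i \<le> \<omega> e} < T}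
    \<le> card {1..m} * (?n * (2 / ?n ^ (c + 14)))"
    by (rule prob_Bex_le[OF finite_atLeastAtMost])
  also have "\<dots> \<le> ?n * (?n * (?n ^ 2 / ?n ^ (c + 14)))"
  proof (intro mult_mono divide_right_mono)
    have "2 ^ 1 \<le> ?n ^ 2" using n2 by (intro power_mono order_trans[of "2 ^ 1" "2 ^ 2" "?n ^ 2"]) auto
    then show "2 \<le> ?n ^ 2" by simp
  qed (use m in auto)
  also have "?n * (?n * (?n ^ 2 / ?n ^ (c + 14))) = ?n ^ 4 / ?n ^ (c + 14)"
    by (simp add: eval_nat_numeral)
  also have "?n ^ (c + 14) = ?n ^ 4 * ?n ^ (c + 10)" by (simp add: add_ac flip: power_add)
  also have "?n ^ 4 / (?n ^ 4 * ?n ^ (c + 10)) = 1 / ?n ^ (c + 10)" using n2 by simp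
  finally show ?thesis
    using measure_pmf.finite_measure_mono[OF sub, of "sample V \<beta>"] by simp
qed

text \<open>For fixed \<omega> the level sets are constants and can play the role of
  \<open>G\<close>.\<close>

lemma prob_concentrated:
  assumes E: "E \<subseteq> pairs V"
  shows "measure_pmf.prob (sample V \<beta>) {\<omega>'. \<not> concentrated \<omega> \<omega>' E} \<le> 1 / real (card V) ^ (c + 2)"
proof -
  let ?n = "real (card V)"
  define Q where "Q = (\<lambda>i \<omega>'. \<exists>S. bd (strong i E) S \<noteq> {} \<and>
    \<not> \<bar>real (card {e \<in> bd (strong i E) S \<inter> (B \<omega> i E - B \<omega> (i - 1) E). i \<le> \<omega>' e})
       - \<beta> ^ i * card (bd (strong i E) S \<inter> (B \<omega> i E - B \<omega> (i - 1) E))\<bar>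
     < \<epsilon> * \<beta> ^ i * card (bd (strong i E) S))"
  have eq: "{\<omega>'. \<not> concentrated \<omega> \<omega>' E} = {\<omega>'. \<exists>i\<in>{1..m}. Q i \<omega>'}"
    unfolding concentrated_def Q_def by blast
  have "measure_pmf.prob (sample V \<beta>) {\<omega>'. Q i \<omega>'} \<le> 1 / ?n ^ (c + 3)" for i
    unfolding Q_def strong_def
  proof (rule projection_concentration[OF V E n2 _ \<beta> \<epsilon>])
    have b: "\<beta> ^ i > 0" using \<beta> by simp
    have "0 < T / (2 * \<beta> ^ i)" using T_pos b by simp
    then show "\<kappa> i > 0" using \<kappa>_ge[of i] by simp
    have "T / 2 \<le> \<beta> ^ i * \<kappa> i" using \<kappa>_ge[of i] b by (simp add: field_simps)
    then have "\<epsilon>\<^sup>2 * (T / 2) \<le> \<epsilon>\<^sup>2 * (\<beta> ^ i * \<kappa> i)" by (intro mult_left_mono) auto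
    then show "real (c + 14) * ln (card V) \<le> \<epsilon>\<^sup>2 * \<beta> ^ i * \<kappa> i / 4" using big by simp
  qed
  then have "measure_pmf.prob (sample V \<beta>) {\<omega>'. \<exists>i\<in>{1..m}. Q i \<omega>'} \<le> card {1..m} * (1 / ?n ^ (c + 3))"
    by (rule prob_Bex_le[OF finite_atLeastAtMost])
  also have "\<dots> \<le> ?n * (1 / ?n ^ (c + 3))" using m by (intro mult_right_mono) auto
  also have "?n ^ (c + 3) = ?n * ?n ^ (c + 2)" by (simp add: eval_nat_numeral)
  also have "?n * (1 / (?n * ?n ^ (c + 2))) = 1 / ?n ^ (c + 2)" using n2 by simp
  finally show ?thesis unfolding eq .
qed

text \<open>Grouped as \<open>prob_pair_pmf_le\<close> expects: first the events of \<omega> alone,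
  then those of \<open>\<omega>'\<close> given \<omega>.\<close>

definition good :: "('v set \<Rightarrow> nat) \<Rightarrow> ('v set \<Rightarrow> nat) \<Rightarrow> 'v set set \<Rightarrow> bool" where
  "good \<omega> \<omega>' E \<longleftrightarrow> (lower \<omega> E \<and> upper \<omega> E \<and> levels_strong \<omega> E) \<and> (upper \<omega>' E \<and> concentrated \<omega> \<omega>' E)"

lemma prob_not_conj_le:
  "measure_pmf.prob p {x. \<not> (P x \<and> Q x)} \<le> measure_pmf.prob p {x. \<not> P x} + measure_pmf.prob p {x. \<not> Q x}"
proof -
  have "{x. \<not> (P x \<and> Q x)} = {x. \<not> P x} \<union> {x. \<not> Q x}" by auto
  then show ?thesis using measure_Un_le[of "{x. \<not> P x}" "measure_pmf p" "{x. \<not> Q x}"] by simp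
qed

lemma prob_good:
  assumes E: "E \<subseteq> pairs V"
  shows "measure_pmf.prob (pair_pmf (sample V \<beta>) (sample V \<beta>)) {(\<omega>, \<omega>'). good \<omega> \<omega>' E}
    \<ge> 1 - 1 / real (card V) ^ c"
proof -
  let ?n = "real (card V)" and ?P = "sample V \<beta>"
  let ?P2 = "pair_pmf ?P ?P"
  let ?a = "1 / ?n ^ (c + 10)" and ?b = "1 / ?n ^ (c + 2)"
  have 1: "measure_pmf.prob ?P {\<omega>. \<not> (lower \<omega> E \<and> upper \<omega> E \<and> levels_strong \<omega> E)} \<le> ?a + (?a + ?a)"
    by (intro order_trans[OF prob_not_conj_le] add_mono prob_lower prob_upper prob_levels_strong E)
  have 2: "measure_pmf.prob ?P {\<omega>'. \<not> (upper \<omega>' E \<and> concentrated \<omega> \<omega>' E)} \<le> ?a + ?b" for \<omega>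
    by (intro order_trans[OF prob_not_conj_le] add_mono prob_upper prob_concentrated E)
  have "measure_pmf.prob ?P2 {(\<omega>, \<omega>'). \<not> good \<omega> \<omega>' E} \<le> (?a + (?a + ?a)) + (?a + ?b)"
    unfolding good_def by (rule prob_pair_pmf_le[OF 1 2])
  also have "\<dots> = 4 * ?a + ?b" by simp
  also have "\<dots> \<le> 1 / ?n ^ c"
  proof -
    have n: "?n \<ge> 2" using n2 by simp
    have p: "?n ^ c > 0" using n by simp
    have "4 / ?n ^ 10 \<le> 4 / 2 ^ 10" using n by (intro divide_left_mono power_mono) auto
    moreover have "1 / ?n ^ 2 \<le> 1 / 2 ^ 2" using n by (intro divide_left_mono power_mono) auto
    ultimately have "4 / ?n ^ 10 + 1 / ?n ^ 2 \<le> 1" by simp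
    then have "(4 / ?n ^ 10 + 1 / ?n ^ 2) / ?n ^ c \<le> 1 / ?n ^ c" using p by (intro divide_right_mono) auto
    moreover have "(4 / ?n ^ 10 + 1 / ?n ^ 2) / ?n ^ c = 4 * ?a + ?b"
      unfolding power_add add_divide_distrib by (simp add: mult.commute)
    ultimately show ?thesis by simp
  qed
  finally have "measure_pmf.prob ?P2 {(\<omega>, \<omega>'). \<not> good \<omega> \<omega>' E} \<le> 1 / ?n ^ c" .
  moreover have "{(\<omega>, \<omega>'). \<not> good \<omega> \<omega>' E} = space (measure_pmf ?P2) - {(\<omega>, \<omega>'). good \<omega> \<omega>' E}" by auto
  ultimately show ?thesis
    using measure_pmf.prob_compl[of "{(\<omega>, \<omega>'). good \<omega> \<omega>' E}" ?P2] by simp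
qed

text \<open>One deterministic algorithm per pair of samples; the distribution over algorithms is the
  image of that of the samples. The query bound holds for every outcome because stages abort, and
  only correctness relies on \<open>good\<close>.\<close>

theorem finds_min_st_cut_exists:
  assumes R: "2 * (m + 2) \<le> R" and b: "card V + 1 \<le> 2 ^ b"
    and q: "real (m + 2) * (6 * card V + 12 * b * (8 * T * card V / \<beta>)) \<le> q"
  shows "\<exists>A. finds_min_st_cut A V s t R q (1 / real (card V) ^ c)"
proof -
  \<comment> \<open>The same limit serves the final stage, as 9 \<theta> n is at most 8 T n by 2
    \<theta> \<le> T.\<close>
  define M where "M = nat \<lfloor>8 * T * card V / \<beta>\<rfloor>"
  have Mle: "k \<le> M" if "real k \<le> 8 * T * card V / \<beta>" for k unfolding M_def using that by linarith
  have pos: "0 \<le> 8 * T * card V / \<beta>" using \<beta> by simp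
  have MM: "real M \<le> 8 * T * card V / \<beta>" unfolding M_def using pos by linarith
  have "\<exists>a. \<forall>E. simple_graph V E \<longrightarrow>
    (\<forall>i<R. \<forall>S\<in>set (round_queries a E i). S \<subseteq> V) \<and>
    num_queries a E R \<le> (m + 2) * (6 * card V + 12 * b * M) \<and>
    ((\<forall>k<m + 2. card (E \<inter> X (fst p) (snd p) k E) \<le> M) \<longrightarrow> result a (history a E R) = res (fst p) (snd p) E)" for p
  proof (rule staged_learning[OF V b R X_subset])
    fix k E E' assume k: "k < m + 2" and E: "E \<subseteq> pairs V" "E' \<subseteq> pairs V"
      and same: "\<And>j. j < k \<Longrightarrow> X (fst p) (snd p) j E = X (fst p) (snd p) j E' \<and>
        E \<inter> X (fst p) (snd p) j E = E' \<inter> X (fst p) (snd p) j E"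
    show "X (fst p) (snd p) k E = X (fst p) (snd p) k E'"
      by (rule X_determined[OF E _ same]) (use k in simp_all)
  next
    fix E E' assume "E \<subseteq> pairs V" "E' \<subseteq> pairs V"
      "\<And>j. j < m + 2 \<Longrightarrow> X (fst p) (snd p) j E = X (fst p) (snd p) j E' \<and>
        E \<inter> X (fst p) (snd p) j E = E' \<inter> X (fst p) (snd p) j E"
    then show "res (fst p) (snd p) E = res (fst p) (snd p) E'" by (rule res_determined)
  qed
  then obtain alg where alg: "\<And>p E. simple_graph V E \<Longrightarrow>
    (\<forall>i<R. \<forall>S\<in>set (round_queries (alg p) E i). S \<subseteq> V) \<and>
    num_queries (alg p) E R \<le> (m + 2) * (6 * card V + 12 * b * M) \<and>
    ((\<forall>k<m + 2. card (E \<inter> X (fst p) (snd p) k E) \<le> M) \<longrightarrow>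
      result (alg p) (history (alg p) E R) = res (fst p) (snd p) E)"
    by metis
  have num: "real ((m + 2) * (6 * card V + 12 * b * M)) \<le> q"
  proof -
    have "real ((m + 2) * (6 * card V + 12 * b * M)) = real (m + 2) * (6 * card V + 12 * b * M)"
      by (simp only: of_nat_mult)
    also have "\<dots> \<le> real (m + 2) * (6 * card V + 12 * b * (8 * T * card V / \<beta>))"
    proof -
      have "real (12 * b) * real M \<le> real (12 * b) * (8 * T * card V / \<beta>)"
        using MM by (rule mult_left_mono) simp
      then show ?thesis by (intro mult_left_mono) simp_all
    qed
    also have "\<dots> \<le> q" using q by simp
    finally show ?thesis .
  qed
  define P where "P = pair_pmf (sample V \<beta>) (sample V \<beta>)"
  have "finds_min_st_cut (map_pmf alg P) V s t R q (1 / real (card V) ^ c)"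
    unfolding finds_min_st_cut_def
  proof (intro allI impI conjI ballI)
    fix E a i S assume h: "simple_graph V E" "a \<in> set_pmf (map_pmf alg P)" "i < R" "S \<in> set (round_queries a E i)"
    then obtain p where "a = alg p" by auto
    then show "S \<subseteq> V" using alg[OF h(1), of p] h(3,4) by blast
  next
    fix E a assume E: "simple_graph V E" and "a \<in> set_pmf (map_pmf alg P)"
    then obtain p where "a = alg p" by auto
    then have "real (num_queries a E R) \<le> real ((m + 2) * (6 * card V + 12 * b * M))"
      using alg[OF E, of p] by (intro of_nat_mono) auto
    then show "real (num_queries a E R) \<le> q" using num by linarith
  next
    fix E assume sE: "simple_graph V E"
    then have E: "E \<subseteq> pairs V" by (simp add: simple_graph_iff)
    have "{(\<omega>, \<omega>'). good \<omega> \<omega>' E} \<subseteq> alg -` {a. result a (history a E R) = min_st_cut V E s t}"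
    proof
      fix p assume "p \<in> {(\<omega>, \<omega>'). good \<omega> \<omega>' E}"
      then obtain \<omega> \<omega>' where p: "p = (\<omega>, \<omega>')" "good \<omega> \<omega>' E" by auto
      note g = p(2)[unfolded good_def]
      have "card (E \<inter> X \<omega> \<omega>' k E) \<le> M" if "k < m + 2" for k
      proof (cases "k \<le> m")
        case True
        then show ?thesis using g by (intro Mle card_X_le[OF E]) auto
      next
        case False
        then have k: "k = Suc m" using that by simp
        have "real (card (E \<inter> X \<omega> \<omega>' k E)) \<le> 9 * \<theta> * card V"
          unfolding k using g by (intro res_correct(2)[OF E]) auto
        also have "\<dots> \<le> 8 * T * card V"
        proof -
          have "9 * \<theta> \<le> 8 * real T" using \<theta> by linarith
          then have "9 * \<theta> * real (card V) \<le> 8 * real T * real (card V)" by (rule mult_right_mono) simp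
          then show ?thesis by simp
        qed
        also have "\<dots> \<le> 8 * T * card V / \<beta>"
        proof -
          have "real (8 * T * card V) * \<beta> \<le> real (8 * T * card V) * 1" using \<beta> by (intro mult_left_mono) auto
          then show ?thesis using \<beta> by (simp add: field_simps)
        qed
        finally show ?thesis by (rule Mle)
      qed
      then have "result (alg p) (history (alg p) E R) = res \<omega> \<omega>' E" using alg[OF sE, of p] p(1) by simp
      also have "\<dots> = min_st_cut V E s t" using g by (intro res_correct(1)[OF E]) auto
      finally show "p \<in> alg -` {a. result a (history a E R) = min_st_cut V E s t}" by simp
    qed
    then have "measure_pmf.prob P {(\<omega>, \<omega>'). good \<omega> \<omega>' E}
      \<le> measure_pmf.prob P (alg -` {a. result a (history a E R) = min_st_cut V E s t})"
      by (intro measure_pmf.finite_measure_mono) auto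
    then show "1 - 1 / real (card V) ^ c
      \<le> measure_pmf.prob (map_pmf alg P) {a. result a (history a E R) = min_st_cut V E s t}"
      using prob_good[OF E] by (simp add: P_def)
  qed
  then show ?thesis by blast
qed

end

subsection \<open>The query bound\<close>

lemma log_bit_bound:
  fixes n :: nat
  assumes "n \<ge> 2"
  obtains b where "n + 1 \<le> 2 ^ b" "real b \<le> 3 * log 2 n"
proof
  let ?b = "nat \<lceil>log 2 (n + 1)\<rceil>"
  have L: "1 \<le> log 2 n" using assms by simp
  have pos: "0 \<le> log 2 (n + 1)" by simp
  have "real (n + 1) = 2 powr log 2 (n + 1)" by simp
  also have "\<dots> \<le> 2 powr real ?b" by (intro powr_mono real_nat_ceiling_ge) auto
  also have "\<dots> = 2 ^ ?b" by (rule powr_realpow) simp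
  also have "\<dots> = real (2 ^ ?b)" by (simp only: of_nat_power of_nat_numeral)
  finally show "n + 1 \<le> 2 ^ ?b" by (simp only: of_nat_le_iff)
  have "log 2 (n + 1) \<le> log 2 (2 * real n)" using assms by simp
  also have "\<dots> = 1 + log 2 n" using assms by (subst log_mult) auto
  finally show "real ?b \<le> 3 * log 2 n" using L pos by linarith
qed

text \<open>A single stage whose target is all pairs learns the graph exactly.\<close>

lemma brute_force_finds_min_st_cut:
  assumes V: "finite V" and b: "card V + 1 \<le> 2 ^ b" and R: "2 \<le> R" and \<delta>: "0 \<le> \<delta>"
    and q: "real (6 * card V + 12 * b * card V ^ 2) \<le> q"
  shows "\<exists>A. finds_min_st_cut A V s t R q \<delta>"
proof -
  have "\<exists>a. \<forall>E. simple_graph V E \<longrightarrow>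
    (\<forall>i<R. \<forall>S\<in>set (round_queries a E i). S \<subseteq> V) \<and>
    num_queries a E R \<le> 1 * (6 * card V + 12 * b * card V ^ 2) \<and>
    ((\<forall>k<1::nat. card (E \<inter> pairs V) \<le> card V ^ 2) \<longrightarrow> result a (history a E R) = min_st_cut V E s t)"
  proof (rule staged_learning[OF V b])
    fix E E' assume E: "E \<subseteq> pairs V" "E' \<subseteq> pairs V"
      and h: "\<And>j. j < (1::nat) \<Longrightarrow> pairs V = pairs V \<and> E \<inter> pairs V = E' \<inter> pairs V"
    have "E = E'" using h[of 0] E by auto
    then show "min_st_cut V E s t = min_st_cut V E' s t" by simp
  qed (use R in auto)
  then obtain a where a: "\<And>E. simple_graph V E \<Longrightarrow>
    (\<forall>i<R. \<forall>S\<in>set (round_queries a E i). S \<subseteq> V) \<and>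
    num_queries a E R \<le> 6 * card V + 12 * b * card V ^ 2 \<and>
    (card (E \<inter> pairs V) \<le> card V ^ 2 \<longrightarrow> result a (history a E R) = min_st_cut V E s t)"
    by auto
  have le: "card (E \<inter> pairs V) \<le> card V ^ 2" for E
    using card_mono[OF finite_pairs[OF V], of "E \<inter> pairs V"] card_pairs_le[OF V] by simp
  have "finds_min_st_cut (return_pmf a) V s t R q \<delta>"
    unfolding finds_min_st_cut_def
  proof (intro allI impI conjI ballI)
    fix E a' i S
    assume "simple_graph V E" "a' \<in> set_pmf (return_pmf a)" "i < R" "S \<in> set (round_queries a' E i)"
    then show "S \<subseteq> V" using a[of E] by auto
  next
    fix E a' assume "simple_graph V E" "a' \<in> set_pmf (return_pmf a)"
    then have "num_queries a' E R \<le> 6 * card V + 12 * b * card V ^ 2" using a[of E] by auto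
    then have "real (num_queries a' E R) \<le> real (6 * card V + 12 * b * card V ^ 2)" by (rule of_nat_mono)
    then show "real (num_queries a' E R) \<le> q" using q by linarith
  next
    fix E assume "simple_graph V E"
    then have "result a (history a E R) = min_st_cut V E s t" using a[of E] le[of E] by blast
    then show "1 - \<delta> \<le> measure_pmf.prob (return_pmf a) {a. result a (history a E R) = min_st_cut V E s t}"
      using \<delta> by simp
  qed
  then show ?thesis by blast
qed

lemma adaptive_finds_min_st_cut:
  fixes V :: "'v set" and r c :: nat
  assumes V: "finite V" and st: "s \<in> V" "t \<in> V" "s \<noteq> t"
    and r: "2 \<le> r" "real r \<le> log 2 (card V)"
  shows "\<exists>A. finds_min_st_cut A V s t (2 * r + 1)
    ((6 + 9504 * real (c + 14)) * card V powr (5 / 3 + 1 / r) * log 2 (card V) ^ 5) (1 / real (card V) ^ c)"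
proof -
  define n where "n = real (card V)"
  define L where "L = log 2 n"
  have "card {s,t} \<le> card V" using V st by (intro card_mono) auto
  then have n2: "card V \<ge> 2" using st by simp
  then have n: "n \<ge> 2" by (simp add: n_def)
  have rL: "real r \<le> L" using r(2) by (simp add: L_def n_def)
  have L: "L \<ge> 1" using rL r(1) by simp
  \<comment> \<open>The rate drops by n^(1/r) per level; this factor is the price paid in
    \<open>card_X_le\<close>.\<close>
  define \<beta> where "\<beta> = n powr (- (1 / r))"
  \<comment> \<open>The factor 2 L absorbs the at most L levels whose errors add up: \<epsilon> m
    \<le> n^(-1/3) / 2.\<close>
  define \<epsilon> where "\<epsilon> = n powr (- (1 / 3)) / (2 * L)"
  define \<theta> where "\<theta> = n powr (2 / 3)"
  \<comment> \<open>Solves the condition \<open>big\<close> for \<open>T\<close> with equality;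
    dividing by \<epsilon>^2 contributes the factor 4 L^2 \<theta>.\<close>
  define z where "z = 8 * (real (c + 14) * ln n) / \<epsilon>\<^sup>2"
  define T where "T = nat \<lceil>z\<rceil>"
  \<comment> \<open>Levels 0 to r - 2 and the final reading make r stages. Starting at level r - 2
    is possible because n^2 \<beta>^(r - 1) is at most n^(3/2) for r \<ge> 2, which is already below
    T n.\<close>
  define m where "m = r - 2"
  have \<beta>: "0 < \<beta>" "\<beta> < 1"
    using n r(1) powr_less_mono[of "- (1 / r)" 0 n] by (auto simp: \<beta>_def)
  have p13: "0 < n powr (- (1 / 3))" "n powr (- (1 / 3)) \<le> 1"
    using n powr_mono[of "- (1 / 3)" 0 n] by auto
  have \<epsilon>0: "0 < \<epsilon>" using p13 L by (simp add: \<epsilon>_def)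
  have \<epsilon>L: "\<epsilon> * L = n powr (- (1 / 3)) / 2" using L by (simp add: \<epsilon>_def)
  have "\<epsilon> \<le> \<epsilon> * L" using mult_left_mono[OF L, of \<epsilon>] \<epsilon>0 by simp
  then have \<epsilon>1: "\<epsilon> \<le> 1" using \<epsilon>L p13 by linarith
  have mL: "real m \<le> L" using rL by (simp add: m_def)
  have "2 powr real r \<le> 2 powr L" using rL by (intro powr_mono) auto
  then have "real (2 ^ r) \<le> real (card V)" using n by (simp add: L_def powr_realpow n_def)
  then have "2 ^ r \<le> card V" by (simp only: of_nat_le_iff)
  moreover have "r < 2 ^ r" by (rule less_exp)
  ultimately have mV: "m \<le> card V" unfolding m_def by linarith
  have ln2: "1 / 2 \<le> ln n"
  proof -
    have "ln 2 \<le> ln n" using n by simp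
    then show ?thesis using ln2_ge_two_thirds by linarith
  qed
  have lnL: "ln n \<le> L"
  proof -
    have "ln n = L * ln 2" by (simp add: L_def log_def)
    also have "\<dots> \<le> L * 1" using L ln_2_less_1 by (intro mult_left_mono) auto
    finally show ?thesis by simp
  qed
  have sq: "(n powr (- (1 / 3)))\<^sup>2 = 1 / \<theta>"
    using n by (simp add: \<theta>_def powr_minus_divide power2_eq_square flip: powr_add)
  have z: "z = 32 * real (c + 14) * ln n * L\<^sup>2 * \<theta>"
    using L by (simp add: z_def \<epsilon>_def power_divide power_mult_distrib sq)
  have \<theta>1: "1 \<le> \<theta>" using n ge_one_powr_ge_zero[of n "2 / 3"] by (simp add: \<theta>_def)
  have L2: "1 \<le> L\<^sup>2" using L by simp
  have z\<theta>: "2 * \<theta> \<le> z"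
  proof -
    have "14 * (1 / 2) \<le> real (c + 14) * ln n" using ln2 by (intro mult_mono) auto
    then have "7 * 1 \<le> real (c + 14) * ln n * L\<^sup>2" using L2 by (intro mult_mono) auto
    then have "7 * \<theta> \<le> real (c + 14) * ln n * L\<^sup>2 * \<theta>" using \<theta>1 by (intro mult_right_mono) auto
    moreover have "z = 32 * (real (c + 14) * ln n * L\<^sup>2 * \<theta>)" by (simp add: z)
    ultimately show ?thesis using \<theta>1 by linarith
  qed
  have Tz: "z \<le> T" "T \<le> z + 1" unfolding T_def using z\<theta> \<theta>1 by linarith+
  have spars: "sparsifier V s t T m c \<beta> \<epsilon> \<theta>"
  proof
    show "finite V" "s \<in> V" "t \<in> V" "s \<noteq> t" by fact+
    show "0 < \<beta>" "\<beta> < 1" "0 < \<epsilon>" "\<epsilon> \<le> 1" "m \<le> card V" "1 \<le> \<theta>" by fact+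
    have "real (c + 14) * ln n = \<epsilon>\<^sup>2 * z / 8" using \<epsilon>0 by (simp add: z_def)
    also have "\<dots> \<le> \<epsilon>\<^sup>2 * T / 8" using Tz(1) by (intro divide_right_mono mult_left_mono) auto
    finally show "real (c + 14) * ln (card V) \<le> \<epsilon>\<^sup>2 * T / 8" by (simp add: n_def)
    show T\<theta>: "2 * \<theta> \<le> T" using z\<theta> Tz(1) by linarith
    show "\<epsilon> * m \<le> 1 / 2"
      using mult_left_mono[OF mL, of \<epsilon>] \<epsilon>0 \<epsilon>L p13 by linarith
    have "2 * (\<epsilon> * m) * n \<le> 2 * (\<epsilon> * L) * n"
      using mL \<epsilon>0 n by (intro mult_right_mono mult_left_mono) auto
    also have "\<dots> = n powr (- (1 / 3)) * n powr 1" using \<epsilon>L n by simp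
    also have "\<dots> = \<theta>" unfolding \<theta>_def powr_add[symmetric] by simp
    finally show "2 * (\<epsilon> * m) * card V \<le> \<theta>" by (simp add: n_def)
    have "sqrt n = n powr (1 / 2)" using n by (simp add: powr_half_sqrt)
    also have "\<dots> \<le> \<theta>" unfolding \<theta>_def using n by (intro powr_mono) auto
    finally show "sqrt (card V) \<le> \<theta>" by (simp add: n_def)
    have "\<beta> ^ Suc m = \<beta> powr real (Suc m)" using \<beta>(1) by (simp only: powr_realpow)
    also have "\<dots> = n powr (- (1 / r) * real (Suc m))" by (simp only: \<beta>_def powr_powr)
    also have "\<dots> \<le> n powr (- (1 / 2))"
    proof (intro powr_mono)
      have "real (Suc m) = real r - 1" using r(1) by (simp add: m_def of_nat_diff)
      moreover have "1 / r \<le> 1 / 2" using r(1) by (simp add: field_simps)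
      ultimately show "- (1 / r) * real (Suc m) \<le> - (1 / 2)" using r(1) by (simp add: field_simps)
    qed (use n in auto)
    finally have "n ^ 2 * \<beta> ^ Suc m \<le> n powr 2 * n powr (- (1 / 2))"
      using n by (simp add: mult_left_mono)
    also have "\<dots> = n powr (3 / 2)" by (simp flip: powr_add)
    also have "\<dots> \<le> n powr (5 / 3)" using n by (intro powr_mono) auto
    also have "\<dots> = \<theta> * n powr 1" unfolding \<theta>_def powr_add[symmetric] by simp
    also have "\<dots> = \<theta> * n" using n by simp
    also have "\<dots> \<le> 2 * T * n" using T\<theta> \<theta>1 n by (intro mult_right_mono) auto
    finally have "n ^ 2 * \<beta> ^ Suc m \<le> 2 * T * n" .
    then show "real (card V) ^ 2 \<le> 2 * T * card V / \<beta> ^ Suc m"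
      using \<beta>(1) by (simp add: n_def field_simps)
  qed
  obtain b where b: "card V + 1 \<le> 2 ^ b" "real b \<le> 3 * L"
    using log_bit_bound[OF n2] by (auto simp: L_def n_def)
  define W where "W = n powr (5 / 3 + 1 / r)"
  have \<theta>W: "\<theta> * n / \<beta> = W"
  proof -
    have n1: "n powr 1 = n" using n by simp
    have "inverse \<beta> = n powr (1 / r)" unfolding \<beta>_def powr_minus by (rule inverse_inverse_eq)
    then have "\<theta> * n / \<beta> = n powr (2 / 3) * n powr 1 * n powr (1 / r)"
      unfolding n1 \<theta>_def divide_inverse[of _ \<beta>] by (simp only:)
    also have "\<dots> = W" unfolding W_def powr_add[symmetric] by simp
    finally show ?thesis .
  qed
  have nW: "n \<le> W"
  proof -
    have "0 \<le> 1 / real r" by simp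
    then have "1 \<le> 5 / 3 + 1 / real r" by linarith
    then show ?thesis using n powr_mono[of 1 "5 / 3 + 1 / r" n] by (simp add: W_def)
  qed
  have T_le: "real T \<le> 33 * real (c + 14) * L ^ 3 * \<theta>"
  proof -
    have "real (c + 14) * ln n * L\<^sup>2 * \<theta> \<le> real (c + 14) * L * L\<^sup>2 * \<theta>"
      using lnL \<theta>1 by (intro mult_right_mono mult_left_mono) auto
    also have "\<dots> = real (c + 14) * L ^ 3 * \<theta>" by (simp only: power2_eq_square power3_eq_cube mult_ac)
    finally have "32 * (real (c + 14) * ln n * L\<^sup>2 * \<theta>) \<le> 32 * (real (c + 14) * L ^ 3 * \<theta>)"
      by (rule mult_left_mono) simp
    moreover have "32 * (real (c + 14) * ln n * L\<^sup>2 * \<theta>) = z" unfolding z by (simp only: mult.assoc)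
    ultimately have "z \<le> 32 * (real (c + 14) * L ^ 3 * \<theta>)" by (simp only:)
    moreover have "1 * 1 * 1 \<le> real (c + 14) * L ^ 3 * \<theta>"
      using L \<theta>1 by (intro mult_mono) auto
    ultimately have "z + 1 \<le> 33 * (real (c + 14) * L ^ 3 * \<theta>)" by linarith
    then have "real T \<le> 33 * (real (c + 14) * L ^ 3 * \<theta>)" using Tz(2) by (rule order_trans[rotated])
    then show ?thesis by (simp only: mult.assoc)
  qed
  \<comment> \<open>36 = 12 * 3 comes from \<open>b\<close>, and 264 = 8 * 33 from the bound on
    \<open>T\<close>, where 33 is 32 plus 1 for the ceiling; 9504 is their product. Of the final
    L^5, one factor comes from \<open>b\<close>, three from \<open>T\<close> and one from the r
    stages.\<close>
  have "real (12 * b) * (8 * T * n / \<beta>) \<le> (36 * L) * (264 * (real (c + 14) * L ^ 3 * W))"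
  proof (rule mult_mono)
    have "8 * T * n / \<beta> \<le> 8 * (33 * real (c + 14) * L ^ 3 * \<theta>) * n / \<beta>"
      using T_le n \<beta> by (intro divide_right_mono mult_right_mono) auto
    also have "\<dots> = 264 * (real (c + 14) * L ^ 3 * (\<theta> * n / \<beta>))" by simp
    finally show "8 * T * n / \<beta> \<le> 264 * (real (c + 14) * L ^ 3 * W)" by (simp only: \<theta>W)
    show "0 \<le> 8 * T * n / \<beta>" using n \<beta> by simp
  qed (use b(2) L in auto)
  also have "\<dots> = 9504 * real (c + 14) * (W * L ^ 4)" by (simp add: eval_nat_numeral)
  finally have big: "real (12 * b) * (8 * T * n / \<beta>) \<le> 9504 * real (c + 14) * (W * L ^ 4)" .
  have small: "6 * n \<le> 6 * (W * L ^ 4)"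
    using nW L n mult_mono[of n W 1 "L ^ 4"] by simp
  have "real r * (6 * n + real (12 * b) * (8 * T * n / \<beta>)) \<le> L * ((6 + 9504 * real (c + 14)) * (W * L ^ 4))"
  proof (rule mult_mono[OF rL])
    show "6 * n + real (12 * b) * (8 * T * n / \<beta>) \<le> (6 + 9504 * real (c + 14)) * (W * L ^ 4)"
      using add_mono[OF small big] by (simp only: distrib_right)
    show "0 \<le> 6 * n + real (12 * b) * (8 * T * n / \<beta>)" using n \<beta> by simp
  qed (use L in auto)
  also have "\<dots> = (6 + 9504 * real (c + 14)) * W * L ^ 5" by (simp add: eval_nat_numeral)
  finally have q: "real r * (6 * n + real (12 * b) * (8 * T * n / \<beta>)) \<le> (6 + 9504 * real (c + 14)) * W * L ^ 5" .
  have mr: "m + 2 = r" using r(1) by (simp add: m_def)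
  have "\<exists>A. finds_min_st_cut A V s t (2 * r + 1) ((6 + 9504 * real (c + 14)) * W * L ^ 5) (1 / real (card V) ^ c)"
  proof (rule sparsifier.finds_min_st_cut_exists[OF spars _ b(1)])
    show "2 * (m + 2) \<le> 2 * r + 1" unfolding mr by simp
    show "real (m + 2) * (6 * card V + 12 * real b * (8 * T * card V / \<beta>)) \<le> (6 + 9504 * real (c + 14)) * W * L ^ 5"
      using q unfolding mr by (simp add: n_def)
  qed
  then show ?thesis by (simp add: W_def L_def n_def)
qed

theorem mainTheorem5:
  fixes c :: nat
  shows "\<exists>(C::real) (k::nat). \<forall>(V::'v set) (s::'v) (t::'v) (r::nat).
    finite V \<longrightarrow> s \<in> V \<longrightarrow> t \<in> V \<longrightarrow> s \<noteq> t \<longrightarrow>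
    1 \<le> r \<longrightarrow> real r \<le> log 2 (real (card V)) \<longrightarrow>
    (\<exists>A. finds_min_st_cut A V s t (2 * r + 1)
      (C * real (card V) powr (5 / 3 + 1 / real r) * log 2 (real (card V)) ^ k)
      (1 / real (card V) ^ c))"
proof (rule exI[of _ "6 + 9504 * real (c + 14)"], rule exI[of _ 5], intro allI impI)
  fix V :: "'v set" and s t :: 'v and r :: nat
  assume V: "finite V" and st: "s \<in> V" "t \<in> V" "s \<noteq> t"
    and r: "1 \<le> r" "real r \<le> log 2 (real (card V))"
  let ?C = "6 + 9504 * real (c + 14)" and ?n = "real (card V)" and ?L = "log 2 (real (card V))"
  show "\<exists>A. finds_min_st_cut A V s t (2 * r + 1) (?C * ?n powr (5 / 3 + 1 / real r) * ?L ^ 5) (1 / ?n ^ c)"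
  \<comment> \<open>For r = 1 even one sampling level and a final stage would exceed the rounds; the
    exponent 8/3 instead pays for reading all pairs in one stage.\<close>
  proof (cases "r = 1")
    case True
    have "card {s,t} \<le> card V" using V st by (intro card_mono) auto
    then have n2: "card V \<ge> 2" using st by simp
    have L: "1 \<le> ?L" using r by simp
    obtain b where b: "card V + 1 \<le> 2 ^ b" "real b \<le> 3 * ?L" using log_bit_bound[OF n2] .
    have nn: "?n ^ 2 \<le> ?n powr (8 / 3)"
      using n2 powr_mono[of 2 "8 / 3" ?n] by simp
    have LL: "?L \<le> ?L ^ 5" using L self_le_power[of ?L 5] by simp
    have "12 * real b * ?n ^ 2 \<le> (36 * ?L ^ 5) * ?n powr (8 / 3)"
    proof (rule mult_mono)
      show "12 * real b \<le> 36 * ?L ^ 5" using b(2) LL by linarith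
    qed (use nn L in auto)
    moreover have "6 * ?n \<le> 6 * (?L ^ 5 * ?n powr (8 / 3))"
    proof -
      have "1 * ?n \<le> ?L ^ 5 * ?n powr (8 / 3)"
        using n2 L powr_mono[of 1 "8 / 3" ?n] by (intro mult_mono) auto
      then show ?thesis by simp
    qed
    moreover have "42 * (?L ^ 5 * ?n powr (8 / 3)) \<le> ?C * (?L ^ 5 * ?n powr (8 / 3))"
      using L by (intro mult_right_mono) auto
    ultimately have "6 * ?n + 12 * real b * ?n ^ 2 \<le> ?C * (?L ^ 5 * ?n powr (8 / 3))" by linarith
    then have q: "real (6 * card V + 12 * b * card V ^ 2) \<le> ?C * ?n powr (5 / 3 + 1 / real r) * ?L ^ 5"
      using True by (simp add: mult_ac)
    show ?thesis by (rule brute_force_finds_min_st_cut[OF V b(1) _ _ q]) (use r(1) in auto)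
  next
    case False
    then show ?thesis using adaptive_finds_min_st_cut[OF V st, of r c] r by simp
  qed
qed

end
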